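(* Assume that $\operatorname{pr}_{V_1}(X)=\mathbb K^{V_1}$, where $\operatorname{pr}_{V_1}\colon\mathbb K^{E_1'\cup V_1}\to\mathbb K^{V_1}$ is the canonical projection, and for $v\in V_1$ let $\xi^v\in X$ be such that $\xi^v|_{V_1}=\mathbf 1_{\{v\}}$. Then the operator $H$ associated with the form $\tau$ is given by $$D(H)=\bigl\{f\in\mathcal H_\Gamma:\ (f_e)_{e\in E_1}\in D(\hat H),\ \operatorname{tr}(\iota f)\in X,\ Q_0\operatorname{str}(\iota f)'=Q_0L\operatorname{tr}(\iota f)\bigr\},$$ $$((Hf)_e)_{e\in E_1}=\hat H(f_e)_{e\in E_1},$$ $$(Hf)_v=\frac1{\mu_v}\bigl(L\operatorname{tr}(\iota f)-\operatorname{str}(\iota f)'\mid\xi^v\bigr)\qquad(v\in V_1).$$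
   Context: **Setting.** $\mathbb K\in\{\mathbb R,\mathbb C\}$; all function spaces consist of $\mathbb K$-valued functions. $\Gamma=(V,E,\gamma)$ is a finite directed graph: $V$ (vertices) and $E$ (edges) are finite disjoint sets and $\gamma=(\gamma_0,\gamma_1)\colon E\to V\times V$ assigns to each edge a starting vertex $\gamma_0(e)$ and an end vertex $\gamma_1(e)$. Each $e\in E$ corresponds to an interval $[a_e,b_e]\subseteq\mathbb R$, $a_e<b_e$, and carries a finite Borel measure $\mu_e$ on $[a_e,b_e]$ such that either $\mu_e=0$, or $a_e,b_e\in\operatorname{spt}\mu_e$ and $\mu_e(\{a_e,b_e\})=0$. Put $E_0:=\{e\in E:\mu_e=0\}$, $E_1:=E\setminus E_0$. Each $v\in V$ has a weight $\mu_v\geq0$; put $V_0:=\{v\in V:\mu_v=0\}$, $V_1:=V\setminus V_0$. **Hilbert space.** $\mathcal H_\Gamma:=\mathcal H_E\oplus\mathbb K^{V_1}$ with $\mathcal H_E:=\bigoplus_{e\in E_1}L_2([a_e,b_e],\mu_e)$ and scalar product $(f\mid g)_{\mathcal H_\Gamma}=\sum_{e\in E_1}(f_e\mid g_e)_{L_2([a_e,b_e],\mu_e)}+\sum_{v\in V_1}f_v\overline{g_v}\,\mu_v$ for $f=((f_e)_{e\in E_1},(f_v)_{v\in V_1})$ and $g$ likewise. **The map $\iota$.** For $e\in E_1$ let $C_{\mu_e}[a_e,b_e]$ be the set of $f\in C[a_e,b_e]$ that are affine linear on the components of $[a_e,b_e]\setminus\operatorname{spt}\mu_e$, and $W^1_{2,\mu_e}(a_e,b_e):=W^1_2(a_e,b_e)\cap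 C_{\mu_e}[a_e,b_e]$. Let $D(\iota_e)$ be the set of $f\in L_2([a_e,b_e],\mu_e)$ for which there is $g\in W^1_2(a_e,b_e)\cap C[a_e,b_e]$ with $g=f$ $\mu_e$-a.e. For $f\in D(\iota_e)$, $\iota_ef$ denotes the unique $g\in W^1_{2,\mu_e}(a_e,b_e)$ with $g=f$ $\mu_e$-a.e. (existence and uniqueness are known). Define $D(\iota):=\{f\in\mathcal H_\Gamma: f_e\in D(\iota_e)\ (e\in E_1)\}$, $(\iota f)_e:=\iota_ef_e$ $(e\in E_1)$, $(\iota f)_v:=f_v$ $(v\in V_1)$. Shorthand: $(\iota f)':=((\iota_ef_e)')_{e\in E_1}$. **Trace.** With $E_1':=E_1\times\{0,1\}$, define $\operatorname{tr}\colon\prod_{e\in E_1}C[a_e,b_e]\times\mathbb K^{V_1}\to\mathbb K^{E_1'\cup V_1}$ by $\operatorname{tr}f(e,0):=f_e(a_e)$, $\operatorname{tr}f(e,1):=f_e(b_e)$ $(e\in E_1)$, $\operatorname{tr}f(v):=f_v$ $(v\in V_1)$. The space $\mathbb K^{E_1'\cup V_1}$ has the scalar product $(\xi\mid\eta):=\sum_{(e,j)\in E_1'}\xi(e,j)\overline{\eta(e,j)}+\sum_{v\in V_1}\xi(v)\overline{\eta(v)}\,\mu_v$. **Form.** Let $X$ be a subspace of $\mathbb K^{E_1'\cup V_1}$ and $L$ a self-adjoint operator in $X$ (with respect to the scalar product $(\xi\mid\eta)=\sum_{(e,j)\in E_1'}\xi(e,j)\overline{\eta(e,j)}+\sum_{v\in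 V_1}\xi(v)\overline{\eta(v)}\,\mu_v$ of $\mathbb K^{E_1'\cup V_1}$, restricted to $X$). Define $$D(\tau):=\{f\in D(\iota):\operatorname{tr}(\iota f)\in X\},$$ $$\tau(f,g):=\sum_{e\in E_1}\int_{a_e}^{b_e}(\iota_ef_e)'(x)\overline{(\iota_eg_e)'(x)}\,dx+\bigl(L\operatorname{tr}(\iota f)\mid\operatorname{tr}(\iota g)\bigr)\qquad(f,g\in D(\tau)).$$ The condition $\operatorname{pr}_{V_1}(X)=\mathbb K^{V_1}$ means that $D(\tau)$ is dense in $\mathcal H_\Gamma$. The operator $H$ associated with $\tau$ is defined by: $f\in D(H)$ and $Hf=h$ if and only if $f\in D(\tau)$, $h\in\mathcal H_\Gamma$ and $\tau(f,g)=(h\mid g)_{\mathcal H_\Gamma}$ for all $g\in D(\tau)$. **Derivative with respect to $\mu$.** For an interval $[a,b]$ with a finite Borel measure $\mu$ ($a,b\in\operatorname{spt}\mu$, $\mu(\{a,b\})=0$): if $f\in L_{1,\mathrm{loc}}(a,b)$ and $g\in L_1([a,b],\mu)$ satisfy $f'=g\mu$ in the sense of distributions, then $\partial_\mu f:=g$ is the distributional derivative of $f$ with respect to $\mu$. Equivalently, $f(x)=c+\int_{(a,x)}g\,d\mu$ for a.e. $x$, for some $c\in\mathbb K$; so $f$ has representatives of bounded variation, whose one-sided limits exist and do not depend on the representative. **Maximal operator.** $D(\hat H)$ is the set of $f\in\prod_{e\in E_1}D(\iota_e)$ such that for all $e\in E_1$: $(\iota_ef_e)'\in L_1(a_e,b_e)$,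 $\partial_{\mu_e}(\iota_ef_e)'$ exists and $\partial_{\mu_e}(\iota_ef_e)'\in L_2([a_e,b_e],\mu_e)$; and $\hat Hf:=(-\partial_{\mu_e}(\iota_ef_e)')_{e\in E_1}$. **Signed trace.** With $BV(a_e,b_e)$ the functions of bounded variation (modulo a.e. equality), $\operatorname{str}\colon\prod_{e\in E_1}BV(a_e,b_e)\to\mathbb K^{E_1'}\subseteq\mathbb K^{E_1'\cup V_1}$ is defined by $\operatorname{str}f(e,0):=f_e(a_e+)$, $\operatorname{str}f(e,1):=-f_e(b_e-)$ (one-sided limits). $\mathbb K^{E_1'}$ is canonically included in $\mathbb K^{E_1'\cup V_1}$ (extension by $0$ on $V_1$). For $f$ with $(f_e)_{e\in E_1}\in D(\hat H)$, $\operatorname{str}(\iota f)'$ is formed with representatives of bounded variation of $(\iota_ef_e)'$. **Projection.** $X_0:=\{x\in X:\operatorname{pr}_{V_1}x=0\}=X\cap\mathbb K^{E_1'}$, and $Q_0$ is the orthogonal projection from $\mathbb K^{E_1'\cup V_1}$ onto $X_0$. *)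

theory Defs
  imports "HOL-Analysis.Analysis" "Graph_Theory.Digraph"
begin

section \<open>The scalar field\<close>

text \<open>
  The field of scalars is a type of sort \<open>{real_normed_field, euclidean_space}\<close>. A
  finite-dimensional commutative real division algebra is isomorphic to the real or the complex
  numbers; both types are instances of this sort. The inner product with \<open>1\<close> is the real part.
\<close>

definition conj_sc :: "'k::{real_normed_field,euclidean_space} \<Rightarrow> 'k" where
  "conj_sc z = of_real (2 * (z \<bullet> 1)) - z"

lemma conj_sc_real: "conj_sc (x :: real) = x"
  by (simp add: conj_sc_def)

lemma conj_sc_complex: "conj_sc (z :: complex) = cnj z"
  by (simp add: conj_sc_def inner_complex_def complex_eq_iff)


section \<open>Function spaces on an interval\<close>

definition sq_integrable :: "'x measure \<Rightarrow> ('x \<Rightarrow> 'k::{real_normed_field,euclidean_space}) set" where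
  "sq_integrable M = {f \<in> borel_measurable M. integrable M (\<lambda>x. (norm (f x))\<^sup>2)}"

definition L2_class :: "'x measure \<Rightarrow> ('x \<Rightarrow> 'k) \<Rightarrow> ('x \<Rightarrow> 'k::{real_normed_field,euclidean_space}) set" where
  "L2_class M f = {g \<in> sq_integrable M. AE x in M. g x = f x}"

text \<open>The elements of \<open>L2 M\<close> are equivalence classes modulo equality almost everywhere.\<close>

definition L2 :: "'x measure \<Rightarrow> ('x \<Rightarrow> 'k::{real_normed_field,euclidean_space}) set set" where
  "L2 M = L2_class M ` sq_integrable M"

definition rep :: "'y set \<Rightarrow> 'y" where
  "rep F = (SOME f. f \<in> F)"

definition L2_inner ::
  "'x measure \<Rightarrow> ('x \<Rightarrow> 'k) set \<Rightarrow> ('x \<Rightarrow> 'k) set \<Rightarrow> 'k::{real_normed_field,euclidean_space}" where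
  "L2_inner M F G = (LINT x|M. rep F x * conj_sc (rep G x))"

definition L1_loc :: "real \<Rightarrow> real \<Rightarrow> (real \<Rightarrow> 'k::{real_normed_field,euclidean_space}) set" where
  "L1_loc a b = {f. \<forall>c d. a < c \<and> d < b \<longrightarrow> set_integrable lborel {c..d} f}"

text \<open>Functions on \<open>[a,b]\<close> are extensional, so that they are determined by their values there.\<close>

definition cont_fun :: "real \<Rightarrow> real \<Rightarrow> (real \<Rightarrow> 'k::{real_normed_field,euclidean_space}) set" where
  "cont_fun a b = {f \<in> extensional {a..b}. continuous_on {a..b} f}"

definition test_fun :: "real \<Rightarrow> real \<Rightarrow> (real \<Rightarrow> real) set" where
  "test_fun a b = {\<phi>. (\<forall>n x. (deriv ^^ n) \<phi> field_differentiable at x) \<and>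
     (\<exists>c d. a < c \<and> d < b \<and> (\<forall>x. x \<notin> {c..d} \<longrightarrow> \<phi> x = 0))}"

text \<open>
  \<open>f' = g M\<close> on \<open>(a,b)\<close> in the sense of distributions. By linearity it suffices to test with
  real-valued functions, also for complex scalars.
\<close>

definition has_distr_deriv ::
  "real \<Rightarrow> real \<Rightarrow> real measure \<Rightarrow> (real \<Rightarrow> 'k) \<Rightarrow> (real \<Rightarrow> 'k::{real_normed_field,euclidean_space}) \<Rightarrow> bool" where
  "has_distr_deriv a b M f g \<longleftrightarrow> (\<forall>\<phi>\<in>test_fun a b.
     (LINT x:{a<..<b}|lborel. deriv \<phi> x *\<^sub>R f x) = - (LINT x:{a<..<b}|M. \<phi> x *\<^sub>R g x))"

text \<open>A representative of the weak derivative; it is determined almost everywhere on \<open>(a,b)\<close>.\<close>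

definition weak_deriv ::
  "real \<Rightarrow> real \<Rightarrow> (real \<Rightarrow> 'k) \<Rightarrow> real \<Rightarrow> 'k::{real_normed_field,euclidean_space}" where
  "weak_deriv a b f = (SOME g. g \<in> L1_loc a b \<and> has_distr_deriv a b lborel f g)"

definition W12 :: "real \<Rightarrow> real \<Rightarrow> (real \<Rightarrow> 'k::{real_normed_field,euclidean_space}) set" where
  "W12 a b = {f \<in> sq_integrable (restrict_space lborel {a<..<b}).
     \<exists>g \<in> sq_integrable (restrict_space lborel {a<..<b}). has_distr_deriv a b lborel f g}"

definition spt :: "real measure \<Rightarrow> real set" where
  "spt M = {x \<in> space M. \<forall>U. open U \<and> x \<in> U \<longrightarrow> emeasure M (U \<inter> space M) > 0}"

definition cont_fun_mu ::
  "real \<Rightarrow> real \<Rightarrow> real measure \<Rightarrow> (real \<Rightarrow> 'k::{real_normed_field,euclidean_space}) set" where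
  "cont_fun_mu a b M = {f \<in> cont_fun a b.
     \<forall>C \<in> components ({a..b} - spt M). \<exists>p q. \<forall>x\<in>C. f x = p + x *\<^sub>R q}"

definition W12_mu ::
  "real \<Rightarrow> real \<Rightarrow> real measure \<Rightarrow> (real \<Rightarrow> 'k::{real_normed_field,euclidean_space}) set" where
  "W12_mu a b M = W12 a b \<inter> cont_fun_mu a b M"

definition dom_iota1 ::
  "real \<Rightarrow> real \<Rightarrow> real measure \<Rightarrow> (real \<Rightarrow> 'k::{real_normed_field,euclidean_space}) set set" where
  "dom_iota1 a b M = {F \<in> L2 M. \<exists>g \<in> W12 a b \<inter> cont_fun a b. AE x in M. g x = rep F x}"

definition iota1 ::
  "real \<Rightarrow> real \<Rightarrow> real measure \<Rightarrow> (real \<Rightarrow> 'k) set \<Rightarrow> real \<Rightarrow> 'k::{real_normed_field,euclidean_space}" where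
  "iota1 a b M F = (THE g. g \<in> W12_mu a b M \<and> (AE x in M. g x = rep F x))"

definition has_mu_deriv ::
  "real \<Rightarrow> real \<Rightarrow> real measure \<Rightarrow> (real \<Rightarrow> 'k) \<Rightarrow> (real \<Rightarrow> 'k::{real_normed_field,euclidean_space}) \<Rightarrow> bool" where
  "has_mu_deriv a b M f g \<longleftrightarrow> f \<in> L1_loc a b \<and> integrable M g \<and> has_distr_deriv a b M f g"

text \<open>A representative of the derivative with respect to \<open>M\<close>; it is determined \<open>M\<close>-almost everywhere.\<close>

definition mu_deriv ::
  "real \<Rightarrow> real \<Rightarrow> real measure \<Rightarrow> (real \<Rightarrow> 'k) \<Rightarrow> real \<Rightarrow> 'k::{real_normed_field,euclidean_space}" where
  "mu_deriv a b M f = (SOME g. has_mu_deriv a b M f g)"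

definition bounded_var_on :: "real set \<Rightarrow> (real \<Rightarrow> 'k::real_normed_vector) \<Rightarrow> bool" where
  "bounded_var_on S f \<longleftrightarrow> (\<exists>B. \<forall>n t. (\<forall>i\<le>n. t i \<in> S) \<and> (\<forall>i<n. t i \<le> t (Suc i)) \<longrightarrow>
     (\<Sum>i<(n::nat). norm (f (t (Suc i)) - f (t i))) \<le> B)"

text \<open>
  One-sided limits of a function that is given modulo equality almost everywhere: they are formed
  with a representative of bounded variation and do not depend on it.
\<close>

definition BV_rep :: "real \<Rightarrow> real \<Rightarrow> (real \<Rightarrow> 'k) \<Rightarrow> (real \<Rightarrow> 'k::real_normed_vector) \<Rightarrow> bool" where
  "BV_rep a b f h \<longleftrightarrow>
     bounded_var_on {a<..<b} h \<and> (AE x in lborel. x \<in> {a<..<b} \<longrightarrow> h x = f x)"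

definition left_value :: "real \<Rightarrow> real \<Rightarrow> (real \<Rightarrow> 'k) \<Rightarrow> 'k::real_normed_vector" where
  "left_value a b f = (THE l. \<exists>h. BV_rep a b f h \<and> (h \<longlongrightarrow> l) (at_right a))"

definition right_value :: "real \<Rightarrow> real \<Rightarrow> (real \<Rightarrow> 'k) \<Rightarrow> 'k::real_normed_vector" where
  "right_value a b f = (THE l. \<exists>h. BV_rep a b f h \<and> (h \<longlongrightarrow> l) (at_left b))"


section \<open>Graphs with measures\<close>

record ('v, 'e) measure_graph =
  graph :: "('v, 'e) pre_digraph"
  lend :: "'e \<Rightarrow> real"
  rend :: "'e \<Rightarrow> real"
  emeas :: "'e \<Rightarrow> real measure"
  weight :: "'v \<Rightarrow> real"

definition measure_graph :: "('v, 'e) measure_graph \<Rightarrow> bool" where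
  "measure_graph G \<longleftrightarrow>
     fin_digraph (graph G) \<and>
     (\<forall>e \<in> arcs (graph G).
        lend G e < rend G e \<and>
        sets (emeas G e) = sets (restrict_space borel {lend G e..rend G e}) \<and>
        finite_measure (emeas G e) \<and>
        (emeasure (emeas G e) {lend G e..rend G e} = 0 \<or>
           lend G e \<in> spt (emeas G e) \<and> rend G e \<in> spt (emeas G e) \<and>
           emeasure (emeas G e) {lend G e, rend G e} = 0)) \<and>
     (\<forall>v \<in> verts (graph G). weight G v \<ge> 0)"

definition E1 :: "('v, 'e) measure_graph \<Rightarrow> 'e set" where
  "E1 G = {e \<in> arcs (graph G). emeasure (emeas G e) {lend G e..rend G e} \<noteq> 0}"

definition V1 :: "('v, 'e) measure_graph \<Rightarrow> 'v set" where
  "V1 G = {v \<in> verts (graph G). weight G v \<noteq> 0}"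

text \<open>
  The space of families of scalars indexed by \<open>I\<close>. Families vanish outside \<open>I\<close>, so that for
  \<open>J \<subseteq> I\<close> the extension by zero is the inclusion \<open>fam J \<subseteq> fam I\<close>.
\<close>

definition fam :: "'i set \<Rightarrow> ('i \<Rightarrow> 'k::zero) set" where
  "fam I = {x. \<forall>i. i \<notin> I \<longrightarrow> x i = 0}"

text \<open>Elements are pairs of an edge part, extensional on \<open>E1 G\<close>, and a vertex part in \<open>fam (V1 G)\<close>.\<close>

definition hilb :: "('v, 'e) measure_graph \<Rightarrow>
    (('e \<Rightarrow> (real \<Rightarrow> 'k) set) \<times> ('v \<Rightarrow> 'k::{real_normed_field,euclidean_space})) set" where
  "hilb G = (\<Pi>\<^sub>E e\<in>E1 G. L2 (emeas G e)) \<times> fam (V1 G)"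

definition hilb_inner :: "('v, 'e) measure_graph \<Rightarrow>
    ('e \<Rightarrow> (real \<Rightarrow> 'k) set) \<times> ('v \<Rightarrow> 'k) \<Rightarrow> ('e \<Rightarrow> (real \<Rightarrow> 'k) set) \<times> ('v \<Rightarrow> 'k) \<Rightarrow>
    'k::{real_normed_field,euclidean_space}" where
  "hilb_inner G f g = (\<Sum>e\<in>E1 G. L2_inner (emeas G e) (fst f e) (fst g e)) +
     (\<Sum>v\<in>V1 G. snd f v * conj_sc (snd g v) * of_real (weight G v))"

definition dom_iota_e :: "('v, 'e) measure_graph \<Rightarrow> 'e \<Rightarrow> (real \<Rightarrow> 'k::{real_normed_field,euclidean_space}) set set" where
  "dom_iota_e G e = dom_iota1 (lend G e) (rend G e) (emeas G e)"

definition iota_e :: "('v, 'e) measure_graph \<Rightarrow> 'e \<Rightarrow> (real \<Rightarrow> 'k) set \<Rightarrow> real \<Rightarrow> 'k::{real_normed_field,euclidean_space}" where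
  "iota_e G e = iota1 (lend G e) (rend G e) (emeas G e)"

definition dom_iota :: "('v, 'e) measure_graph \<Rightarrow>
    (('e \<Rightarrow> (real \<Rightarrow> 'k) set) \<times> ('v \<Rightarrow> 'k::{real_normed_field,euclidean_space})) set" where
  "dom_iota G = {f \<in> hilb G. \<forall>e\<in>E1 G. fst f e \<in> dom_iota_e G e}"

definition iota :: "('v, 'e) measure_graph \<Rightarrow> ('e \<Rightarrow> (real \<Rightarrow> 'k) set) \<times> ('v \<Rightarrow> 'k) \<Rightarrow>
    ('e \<Rightarrow> real \<Rightarrow> 'k) \<times> ('v \<Rightarrow> 'k::{real_normed_field,euclidean_space})" where
  "iota G f = (\<lambda>e\<in>E1 G. iota_e G e (fst f e), snd f)"

text \<open>\<open>edge_deriv G (fst (iota G f))\<close> is the family \<open>(\<iota> f)'\<close>.\<close>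

definition edge_deriv :: "('v, 'e) measure_graph \<Rightarrow> ('e \<Rightarrow> real \<Rightarrow> 'k) \<Rightarrow>
    'e \<Rightarrow> real \<Rightarrow> 'k::{real_normed_field,euclidean_space}" where
  "edge_deriv G u = (\<lambda>e\<in>E1 G. weak_deriv (lend G e) (rend G e) (u e))"


section \<open>Boundary values and the form\<close>

type_synonym ('v, 'e) bidx = "('e \<times> nat) + 'v"

definition bnd_idx :: "('v, 'e) measure_graph \<Rightarrow> ('v, 'e) bidx set" where
  "bnd_idx G = (E1 G \<times> {0, 1}) <+> V1 G"

definition bnd_inner :: "('v, 'e) measure_graph \<Rightarrow> (('v, 'e) bidx \<Rightarrow> 'k) \<Rightarrow> (('v, 'e) bidx \<Rightarrow> 'k) \<Rightarrow>
    'k::{real_normed_field,euclidean_space}" where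
  "bnd_inner G x y = (\<Sum>p\<in>E1 G \<times> {0, 1}. x (Inl p) * conj_sc (y (Inl p))) +
     (\<Sum>v\<in>V1 G. x (Inr v) * conj_sc (y (Inr v)) * of_real (weight G v))"

definition pr_V1 :: "(('v, 'e) bidx \<Rightarrow> 'k) \<Rightarrow> 'v \<Rightarrow> 'k" where
  "pr_V1 x = (\<lambda>v. x (Inr v))"

definition tr :: "('v, 'e) measure_graph \<Rightarrow> ('e \<Rightarrow> real \<Rightarrow> 'k) \<times> ('v \<Rightarrow> 'k) \<Rightarrow>
    ('v, 'e) bidx \<Rightarrow> 'k::{real_normed_field,euclidean_space}" where
  "tr G f i = (if i \<notin> bnd_idx G then 0 else
     (case i of Inl (e, j) \<Rightarrow> if j = 0 then fst f e (lend G e) else fst f e (rend G e)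
              | Inr v \<Rightarrow> snd f v))"

definition str :: "('v, 'e) measure_graph \<Rightarrow> ('e \<Rightarrow> real \<Rightarrow> 'k) \<Rightarrow>
    ('v, 'e) bidx \<Rightarrow> 'k::{real_normed_field,euclidean_space}" where
  "str G u i = (if i \<notin> bnd_idx G then 0 else
     (case i of Inl (e, j) \<Rightarrow> if j = 0 then left_value (lend G e) (rend G e) (u e)
                              else - right_value (lend G e) (rend G e) (u e)
              | Inr v \<Rightarrow> 0))"

definition bnd_subspace :: "('v, 'e) measure_graph \<Rightarrow> (('v, 'e) bidx \<Rightarrow> 'k::{real_normed_field,euclidean_space}) set \<Rightarrow> bool" where
  "bnd_subspace G X \<longleftrightarrow> X \<subseteq> fam (bnd_idx G) \<and> (\<lambda>i. 0) \<in> X \<and>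
     (\<forall>x\<in>X. \<forall>y\<in>X. (\<lambda>i. x i + y i) \<in> X) \<and> (\<forall>c. \<forall>x\<in>X. (\<lambda>i. c * x i) \<in> X)"

text \<open>
  On the finite-dimensional space \<open>X\<close>, the self-adjoint operators are the symmetric linear
  operators defined on all of \<open>X\<close>.
\<close>

definition selfadjoint_on :: "('v, 'e) measure_graph \<Rightarrow> (('v, 'e) bidx \<Rightarrow> 'k) set \<Rightarrow>
    ((('v, 'e) bidx \<Rightarrow> 'k) \<Rightarrow> (('v, 'e) bidx \<Rightarrow> 'k::{real_normed_field,euclidean_space})) \<Rightarrow> bool" where
  "selfadjoint_on G X L \<longleftrightarrow> L \<in> X \<rightarrow> X \<and>
     (\<forall>x\<in>X. \<forall>y\<in>X. L (\<lambda>i. x i + y i) = (\<lambda>i. L x i + L y i)) \<and>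
     (\<forall>c. \<forall>x\<in>X. L (\<lambda>i. c * x i) = (\<lambda>i. c * L x i)) \<and>
     (\<forall>x\<in>X. \<forall>y\<in>X. bnd_inner G (L x) y = bnd_inner G x (L y))"

definition X0 :: "(('v, 'e) bidx \<Rightarrow> 'k::{real_normed_field,euclidean_space}) set \<Rightarrow> (('v, 'e) bidx \<Rightarrow> 'k) set" where
  "X0 X = {x \<in> X. pr_V1 x = (\<lambda>v. 0)}"

definition orth_proj :: "('v, 'e) measure_graph \<Rightarrow> (('v, 'e) bidx \<Rightarrow> 'k) set \<Rightarrow>
    (('v, 'e) bidx \<Rightarrow> 'k) \<Rightarrow> ('v, 'e) bidx \<Rightarrow> 'k::{real_normed_field,euclidean_space}" where
  "orth_proj G Y x = (THE y. y \<in> Y \<and> (\<forall>z\<in>Y. bnd_inner G (\<lambda>i. x i - y i) z = 0))"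

definition dom_tau :: "('v, 'e) measure_graph \<Rightarrow> (('v, 'e) bidx \<Rightarrow> 'k) set \<Rightarrow>
    (('e \<Rightarrow> (real \<Rightarrow> 'k) set) \<times> ('v \<Rightarrow> 'k::{real_normed_field,euclidean_space})) set" where
  "dom_tau G X = {f \<in> dom_iota G. tr G (iota G f) \<in> X}"

definition tau :: "('v, 'e) measure_graph \<Rightarrow> ((('v, 'e) bidx \<Rightarrow> 'k) \<Rightarrow> (('v, 'e) bidx \<Rightarrow> 'k)) \<Rightarrow>
    ('e \<Rightarrow> (real \<Rightarrow> 'k) set) \<times> ('v \<Rightarrow> 'k) \<Rightarrow> ('e \<Rightarrow> (real \<Rightarrow> 'k) set) \<times> ('v \<Rightarrow> 'k) \<Rightarrow>
    'k::{real_normed_field,euclidean_space}" where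
  "tau G L f g =
     (\<Sum>e\<in>E1 G. LINT x:{lend G e<..<rend G e}|lborel.
        edge_deriv G (fst (iota G f)) e x * conj_sc (edge_deriv G (fst (iota G g)) e x)) +
     bnd_inner G (L (tr G (iota G f))) (tr G (iota G g))"


section \<open>The associated operator and the maximal operator\<close>

definition H_graph :: "('v, 'e) measure_graph \<Rightarrow> (('v, 'e) bidx \<Rightarrow> 'k) set \<Rightarrow>
    ((('v, 'e) bidx \<Rightarrow> 'k) \<Rightarrow> (('v, 'e) bidx \<Rightarrow> 'k)) \<Rightarrow>
    ((('e \<Rightarrow> (real \<Rightarrow> 'k) set) \<times> ('v \<Rightarrow> 'k)) \<times>
     (('e \<Rightarrow> (real \<Rightarrow> 'k) set) \<times> ('v \<Rightarrow> 'k::{real_normed_field,euclidean_space}))) set" where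
  "H_graph G X L = {(f, h). f \<in> dom_tau G X \<and> h \<in> hilb G \<and>
     (\<forall>g\<in>dom_tau G X. tau G L f g = hilb_inner G h g)}"

definition dom_H :: "('v, 'e) measure_graph \<Rightarrow> (('v, 'e) bidx \<Rightarrow> 'k) set \<Rightarrow>
    ((('v, 'e) bidx \<Rightarrow> 'k) \<Rightarrow> (('v, 'e) bidx \<Rightarrow> 'k)) \<Rightarrow>
    (('e \<Rightarrow> (real \<Rightarrow> 'k) set) \<times> ('v \<Rightarrow> 'k::{real_normed_field,euclidean_space})) set" where
  "dom_H G X L = Domain (H_graph G X L)"

definition H_op :: "('v, 'e) measure_graph \<Rightarrow> (('v, 'e) bidx \<Rightarrow> 'k) set \<Rightarrow>
    ((('v, 'e) bidx \<Rightarrow> 'k) \<Rightarrow> (('v, 'e) bidx \<Rightarrow> 'k)) \<Rightarrow>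
    ('e \<Rightarrow> (real \<Rightarrow> 'k) set) \<times> ('v \<Rightarrow> 'k) \<Rightarrow>
    ('e \<Rightarrow> (real \<Rightarrow> 'k) set) \<times> ('v \<Rightarrow> 'k::{real_normed_field,euclidean_space})" where
  "H_op G X L f = (THE h. (f, h) \<in> H_graph G X L)"

definition dom_Hhat :: "('v, 'e) measure_graph \<Rightarrow>
    ('e \<Rightarrow> (real \<Rightarrow> 'k::{real_normed_field,euclidean_space}) set) set" where
  "dom_Hhat G = {F \<in> (\<Pi>\<^sub>E e\<in>E1 G. dom_iota_e G e). \<forall>e\<in>E1 G.
     let a = lend G e; b = rend G e; M = emeas G e; u = weak_deriv a b (iota_e G e (F e)) in
       set_integrable lborel {a<..<b} u \<and>
       (\<exists>g. has_mu_deriv a b M u g) \<and> mu_deriv a b M u \<in> sq_integrable M}"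

definition Hhat :: "('v, 'e) measure_graph \<Rightarrow> ('e \<Rightarrow> (real \<Rightarrow> 'k) set) \<Rightarrow>
    'e \<Rightarrow> (real \<Rightarrow> 'k::{real_normed_field,euclidean_space}) set" where
  "Hhat G F = (\<lambda>e\<in>E1 G.
     let a = lend G e; b = rend G e; M = emeas G e; u = weak_deriv a b (iota_e G e (F e)) in
       L2_class M (\<lambda>x. - mu_deriv a b M u x))"

end

theory Submission
  imports Defs
begin

text \<open>
  The form is turned into the operator by one integration by parts on every edge. If the weak
  derivative \<open>u\<close> of \<open>\<iota> f\<close> on an edge has the derivative \<open>k\<close> with respect to the edge measure \<open>\<mu>\<close>, then
  \<open>u\<close> is almost everywhere the indefinite \<open>\<mu>\<close>-integral of \<open>k\<close> plus a constant, and Fubini's theorem on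
  a triangle yields Green's formula: the integral of \<open>u\<close> against the conjugate of \<open>(\<iota> g)'\<close> equals
  \<open>- (k | g)\<close> in the \<open>L2\<close> space of \<open>\<mu>\<close> plus boundary terms, which are the one-sided limits of \<open>u\<close> times
  end point values of \<open>\<iota> g\<close>. Summing over the edges,
  \<open>\<tau>(f, g) = (H^ f | g) + (L tr (\<iota> f) - str (\<iota> f)' | tr (\<iota> g))\<close> for \<open>f\<close> in the domain of the
  maximal operator (\<open>tau_eq_Hhat\<close>).

  Let \<open>(f, h)\<close> belong to the operator of the form. Testing with a test function \<open>\<phi>\<close> on one edge shows that \<open>- h\<close> is
  the derivative of \<open>(\<iota> f)'\<close> with respect to \<open>\<mu>\<close> (\<open>H_graph_mu_deriv\<close>). The form sees \<open>\<phi>\<close> only through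
  its class in \<open>L2\<close>, that is through the interpolant of \<open>\<phi>\<close> which is affine on the gaps of the support of
  \<open>\<mu>\<close>. Replacing \<open>\<phi>\<close> by the interpolant does not change the integral, since \<open>(\<iota> f)'\<close> is constant on
  the gaps and the difference of the two derivatives vanishes on the support and has mean value zero on every gap
  (\<open>interpolate_orthogonality\<close>). The averaging that defines the interpolant also proves that \<open>\<iota>\<close> is well
  defined.

  With \<open>h = H^ f\<close> on the edges, only \<open>(L tr (\<iota> f) - str (\<iota> f)' | \<eta>) = (h | \<eta>)\<close> on the vertices is left, for
  all traces \<open>\<eta>\<close> of elements of the form domain, and these are all elements of \<open>X\<close> (\<open>prescribed_trace\<close>). Since
  \<open>X\<close> is spanned by \<open>X0 X\<close> and the vectors \<open>\<xi> v\<close>, this amounts to the condition on the orthogonal projections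
  together with the formula for \<open>h\<close> on the vertices.
\<close>

section \<open>The conjugation of the scalar field\<close>

lemma inner_mult_mult:
  fixes z x y :: "'k::{real_normed_field,euclidean_space}"
  shows "(z * x) \<bullet> (z * y) = (norm z)\<^sup>2 * (x \<bullet> y)"
proof -
  have "norm (z * x + z * y) = norm z * norm (x + y)"
    by (metis distrib_left norm_mult)
  then show ?thesis
    unfolding dot_norm by (simp add: norm_mult power_mult_distrib algebra_simps diff_divide_distrib add_divide_distrib)
qed

text \<open>
  Conjugation is the adjoint of multiplication: replacing \<open>z\<close> by \<open>z + 1\<close> in \<open>inner_mult_mult\<close> linearizes that
  identity in \<open>z\<close>. Multiplicativity of the conjugation and the formula for \<open>z * conj_sc z\<close> follow from
  adjointness, without distinguishing real from complex scalars.
\<close>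

lemma inner_mult_conj:
  fixes z x y :: "'k::{real_normed_field,euclidean_space}"
  shows "x \<bullet> (z * y) = (conj_sc z * x) \<bullet> y"
proof -
  have "((z + 1) * x) \<bullet> ((z + 1) * y) = (norm (z + 1))\<^sup>2 * (x \<bullet> y)"
    by (rule inner_mult_mult)
  moreover have "(norm (z + 1))\<^sup>2 = (norm z)\<^sup>2 + 2 * (z \<bullet> 1) + 1"
    using dot_norm[of z 1] by simp
  ultimately have "(z * x) \<bullet> y + x \<bullet> (z * y) = 2 * (z \<bullet> 1) * (x \<bullet> y)"
    using inner_mult_mult[of z x y] by (simp add: distrib_right inner_add_left inner_add_right algebra_simps)
  then show ?thesis
    by (simp add: conj_sc_def left_diff_distrib inner_diff_left del: of_real_mult of_real_numeral flip: scaleR_conv_of_real)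
qed

lemma conj_sc_add [simp]: "conj_sc (x + y) = conj_sc x + conj_sc y"
  by (simp add: conj_sc_def inner_add_left algebra_simps)

lemma conj_sc_scaleR [simp]: "conj_sc (r *\<^sub>R x) = r *\<^sub>R conj_sc x"
  by (simp add: conj_sc_def of_real_def algebra_simps)

lemma conj_sc_of_real [simp]: "conj_sc (of_real r) = of_real r"
  by (simp add: conj_sc_def of_real_def dot_square_norm flip: scaleR_left_diff_distrib)

lemma conj_sc_0 [simp]: "conj_sc 0 = 0" and conj_sc_1 [simp]: "conj_sc 1 = 1"
  using conj_sc_of_real[of 0] conj_sc_of_real[of 1] by simp_all

lemma conj_sc_minus [simp]: "conj_sc (- x) = - conj_sc x"
  using conj_sc_scaleR[of "-1" x] by simp

lemma conj_sc_diff [simp]: "conj_sc (x - y) = conj_sc x - conj_sc y"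
  using conj_sc_add[of x "- y"] by simp

lemma conj_sc_mult [simp]: "conj_sc (x * y) = conj_sc x * conj_sc y"
proof -
  have "conj_sc (x * y) \<bullet> u = (conj_sc x * conj_sc y) \<bullet> u" for u
    using inner_mult_conj[of 1 "x * y" u] inner_mult_conj[of 1 x "y * u"]
      inner_mult_conj[of "conj_sc x" y u]
    by (simp add: ac_simps)
  then show ?thesis by (metis vector_eq_rdot)
qed

lemma norm_conj_sc [simp]: "norm (conj_sc x) = norm x"
proof -
  have "conj_sc x \<bullet> conj_sc x = x \<bullet> x"
    by (simp add: conj_sc_def inner_diff_left inner_diff_right of_real_def inner_commute[of 1 x] dot_square_norm[of 1])
  then have "(norm (conj_sc x))\<^sup>2 = (norm x)\<^sup>2"
    unfolding power2_norm_eq_inner .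
  then show ?thesis by (simp add: power2_eq_iff_nonneg)
qed

lemma mult_conj_sc: "x * conj_sc x = of_real ((norm x)\<^sup>2)"
proof -
  have "(x * conj_sc x) \<bullet> u = of_real ((norm x)\<^sup>2) \<bullet> u" for u
    using inner_mult_conj[of x x u] inner_mult_mult[of x 1 u]
    by (simp add: of_real_def mult.commute)
  then show ?thesis by (metis vector_eq_rdot)
qed

lemma bounded_linear_conj_sc: "bounded_linear conj_sc"
  by (rule bounded_linear_intro[where K = 1]) auto

lemma continuous_on_conj_sc [continuous_intros]:
  "continuous_on S f \<Longrightarrow> continuous_on S (\<lambda>x. conj_sc (f x))"
  using bounded_linear.continuous_on[OF bounded_linear_conj_sc] .

lemma borel_measurable_conj_sc [measurable]: "conj_sc \<in> borel_measurable borel"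
  using continuous_on_conj_sc[OF continuous_on_id, of UNIV] by (intro borel_measurable_continuous_onI) simp

section \<open>Orthogonal projections in finite dimensions\<close>

definition lin_subspace :: "('i \<Rightarrow> 'k::{real_normed_field,euclidean_space}) set \<Rightarrow> bool" where
  "lin_subspace Y \<longleftrightarrow> (\<lambda>i. 0) \<in> Y \<and> (\<forall>x\<in>Y. \<forall>y\<in>Y. (\<lambda>i. x i + y i) \<in> Y) \<and> (\<forall>c. \<forall>x\<in>Y. (\<lambda>i. c * x i) \<in> Y)"

definition weighted_inner ::
  "'i set \<Rightarrow> ('i \<Rightarrow> real) \<Rightarrow> ('i \<Rightarrow> 'k) \<Rightarrow> ('i \<Rightarrow> 'k) \<Rightarrow> 'k::{real_normed_field,euclidean_space}" where
  "weighted_inner I w x y = (\<Sum>i\<in>I. x i * conj_sc (y i) * of_real (w i))"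

lemma weighted_inner_diff_left: "weighted_inner I w (\<lambda>i. x i - y i) z = weighted_inner I w x z - weighted_inner I w y z"
  and weighted_inner_mult_left: "weighted_inner I w (\<lambda>i. c * x i) z = c * weighted_inner I w x z"
  and weighted_inner_add_right: "weighted_inner I w z (\<lambda>i. x i + y i) = weighted_inner I w z x + weighted_inner I w z y"
  and weighted_inner_mult_right: "weighted_inner I w z (\<lambda>i. c * x i) = conj_sc c * weighted_inner I w z x"
  by (simp_all add: weighted_inner_def sum.distrib sum_subtractf sum_distrib_left algebra_simps)

lemma weighted_inner_self:
  "weighted_inner I w x x = of_real (\<Sum>i\<in>I. (norm (x i))\<^sup>2 * w i)"
  by (simp add: weighted_inner_def mult_conj_sc)

lemma weighted_inner_self_eq_0D:
  assumes "finite I" "\<And>i. i \<in> I \<Longrightarrow> w i > 0" "weighted_inner I w x x = 0" "i \<in> I"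
  shows "x i = 0"
proof -
  have "(\<Sum>i\<in>I. (norm (x i))\<^sup>2 * w i) = 0"
    using assms(3) unfolding weighted_inner_self of_real_eq_0_iff .
  then have "(norm (x i))\<^sup>2 * w i = 0"
    using assms(1,2,4) by (subst (asm) sum_nonneg_eq_0_iff) (auto simp: order.strict_implies_order)
  then show ?thesis using assms(2)[OF assms(4)] by simp
qed

lemma lin_subspace_diff: "lin_subspace Y \<Longrightarrow> x \<in> Y \<Longrightarrow> y \<in> Y \<Longrightarrow> (\<lambda>i. x i - c * y i) \<in> Y"
proof -
  assume Y: "lin_subspace Y" "x \<in> Y" "y \<in> Y"
  then have "(\<lambda>i. (-c) * y i) \<in> Y" unfolding lin_subspace_def by blast
  then have "(\<lambda>i. x i + (-c) * y i) \<in> Y" using Y(1,2) unfolding lin_subspace_def by fast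
  then show ?thesis by simp
qed

text \<open>
  The projection onto \<open>Y\<close> is built one coordinate at a time: the elements of \<open>Y\<close> that vanish at
  \<open>j\<close> form a subspace of codimension at most one, and the defect is spanned by a single vector
  orthogonal to that subspace.
\<close>

lemma orthogonal_projection_exists:
  assumes "finite I" "\<And>i. i \<in> I \<Longrightarrow> w i > 0"
    and "finite J" "J \<subseteq> I" "Y \<subseteq> fam J" "lin_subspace Y"
  shows "\<exists>y\<in>Y. \<forall>z\<in>Y. weighted_inner I w (\<lambda>i. x i - y i) z = 0"
  using assms(3-)
proof (induction J arbitrary: x Y rule: finite_induct)
  case empty
  then have "Y = {\<lambda>i. 0}" by (auto simp: fam_def lin_subspace_def)
  then show ?case by (simp add: weighted_inner_def)
next
  case (insert j J)
  define Y' where "Y' = {y \<in> Y. y j = 0}"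
  have Y': "Y' \<subseteq> fam J" "lin_subspace Y'"
    using insert.prems by (auto simp: Y'_def fam_def lin_subspace_def)
  note proj = insert.IH[OF _ Y', OF order_trans[OF subset_insertI insert.prems(1)]]
  show ?case
  proof (cases "Y \<subseteq> Y'")
    case True
    then have "Y = Y'" by (auto simp: Y'_def)
    then show ?thesis using proj by simp
  next
    case False
    then obtain y1 where y1: "y1 \<in> Y" "y1 j \<noteq> 0" by (auto simp: Y'_def)
    define y0 where "y0 = (\<lambda>i. inverse (y1 j) * y1 i)"
    have y0: "y0 \<in> Y" "y0 j = 1" using y1 insert.prems(3) by (auto simp: y0_def lin_subspace_def)
    obtain p where p: "p \<in> Y'" "\<And>z. z \<in> Y' \<Longrightarrow> weighted_inner I w (\<lambda>i. y0 i - p i) z = 0"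
      using proj by blast
    define q where "q = (\<lambda>i. y0 i - p i)"
    have q: "q \<in> Y" "q j = 1" "\<And>z. z \<in> Y' \<Longrightarrow> weighted_inner I w q z = 0"
      using lin_subspace_diff[OF insert.prems(3) y0(1), of p 1] p y0 by (auto simp: q_def Y'_def)
    have "weighted_inner I w q q \<noteq> 0"
      using weighted_inner_self_eq_0D[OF assms(1,2), where x = q and i = j] q(2) insert.prems(1) by auto
    obtain x' where x': "x' \<in> Y'" "\<And>z. z \<in> Y' \<Longrightarrow> weighted_inner I w (\<lambda>i. x i - x' i) z = 0"
      using proj by blast
    define c where "c = weighted_inner I w (\<lambda>i. x i - x' i) q / weighted_inner I w q q"
    show ?thesis
    proof (intro bexI ballI)
      show "(\<lambda>i. x' i + c * q i) \<in> Y"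
        using x'(1) q(1) insert.prems(3) by (auto simp: Y'_def lin_subspace_def)
      fix z assume z: "z \<in> Y"
      define z' where "z' = (\<lambda>i. z i - z j * q i)"
      have z': "z' \<in> Y'"
        using lin_subspace_diff[OF insert.prems(3) z q(1)] q(2) by (auto simp: z'_def Y'_def)
      have *: "weighted_inner I w (\<lambda>i. x i - (x' i + c * q i)) u
          = weighted_inner I w (\<lambda>i. x i - x' i) u - c * weighted_inner I w q u" for u
        by (subst weighted_inner_mult_left[symmetric], subst weighted_inner_diff_left[symmetric])
           (simp add: algebra_simps)
      have "weighted_inner I w (\<lambda>i. x i - (x' i + c * q i)) (\<lambda>i. z' i + z j * q i)
          = weighted_inner I w (\<lambda>i. x i - (x' i + c * q i)) z'
            + conj_sc (z j) * weighted_inner I w (\<lambda>i. x i - (x' i + c * q i)) q"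
        unfolding weighted_inner_add_right weighted_inner_mult_right ..
      also have "\<dots> = 0"
        unfolding * using x'(2)[OF z'] q(3)[OF z'] \<open>weighted_inner I w q q \<noteq> 0\<close> by (simp add: c_def)
      finally show "weighted_inner I w (\<lambda>i. x i - (x' i + c * q i)) z = 0"
        by (simp add: z'_def)
    qed
  qed
qed

lemma bnd_inner_eq_weighted_inner:
  assumes "finite (E1 G)" "finite (V1 G)"
  shows "bnd_inner G x y = weighted_inner (bnd_idx G) (case_sum (\<lambda>_. 1) (weight G)) x y"
  using assms by (simp add: bnd_inner_def weighted_inner_def bnd_idx_def sum.Plus finite_cartesian_product)


section \<open>Test functions\<close>

text \<open>
  Smoothness of a concrete function is established by exhibiting a family of functions that contains it and is
  closed under differentiation.
\<close>

lemma derivatives_differentiable_of_closed: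
  fixes S :: "(real \<Rightarrow> real) set"
  assumes "\<And>f. f \<in> S \<Longrightarrow> \<exists>g\<in>S. \<forall>x. (f has_real_derivative g x) (at x)" and "f \<in> S"
  shows "(deriv ^^ n) f field_differentiable at x"
proof -
  have "(deriv ^^ n) f \<in> S"
  proof (induction n)
    case (Suc n)
    then obtain g where g: "g \<in> S" "\<And>x. ((deriv ^^ n) f has_real_derivative g x) (at x)"
      using assms(1) by blast
    then have "deriv ((deriv ^^ n) f) = g" by (intro ext DERIV_imp_deriv)
    then show ?case using g(1) by simp
  qed (use assms(2) in simp)
  then show ?thesis using assms(1) field_differentiable_def by blast
qed

text \<open>
  The standard smooth function that is flat at \<open>0\<close>; the polynomial factor makes the family closed under
  differentiation.
\<close>

definition flat_exp :: "real poly \<Rightarrow> real \<Rightarrow> real" where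
  "flat_exp p x = (if x > 0 then poly p (1 / x) * exp (- (1 / x)) else 0)"

lemma flat_exp_tendsto_0: "(flat_exp p \<longlongrightarrow> 0) (at_right 0)"
proof -
  have "((\<lambda>t. \<Sum>i\<le>degree p. coeff p i * (t ^ i / exp t)) \<longlongrightarrow> (\<Sum>i\<le>degree p. coeff p i * 0)) at_top"
    by (intro tendsto_sum tendsto_mult tendsto_const tendsto_power_div_exp_0)
  then have "((\<lambda>t. poly p t * exp (- t)) \<longlongrightarrow> 0) at_top"
    by (simp add: poly_altdef sum_distrib_right sum_divide_distrib exp_minus field_simps)
  from filterlim_compose[OF this filterlim_inverse_at_top_right]
  have "((\<lambda>x. poly p (1 / x) * exp (- (1 / x))) \<longlongrightarrow> 0) (at_right 0)"
    by (simp add: inverse_eq_divide)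
  then show ?thesis
    by (rule Lim_transform_eventually)
       (auto simp: flat_exp_def eventually_at_right_less intro: eventually_mono[OF eventually_at_right_less])
qed

text \<open>
  At \<open>0\<close> the difference quotient of \<open>flat_exp p\<close> from the right is \<open>flat_exp (pCons 0 p)\<close>, which tends to
  \<open>0\<close> since the exponential function dominates every power.
\<close>

lemma flat_exp_has_derivative:
  "(flat_exp p has_real_derivative flat_exp ([:0, 0, 1:] * (p - pderiv p)) x) (at x)"
proof -
  consider "x < 0" | "x > 0" | "x = 0" by linarith
  then show ?thesis
  proof cases
    case 1
    have "((\<lambda>_. 0) has_real_derivative 0) (at x)" by simp
    then show ?thesis
      using 1 by (simp add: flat_exp_def) (rule has_field_derivative_transform_within_open[of _ _ _ "{..<0}"], auto simp: flat_exp_def)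
  next
    case 2
    have "((\<lambda>x. poly p (1 / x) * exp (- (1 / x))) has_real_derivative
        flat_exp ([:0, 0, 1:] * (p - pderiv p)) x) (at x)"
      using 2 by (auto intro!: derivative_eq_intros poly_DERIV[THEN DERIV_chain2] simp: flat_exp_def field_simps power2_eq_square)
    then show ?thesis
      by (rule has_field_derivative_transform_within_open[of _ _ _ "{0<..}"]) (use 2 in \<open>auto simp: flat_exp_def\<close>)
  next
    case 3
    have "((\<lambda>h. (flat_exp p (0 + h) - flat_exp p 0) / h) \<longlongrightarrow> 0) (at 0)"
    proof (rule filterlim_split_at)
      have "((\<lambda>h. 0) \<longlongrightarrow> (0::real)) (at_left 0)" by simp
      then show "((\<lambda>h. (flat_exp p (0 + h) - flat_exp p 0) / h) \<longlongrightarrow> 0) (at_left 0)"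
        by (rule Lim_transform_eventually)
           (auto simp: flat_exp_def eventually_at_filter)
      show "((\<lambda>h. (flat_exp p (0 + h) - flat_exp p 0) / h) \<longlongrightarrow> 0) (at_right 0)"
        by (rule Lim_transform_eventually[OF flat_exp_tendsto_0[of "pCons 0 p"]])
           (auto simp: flat_exp_def eventually_at_filter)
    qed
    then show ?thesis using 3 by (simp add: DERIV_def flat_exp_def)
  qed
qed

inductive_set flat_algebra :: "(real \<Rightarrow> real) set" where
  flat: "(\<lambda>x. flat_exp p (r * x + s)) \<in> flat_algebra"
| add: "f \<in> flat_algebra \<Longrightarrow> g \<in> flat_algebra \<Longrightarrow> (\<lambda>x. f x + g x) \<in> flat_algebra"
| mult: "f \<in> flat_algebra \<Longrightarrow> g \<in> flat_algebra \<Longrightarrow> (\<lambda>x. f x * g x) \<in> flat_algebra"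

lemma flat_algebra_has_derivative:
  "f \<in> flat_algebra \<Longrightarrow> \<exists>g\<in>flat_algebra. \<forall>x. (f has_real_derivative g x) (at x)"
proof (induction rule: flat_algebra.induct)
  case (flat p r s)
  have "((\<lambda>x. flat_exp p (r * x + s)) has_real_derivative
      flat_exp (smult r ([:0, 0, 1:] * (p - pderiv p))) (r * x + s)) (at x)" for x
  proof -
    have "((\<lambda>x. r * x + s) has_real_derivative r) (at x)"
      by (auto intro!: derivative_eq_intros)
    moreover have "flat_exp (smult r q) y = flat_exp q y * r" for q y
      by (simp add: flat_exp_def)
    ultimately show ?thesis using DERIV_chain2[OF flat_exp_has_derivative] by metis
  qed
  then show ?case
    by (intro bexI[OF _ flat_algebra.flat[of "smult r ([:0, 0, 1:] * (p - pderiv p))" r s]]) auto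
next
  case (add f g)
  then obtain f' g' where *: "f' \<in> flat_algebra" "\<And>x. (f has_real_derivative f' x) (at x)"
     "g' \<in> flat_algebra" "\<And>x. (g has_real_derivative g' x) (at x)" by blast
  then show ?case
    by (intro bexI[OF _ flat_algebra.add[OF *(1,3)]]) (auto intro!: DERIV_add)
next
  case (mult f g)
  then obtain f' g' where *: "f' \<in> flat_algebra" "\<And>x. (f has_real_derivative f' x) (at x)"
     "g' \<in> flat_algebra" "\<And>x. (g has_real_derivative g' x) (at x)" by blast
  have "((\<lambda>x. f x * g x) has_real_derivative f' x * g x + g' x * f x) (at x)" for x
    using DERIV_mult[OF *(2,4)] .
  then show ?case
    by (intro bexI[OF _ flat_algebra.add[OF flat_algebra.mult[OF *(1) mult.hyps(2)] flat_algebra.mult[OF *(3) mult.hyps(1)]]]) auto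
qed

text \<open>
  Scaling the argument by \<open>Suc n\<close> takes the root of order \<open>Suc n\<close> of the bump function, so that the values in
  the open interval increase to \<open>1\<close>: the indicator is approximated without any normalization.
\<close>

definition cutoff :: "real \<Rightarrow> real \<Rightarrow> nat \<Rightarrow> real \<Rightarrow> real" where
  "cutoff c d n x = flat_exp 1 (real (Suc n) * (x - c)) * flat_exp 1 (real (Suc n) * (d - x))"

lemma cutoff_test_fun:
  assumes "a < c" "d < b"
  shows "cutoff c d n \<in> test_fun a b"
proof -
  have "(\<lambda>x. flat_exp 1 (real (Suc n) * x + - (real (Suc n) * c)) * flat_exp 1 (- real (Suc n) * x + real (Suc n) * d)) \<in> flat_algebra"
    by (intro flat_algebra.intros)
  moreover have "(\<lambda>x. flat_exp 1 (real (Suc n) * x + - (real (Suc n) * c)) * flat_exp 1 (- real (Suc n) * x + real (Suc n) * d)) = cutoff c d n"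
    by (auto simp: cutoff_def algebra_simps fun_eq_iff)
  ultimately have "cutoff c d n \<in> flat_algebra" by simp
  from derivatives_differentiable_of_closed[OF flat_algebra_has_derivative this]
  have "\<forall>m x. (deriv ^^ m) (cutoff c d n) field_differentiable at x" by auto
  moreover have "\<forall>x. x \<notin> {c..d} \<longrightarrow> cutoff c d n x = 0"
    by (auto simp: cutoff_def flat_exp_def mult_less_0_iff zero_less_mult_iff)
  ultimately show ?thesis unfolding test_fun_def using assms by blast
qed

lemma flat_exp_1_bounds: "0 \<le> flat_exp 1 x" "flat_exp 1 x \<le> 1"
  by (auto simp: flat_exp_def)

lemma cutoff_bounds: "0 \<le> cutoff c d n x" "cutoff c d n x \<le> 1"
  unfolding cutoff_def using flat_exp_1_bounds by (auto intro!: mult_nonneg_nonneg mult_le_one)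

lemma cutoff_eq_0: "x \<notin> {c<..<d} \<Longrightarrow> cutoff c d n x = 0"
  by (auto simp: cutoff_def flat_exp_def zero_less_mult_iff)

lemma cutoff_pos: "c < x \<Longrightarrow> x < d \<Longrightarrow> 0 < cutoff c d n x"
  by (auto simp: cutoff_def flat_exp_def)

lemma flat_exp_scaled_tendsto:
  "(\<lambda>n. flat_exp 1 (real (Suc n) * y)) \<longlonglongrightarrow> (if y > 0 then 1 else 0)"
proof (cases "y > 0")
  case True
  have "(\<lambda>n. exp (- (inverse (real (Suc n)) * (1 / y)))) \<longlonglongrightarrow> exp (- (0 * (1 / y)))"
    by (intro tendsto_intros LIMSEQ_inverse_real_of_nat)
  then show ?thesis using True by (simp add: flat_exp_def divide_simps)
qed (auto simp: flat_exp_def zero_less_mult_iff)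

lemma cutoff_tendsto: "(\<lambda>n. cutoff c d n x) \<longlonglongrightarrow> indicator {c<..<d} x"
  using tendsto_mult[OF flat_exp_scaled_tendsto[of "x - c"] flat_exp_scaled_tendsto[of "d - x"]]
  unfolding cutoff_def by (auto simp: indicator_def split: if_splits)

lemma test_fun_has_derivative: "\<phi> \<in> test_fun a b \<Longrightarrow> (\<phi> has_real_derivative deriv \<phi> x) (at x)"
  unfolding test_fun_def mem_Collect_eq
  by (drule conjunct1, drule spec[of _ 0], drule spec[of _ x]) (simp add: field_differentiable_derivI)

lemma test_fun_deriv:
  assumes "\<phi> \<in> test_fun a b"
  shows "deriv \<phi> \<in> test_fun a b"
proof -
  obtain c d where cd: "a < c" "d < b" "\<And>x. x \<notin> {c..d} \<Longrightarrow> \<phi> x = 0"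
    using assms by (auto simp: test_fun_def)
  have "deriv \<phi> x = 0" if "x \<notin> {c..d}" for x
  proof -
    have "((\<lambda>_. 0) has_real_derivative 0) (at x)" by simp
    then have "(\<phi> has_real_derivative 0) (at x)"
      by (rule has_field_derivative_transform_within_open[of _ _ _ "- {c..d}"]) (use that cd(3) in auto)
    then show ?thesis by (rule DERIV_imp_deriv)
  qed
  moreover have "(deriv ^^ n) (deriv \<phi>) field_differentiable at x" for n x
    using assms unfolding test_fun_def by (metis (mono_tags, lifting) funpow_Suc_right comp_apply mem_Collect_eq)
  ultimately show ?thesis using cd(1,2) unfolding test_fun_def by blast
qed

lemma test_fun_continuous: "\<phi> \<in> test_fun a b \<Longrightarrow> continuous_on S \<phi>"
  using test_fun_has_derivative by (meson DERIV_isCont continuous_at_imp_continuous_on)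

lemma test_fun_measurable [measurable_dest]: "\<phi> \<in> test_fun a b \<Longrightarrow> \<phi> \<in> borel_measurable borel"
  by (intro borel_measurable_continuous_onI test_fun_continuous)

lemma test_fun_bounded:
  assumes "\<phi> \<in> test_fun a b" "a < b"
  obtains c d B where "a < c" "c < d" "d < b" "\<And>x. x \<notin> {c..d} \<Longrightarrow> \<phi> x = 0" "\<And>x. \<bar>\<phi> x\<bar> \<le> B"
proof -
  obtain c0 d0 where cd: "a < c0" "d0 < b" "\<And>x. x \<notin> {c0..d0} \<Longrightarrow> \<phi> x = 0"
    using assms by (auto simp: test_fun_def)
  define c d where "c = min c0 ((2 * a + b) / 3)" and "d = max d0 ((a + 2 * b) / 3)"
  have "(2 * a + b) / 3 < (a + 2 * b) / 3" using assms(2) by (simp add: field_simps)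
  moreover have "c \<le> (2 * a + b) / 3" "(a + 2 * b) / 3 \<le> d"
    unfolding c_def d_def by (rule min.cobounded2, rule max.cobounded2)
  ultimately have "c < d" by linarith
  then have cd': "a < c" "c < d" "d < b" "c \<le> c0" "d0 \<le> d"
    using cd(1,2) assms(2) unfolding c_def d_def by auto
  have zero: "\<phi> x = 0" if "x \<notin> {c..d}" for x
    using that cd' by (intro cd(3)) auto
  have "bounded (\<phi> ` {c..d})"
    by (intro compact_imp_bounded compact_continuous_image test_fun_continuous[OF assms(1)]) auto
  then obtain B where "\<forall>x\<in>{c..d}. \<bar>\<phi> x\<bar> \<le> B" by (auto simp: bounded_iff)
  then have "\<bar>\<phi> x\<bar> \<le> max B 0" for x using zero[of x] by (cases "x \<in> {c..d}") force+
  then show ?thesis using that cd' zero by blast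
qed

lemma test_fun_lincomb:
  assumes "\<phi> \<in> test_fun a b" "\<psi> \<in> test_fun a b"
  shows "(\<lambda>x. \<phi> x - r * \<psi> x) \<in> test_fun a b"
proof -
  define S where "S = {(\<lambda>x. f x - r * g x) |f g. f \<in> test_fun a b \<and> g \<in> test_fun a b}"
  have "\<exists>g\<in>S. \<forall>x. (f has_real_derivative g x) (at x)" if f: "f \<in> S" for f
  proof -
    obtain g h where gh: "f = (\<lambda>x. g x - r * h x)" "g \<in> test_fun a b" "h \<in> test_fun a b"
      using f unfolding S_def by blast
    have "(\<lambda>x. deriv g x - r * deriv h x) \<in> S"
      using test_fun_deriv[OF gh(2)] test_fun_deriv[OF gh(3)] unfolding S_def by blast
    moreover have "\<forall>x. (f has_real_derivative deriv g x - r * deriv h x) (at x)"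
      unfolding gh(1) by (intro allI DERIV_diff DERIV_cmult test_fun_has_derivative[OF gh(2)] test_fun_has_derivative[OF gh(3)])
    ultimately show ?thesis
      by (intro bexI[of _ "\<lambda>x. deriv g x - r * deriv h x"])
  qed
  note smooth = derivatives_differentiable_of_closed[OF this]
  obtain c d where cd: "a < c" "d < b" "\<And>x. x \<notin> {c..d} \<Longrightarrow> \<phi> x = 0"
    using assms by (auto simp: test_fun_def)
  obtain c' d' where cd': "a < c'" "d' < b" "\<And>x. x \<notin> {c'..d'} \<Longrightarrow> \<psi> x = 0"
    using assms by (auto simp: test_fun_def)
  have "\<phi> x - r * \<psi> x = 0" if "x \<notin> {min c c'..max d d'}" for x
    using cd(3)[of x] cd'(3)[of x] that by force
  moreover have "a < min c c'" "max d d' < b" using cd cd' by auto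
  moreover have "(\<lambda>x. \<phi> x - r * \<psi> x) \<in> S" using assms unfolding S_def by blast
  ultimately show ?thesis unfolding test_fun_def using smooth by blast
qed

text \<open>
  The vanishing integral is what makes the antiderivative return to \<open>0\<close> to the right of the support.
\<close>

lemma test_fun_primitive:
  assumes "\<phi> \<in> test_fun a b" "a < b" "(LINT x:{a<..<b}|lborel. \<phi> x) = 0"
  obtains \<psi> where "\<psi> \<in> test_fun a b" "deriv \<psi> = \<phi>"
proof -
  obtain c d B where cd: "a < c" "c < d" "d < b" "\<And>x. x \<notin> {c..d} \<Longrightarrow> \<phi> x = 0"
    using test_fun_bounded[OF assms(1,2)] by metis
  obtain F where F: "\<And>x. (F has_real_derivative \<phi> x) (at x)"
    using einterval_antiderivative[of "-\<infinity>" \<infinity> \<phi>] test_fun_continuous[OF assms(1), of UNIV]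
    by (auto simp: continuous_on_eq_continuous_at has_real_derivative_iff_has_vector_derivative)
  \<comment> \<open>Normalizing strictly to the left of the support spares the discussion of its end point.\<close>
  define c' where "c' = (a + c) / 2"
  have c': "a < c'" "c' < c" using cd by (auto simp: c'_def)
  have FTC: "F y - F x = (LINT t:{x..y}|lborel. \<phi> t)" if "x \<le> y" for x y
    using integral_FTC_atLeastAtMost[OF that, of F \<phi>] F test_fun_continuous[OF assms(1)]
    by (auto simp: set_lebesgue_integral_def has_real_derivative_iff_has_vector_derivative has_vector_derivative_at_within)
  define \<psi> where "\<psi> x = F x - F c'" for x
  have D: "(\<psi> has_real_derivative \<phi> x) (at x)" for x
    unfolding \<psi>_def by (auto intro!: derivative_eq_intros F)
  have deriv: "deriv \<psi> = \<phi>" using D by (intro ext DERIV_imp_deriv)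
  have "\<psi> x = 0" if "x \<notin> {c'..d}" for x
  proof (cases "x < c'")
    case True
    have "F c' - F x = (LINT t:{x..c'}|lborel. 0)"
      unfolding FTC[OF less_imp_le[OF True]]
      by (intro set_lebesgue_integral_cong) (use cd c' in auto)
    then show ?thesis by (simp add: \<psi>_def)
  next
    case False
    then have x: "x > d" "c' \<le> x" using that by auto
    have "F x - F c' = (LINT t:{c'..x}|lborel. \<phi> t)" using FTC x by blast
    also have "\<dots> = (LINT x:{a<..<b}|lborel. \<phi> x)"
      unfolding set_lebesgue_integral_def
    proof (intro Bochner_Integration.integral_cong refl)
      fix t
      have "t \<in> {c..d} \<or> \<phi> t = 0" using cd(4) by blast
      then show "indicator {c'..x} t *\<^sub>R \<phi> t = indicator {a<..<b} t *\<^sub>R \<phi> t"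
        using cd(1-3) c' x by (auto simp: indicator_def)
    qed
    finally show ?thesis using assms(3) by (simp add: \<psi>_def)
  qed
  moreover have "(deriv ^^ n) \<psi> field_differentiable at x" for n x
  proof (cases n)
    case 0
    then show ?thesis using D field_differentiable_def by auto
  next
    case (Suc m)
    then have "(deriv ^^ n) \<psi> = (deriv ^^ m) \<phi>" by (metis comp_apply deriv funpow_Suc_right)
    then show ?thesis using assms(1) by (simp add: test_fun_def)
  qed
  ultimately have "\<psi> \<in> test_fun a b"
    using c' cd unfolding test_fun_def by blast
  then show ?thesis using that deriv by blast
qed


section \<open>Distributional derivatives\<close>

text \<open>
  Edge measures and Lebesgue measure on the interval are both instances, so that the same lemmas serve
  weak derivatives and derivatives with respect to an edge measure.
\<close>

locale interval_measure = finite_measure M for M :: "real measure" +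
  fixes a b :: real
  assumes less: "a < b" and sets_M: "sets M = sets (restrict_space borel {a..b})"
begin

lemma space_M: "space M = {a..b}"
  using sets_eq_imp_space_eq[OF sets_M] by (simp add: space_restrict_space)

lemma measurable_M: "f \<in> borel_measurable borel \<Longrightarrow> f \<in> borel_measurable M"
  by (subst measurable_cong_sets[OF sets_M refl]) (rule measurable_restrict_space1)

lemma borel_sets_M: "A \<in> sets M \<Longrightarrow> A \<in> sets borel"
  unfolding sets_M by (auto simp: sets_restrict_space)

lemma Int_sets_M: "A \<in> sets borel \<Longrightarrow> A \<inter> {a..b} \<in> sets M"
  unfolding sets_M by (auto simp: sets_restrict_space)

lemma subset_sets_M: "A \<in> sets borel \<Longrightarrow> A \<subseteq> {a..b} \<Longrightarrow> A \<in> sets M"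
  using Int_sets_M[of A] by (simp add: Int_absorb2)

lemma set_integrable_borel:
  fixes f :: "real \<Rightarrow> 'k::euclidean_space"
  assumes "integrable M f" "A \<in> sets borel"
  shows "set_integrable M A f"
proof -
  have "set_integrable M (A \<inter> {a..b}) f"
    unfolding set_integrable_def using assms Int_sets_M by (intro integrable_mult_indicator) auto
  moreover have "set_integrable M A f = set_integrable M (A \<inter> {a..b}) f"
    unfolding set_integrable_def by (intro Bochner_Integration.integrable_cong refl) (auto simp: space_M indicator_def)
  ultimately show ?thesis by simp
qed

lemma set_integrable_borel_subset:
  fixes f :: "real \<Rightarrow> 'k::euclidean_space"
  assumes "set_integrable M B f" "A \<in> sets borel" "A \<subseteq> B"
  shows "set_integrable M A f"
proof -
  have "set_integrable M A (\<lambda>x. indicator B x *\<^sub>R f x)"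
    using assms(1,2) unfolding set_integrable_def[of M B] by (rule set_integrable_borel)
  moreover have "indicator A x *\<^sub>R indicator B x *\<^sub>R f x = indicator A x *\<^sub>R f x" for x
    using assms(3) by (auto simp: indicator_def)
  ultimately show ?thesis by (simp only: set_integrable_def)
qed

text \<open>
  Open intervals shrink to closed ones, and the Borel sets over which the integral vanishes are closed under
  complements and countable disjoint unions.
\<close>

lemma AE_zero_if_interval_integrals_zero:
  fixes f :: "real \<Rightarrow> 'k::euclidean_space"
  assumes f: "integrable M f" and 0: "\<And>c d. c < d \<Longrightarrow> (LINT x:{c<..<d}|M. f x) = 0"
  shows "AE x in M. f x = 0"
proof -
  have int: "set_integrable M A f" if "A \<in> sets borel" for A
    using set_integrable_borel[OF f that] .
  have closed: "(LINT x:{c..d}|M. f x) = 0" if "c \<le> d" for c d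
  proof -
    have "(\<lambda>n. LINT x|M. indicator {c - 1 / Suc n<..<d + 1 / Suc n} x *\<^sub>R f x)
        \<longlonglongrightarrow> (LINT x|M. indicator {c..d} x *\<^sub>R f x)"
    proof (rule integral_dominated_convergence[where w = "\<lambda>x. norm (f x)"])
      show "(\<lambda>x. indicator {c..d} x *\<^sub>R f x) \<in> borel_measurable M"
        using int[of "{c..d}"] by (auto simp: set_integrable_def)
      show "(\<lambda>x. indicator {c - 1 / Suc n<..<d + 1 / Suc n} x *\<^sub>R f x) \<in> borel_measurable M" for n
        using int[of "{c - 1 / Suc n<..<d + 1 / Suc n}"] by (auto simp: set_integrable_def)
      show "AE x in M. (\<lambda>n. indicator {c - 1 / Suc n<..<d + 1 / Suc n} x *\<^sub>R f x) \<longlonglongrightarrow> indicator {c..d} x *\<^sub>R f x"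
      proof (intro AE_I2 tendsto_scaleR tendsto_const)
        fix x
        show "(\<lambda>n. indicator {c - 1 / Suc n<..<d + 1 / Suc n} x) \<longlonglongrightarrow> (indicator {c..d} x :: real)"
        proof (cases "x \<in> {c..d}")
          case True
          have *: "c - 1 / Suc n < x \<and> x < d + 1 / Suc n" for n
          proof -
            have "0 < 1 / real (Suc n)" by simp
            then show ?thesis using True unfolding atLeastAtMost_iff by linarith
          qed
          then have "indicator {c - 1 / Suc n<..<d + 1 / Suc n} x = (1::real)" for n
            using *[of n] by (simp only: indicator_def greaterThanLessThan_iff simp_thms of_bool_eq)
          then show ?thesis using True by simp
        next
          case False
          then have "max (c - x) (x - d) > 0" by auto
          from order_tendstoD(2)[OF LIMSEQ_inverse_real_of_nat this]
          have "\<forall>\<^sub>F n in sequentially. x \<notin> {c - 1 / Suc n<..<d + 1 / Suc n}"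
            by eventually_elim (simp add: inverse_eq_divide, linarith)
          then have "\<forall>\<^sub>F n in sequentially. (indicator {c - 1 / Suc n<..<d + 1 / Suc n} x :: real) = 0"
            by eventually_elim (simp add: indicator_def)
          then show ?thesis using False by (simp add: tendsto_eventually)
        qed
      qed
      show "AE x in M. norm (indicator {c - 1 / Suc n<..<d + 1 / Suc n} x *\<^sub>R f x) \<le> norm (f x)" for n
        by (auto simp: indicator_def)
    qed (use f in auto)
    moreover have "(LINT x|M. indicator {c - 1 / Suc n<..<d + 1 / Suc n} x *\<^sub>R f x) = 0" for n
    proof -
      have "0 < 1 / real (Suc n)" by simp
      then have "c - 1 / Suc n < d + 1 / Suc n" using that by linarith
      from 0[OF this] show ?thesis by (simp add: set_lebesgue_integral_def)
    qed
    ultimately show ?thesis by (simp add: set_lebesgue_integral_def LIMSEQ_const_iff)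
  qed
  have total: "(LINT x|M. f x) = 0"
  proof -
    have "(LINT x:{a..b}|M. f x) = (LINT x|M. f x)"
      unfolding set_lebesgue_integral_def
      by (intro Bochner_Integration.integral_cong) (auto simp: space_M)
    then show ?thesis using closed[of a b] less by simp
  qed
  have zero: "(LINT x:A|M. f x) = 0" if "A \<in> sets borel" for A
    using that
  proof (induction A rule: borel_set_induct)
    case (compl A)
    have "(LINT x:A|M. f x) + (LINT x:- A|M. f x) = (LINT x|M. f x)"
    proof -
      have "indicator A x *\<^sub>R f x + indicator (- A) x *\<^sub>R f x = f x" for x
        by (simp add: indicator_def)
      then show ?thesis
        using int[OF compl(1)] int[of "- A"] compl(1)
          Bochner_Integration.integral_add[of M "\<lambda>x. indicator A x *\<^sub>R f x" "\<lambda>x. indicator (- A) x *\<^sub>R f x"]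
        unfolding set_lebesgue_integral_def set_integrable_def by (simp add: borel_comp)
    qed
    then show ?case using compl total by simp
  next
    case (union A)
    have eq: "(LINT x:B \<inter> {a..b}|M. f x) = (LINT x:B|M. f x)" for B
      unfolding set_lebesgue_integral_def
      by (intro Bochner_Integration.integral_cong) (auto simp: space_M indicator_def)
    have "(LINT x:(\<Union>i. A i \<inter> {a..b})|M. f x) = (\<Sum>i. (LINT x:A i \<inter> {a..b}|M. f x))"
      using union(1,2) by (intro lebesgue_integral_countable_add Int_sets_M int) (auto simp: disjoint_family_on_def)
    then show ?case using union(3) eq[of "\<Union>i. A i"] by (simp add: eq)
  qed (use closed in \<open>auto simp: set_lebesgue_integral_def\<close>)
  show ?thesis
    using density_zero[OF f] zero borel_sets_M by blast
qed

text \<open>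
  Rescaled bump functions converge boundedly to indicators of intervals, so that testing with them
  determines all interval integrals.
\<close>

lemma AE_zero_if_test_integrals_zero:
  fixes g :: "real \<Rightarrow> 'k::euclidean_space"
  assumes int: "\<And>c d. a < c \<Longrightarrow> c < d \<Longrightarrow> d < b \<Longrightarrow> set_integrable M {c..d} g"
    and 0: "\<And>\<phi>. \<phi> \<in> test_fun a b \<Longrightarrow> (LINT x:{a<..<b}|M. \<phi> x *\<^sub>R g x) = 0"
  shows "AE x in M. x \<in> {a<..<b} \<longrightarrow> g x = 0"
proof -
  have interval: "(LINT x:{c<..<d}|M. g x) = 0" if cd: "a < c" "c < d" "d < b" for c d
  proof -
    have meas: "(\<lambda>x. indicator {c..d} x *\<^sub>R g x) \<in> borel_measurable M"
      using int[OF cd] by (auto simp: set_integrable_def)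
    have "(\<lambda>n. LINT x|M. cutoff c d n x *\<^sub>R indicator {c..d} x *\<^sub>R g x) \<longlonglongrightarrow>
        (LINT x|M. indicator {c<..<d} x *\<^sub>R indicator {c..d} x *\<^sub>R g x)"
    proof (rule integral_dominated_convergence[where w = "\<lambda>x. norm (indicator {c..d} x *\<^sub>R g x)"])
      show "(\<lambda>x. indicator {c<..<d} x *\<^sub>R indicator {c..d} x *\<^sub>R g x) \<in> borel_measurable M"
        by (intro borel_measurable_scaleR meas measurable_M) auto
      show "(\<lambda>x. cutoff c d n x *\<^sub>R indicator {c..d} x *\<^sub>R g x) \<in> borel_measurable M" for n
        by (intro borel_measurable_scaleR meas measurable_M test_fun_measurable[OF cutoff_test_fun[OF cd(1,3)]])
      show "AE x in M. norm (cutoff c d n x *\<^sub>R indicator {c..d} x *\<^sub>R g x) \<le> norm (indicator {c..d} x *\<^sub>R g x)" for n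
        using cutoff_bounds[of c d n] by (intro AE_I2, subst norm_scaleR, intro mult_left_le_one_le) auto
    next
      show "integrable M (\<lambda>x. norm (indicator {c..d} x *\<^sub>R g x))"
        using int[OF cd] unfolding set_integrable_def by (rule integrable_norm)
    qed (intro AE_I2 tendsto_scaleR tendsto_const cutoff_tendsto)
    moreover have "(LINT x|M. cutoff c d n x *\<^sub>R indicator {c..d} x *\<^sub>R g x) = 0" for n
    proof -
      have "cutoff c d n x *\<^sub>R indicator {c..d} x *\<^sub>R g x = indicator {a<..<b} x *\<^sub>R cutoff c d n x *\<^sub>R g x" for x
      proof (cases "x \<in> {c<..<d}")
        case True
        then have "x \<in> {c..d}" "x \<in> {a<..<b}" using cd by auto
        then show ?thesis by simp
      next
        case False
        then show ?thesis by (simp add: cutoff_eq_0)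
      qed
      then show ?thesis
        using 0[OF cutoff_test_fun[OF cd(1,3), of n]] by (simp only: set_lebesgue_integral_def)
    qed
    moreover have "indicator {c<..<d} x *\<^sub>R indicator {c..d} x *\<^sub>R g x = indicator {c<..<d} x *\<^sub>R g x" for x
      by (auto simp: indicator_def)
    ultimately show ?thesis by (simp only: set_lebesgue_integral_def LIMSEQ_const_iff)
  qed
  have local: "AE x in M. x \<in> {c<..<d} \<longrightarrow> g x = 0" if cd: "a < c" "c < d" "d < b" for c d
  proof -
    have "AE x in M. indicator {c<..<d} x *\<^sub>R g x = 0"
    proof (rule AE_zero_if_interval_integrals_zero)
      show "integrable M (\<lambda>x. indicator {c<..<d} x *\<^sub>R g x)"
        using set_integrable_borel_subset[OF int[OF cd], of "{c<..<d}"]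
        by (simp add: set_integrable_def greaterThanLessThan_subseteq_atLeastAtMost_iff)
      fix p q :: real
      have "(LINT x:{p<..<q}|M. indicator {c<..<d} x *\<^sub>R g x) = (LINT x:{max p c<..<min q d}|M. g x)"
        unfolding set_lebesgue_integral_def
        by (intro Bochner_Integration.integral_cong) (auto simp: indicator_def)
      also have "\<dots> = 0"
        using interval[of "max p c" "min q d"] cd
        by (cases "max p c < min q d") (auto simp: set_lebesgue_integral_def)
      finally show "(LINT x:{p<..<q}|M. indicator {c<..<d} x *\<^sub>R g x) = 0" .
    qed
    then show ?thesis by eventually_elim (auto simp: indicator_def)
  qed
  define c where "c n = a + (b - a) / real (n + 3)" for n
  define d where "d n = b - (b - a) / real (n + 3)" for n
  have "AE x in M. \<forall>n. x \<in> {c n<..<d n} \<longrightarrow> g x = 0"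
  proof (subst AE_all_countable, intro allI local)
    fix n
    \<comment> \<open>The offset 3 keeps the two end points apart already for the index 0.\<close>
    define t where "t = (b - a) / real (n + 3)"
    have "0 < t" using less by (simp add: t_def)
    moreover have "t \<le> (b - a) / 3" unfolding t_def using less by (intro divide_left_mono) auto
    ultimately have "a < a + t" "a + t < b - t" "b - t < b" using less by argo+
    then show "a < c n" "c n < d n" "d n < b"
      unfolding c_def d_def t_def by this+
  qed
  then show ?thesis
  proof eventually_elim
    case (elim x)
    show ?case
    proof
      assume x: "x \<in> {a<..<b}"
      define r where "r = min (x - a) (b - x) / (b - a)"
      have r: "r > 0" using x less by (simp add: r_def)
      then obtain n where n: "inverse (real (Suc n)) < r" using reals_Archimedean by blast
      have "(b - a) / real (n + 3) < min (x - a) (b - x)"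
      proof -
        have "inverse (real (n + 3)) \<le> inverse (real (Suc n))" by (intro le_imp_inverse_le) auto
        then have "inverse (real (n + 3)) < r" using n by linarith
        then have "(b - a) * inverse (real (n + 3)) < (b - a) * r"
          using less by (intro mult_strict_left_mono) linarith+
        also have "(b - a) * r = min (x - a) (b - x)" using less by (simp add: r_def)
        finally show ?thesis by (simp only: divide_inverse)
      qed
      then have "x \<in> {c n<..<d n}" by (auto simp: c_def d_def)
      then show "g x = 0" using elim by blast
    qed
  qed
qed

end

lemma interval_measure_lborel: 
  assumes "a < b" shows "interval_measure (restrict_space lborel {a..b}) a b"
proof (intro interval_measure.intro finite_measureI interval_measure_axioms.intro assms)
  have "emeasure (restrict_space lborel {a..b}) {a..b} = emeasure lborel {a..b}"
    by (subst emeasure_restrict_space) auto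
  then show "emeasure (restrict_space lborel {a..b}) (space (restrict_space lborel {a..b})) \<noteq> \<infinity>"
    using assms by (simp add: space_restrict_space)
qed (rule sets_restrict_space_cong, simp)


lemma set_integral_cong_AE:
  fixes f g :: "'x \<Rightarrow> 'k::euclidean_space"
  assumes "set_integrable M A f" "set_integrable M A g" "AE x in M. x \<in> A \<longrightarrow> f x = g x"
  shows "(LINT x:A|M. f x) = (LINT x:A|M. g x)"
  unfolding set_lebesgue_integral_def
proof (rule integral_cong_AE)
  show "AE x in M. indicator A x *\<^sub>R f x = indicator A x *\<^sub>R g x"
    using assms(3) by eventually_elim (auto simp: indicator_def)
qed (use assms(1,2) in \<open>auto simp: set_integrable_def\<close>)

lemma set_integral_finite_diff:
  fixes f :: "real \<Rightarrow> 'k::euclidean_space"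
  assumes "set_integrable lborel A f" "set_integrable lborel B f" "finite F"
    and "\<And>x. x \<notin> F \<Longrightarrow> x \<in> A \<longleftrightarrow> x \<in> B"
  shows "(LINT x:A|lborel. f x) = (LINT x:B|lborel. f x)"
proof (rule set_integral_cong_set)
  have "AE x in lborel. x \<notin> F" by (rule AE_not_in[OF finite_imp_null_set_lborel[OF assms(3)]])
  then show "AE x in lborel. x \<in> B \<longleftrightarrow> x \<in> A"
    by eventually_elim (use assms(4) in blast)
qed (use assms(1,2) in \<open>auto simp: set_integrable_def set_borel_measurable_def\<close>)

lemma set_integrable_const_Ioo: "set_integrable lborel {a<..<b::real} (\<lambda>_. c::'k::euclidean_space)"
  unfolding set_integrable_def
  by (intro integrable_scaleR_left integrable_real_indicator emeasure_bounded_finite) auto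

lemma set_integral_restrict_Icc:
  fixes f :: "real \<Rightarrow> 'k::euclidean_space"
  assumes "A \<subseteq> {a..b}"
  shows "(LINT x:A|restrict_space lborel {a..b}. f x) = (LINT x:A|lborel. f x)"
    and "set_integrable (restrict_space lborel {a..b}) A f \<longleftrightarrow> set_integrable lborel A f"
proof -
  have *: "indicator {a..b} x *\<^sub>R indicator A x *\<^sub>R f x = indicator A x *\<^sub>R f x" for x
    using assms by (auto simp: indicator_def)
  show "(LINT x:A|restrict_space lborel {a..b}. f x) = (LINT x:A|lborel. f x)"
    unfolding set_lebesgue_integral_def by (subst integral_restrict_space) (simp, simp only: *)
  show "set_integrable (restrict_space lborel {a..b}) A f \<longleftrightarrow> set_integrable lborel A f"
    unfolding set_integrable_def by (subst integrable_restrict_space) (simp, simp only: *)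
qed

lemma set_integrable_mult_test_fun:
  fixes f :: "real \<Rightarrow> 'k::{real_normed_field,euclidean_space}"
  assumes "\<phi> \<in> test_fun a b" "f \<in> L1_loc a b" "a < b"
  shows "set_integrable lborel {a<..<b} (\<lambda>x. \<phi> x *\<^sub>R f x)"
proof -
  obtain c d B where cd: "a < c" "c < d" "d < b" "\<And>x. x \<notin> {c..d} \<Longrightarrow> \<phi> x = 0" "\<And>x. \<bar>\<phi> x\<bar> \<le> B"
    using test_fun_bounded[OF assms(1,3)] by metis
  have int: "integrable lborel (\<lambda>x. indicator {c..d} x *\<^sub>R f x)"
    using assms(2) cd(1,3) by (auto simp: L1_loc_def set_integrable_def)
  have [measurable]: "\<phi> \<in> borel_measurable borel" by (rule test_fun_measurable[OF assms(1)])
  have "integrable lborel (\<lambda>x. \<phi> x *\<^sub>R (indicator {c..d} x *\<^sub>R f x))"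
  proof (rule Bochner_Integration.integrable_bound)
    show "integrable lborel (\<lambda>x. B *\<^sub>R (indicator {c..d} x *\<^sub>R f x))" using int by (rule integrable_scaleR_right)
    show "(\<lambda>x. \<phi> x *\<^sub>R (indicator {c..d} x *\<^sub>R f x)) \<in> borel_measurable lborel"
      by (intro borel_measurable_scaleR borel_measurable_integrable[OF int]) simp
    show "AE x in lborel. norm (\<phi> x *\<^sub>R (indicator {c..d} x *\<^sub>R f x)) \<le> norm (B *\<^sub>R (indicator {c..d} x *\<^sub>R f x))"
    proof (intro AE_I2)
      fix x show "norm (\<phi> x *\<^sub>R (indicator {c..d} x *\<^sub>R f x)) \<le> norm (B *\<^sub>R (indicator {c..d} x *\<^sub>R f x))"
        unfolding norm_scaleR using cd(5)[of x] by (intro mult_right_mono) auto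
    qed
  qed
  moreover have "\<phi> x *\<^sub>R (indicator {c..d} x *\<^sub>R f x) = indicator {a<..<b} x *\<^sub>R \<phi> x *\<^sub>R f x" for x
  proof (cases "x \<in> {c..d}")
    case True
    then have "x \<in> {a<..<b}" using cd by auto
    with True show ?thesis by simp
  qed (simp add: cd(4))
  ultimately show ?thesis by (simp only: set_integrable_def)
qed

lemma L1_loc_AE_zero:
  fixes f :: "real \<Rightarrow> 'k::{real_normed_field,euclidean_space}"
  assumes "a < b" "f \<in> L1_loc a b"
    and "\<And>\<phi>. \<phi> \<in> test_fun a b \<Longrightarrow> (LINT x:{a<..<b}|lborel. \<phi> x *\<^sub>R f x) = 0"
  shows "AE x in lborel. x \<in> {a<..<b} \<longrightarrow> f x = 0"
proof -
  interpret interval_measure "restrict_space lborel {a..b}" a b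
    by (rule interval_measure_lborel[OF assms(1)])
  have "AE x in restrict_space lborel {a..b}. x \<in> {a<..<b} \<longrightarrow> f x = 0"
  proof (rule AE_zero_if_test_integrals_zero)
    fix c d assume cd: "a < c" "c < d" "d < b"
    then have "{c..d} \<subseteq> {a..b}" by auto
    then show "set_integrable (restrict_space lborel {a..b}) {c..d} f"
      using assms(2) cd by (simp add: set_integral_restrict_Icc L1_loc_def)
  next
    fix \<phi> assume "\<phi> \<in> test_fun a b"
    moreover have "{a<..<b} \<subseteq> {a..b}" by auto
    ultimately show "(LINT x:{a<..<b}|restrict_space lborel {a..b}. \<phi> x *\<^sub>R f x) = 0"
      using assms(3) by (simp add: set_integral_restrict_Icc)
  qed
  then have "AE x in lborel. x \<in> {a..b} \<longrightarrow> x \<in> {a<..<b} \<longrightarrow> f x = 0"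
    by (subst (asm) AE_restrict_space_iff) auto
  then show ?thesis by eventually_elim auto
qed

lemma set_integrable_imp_L1_loc:
  "set_integrable lborel {a<..<b} f \<Longrightarrow> f \<in> L1_loc a b"
  unfolding L1_loc_def by (auto intro: set_integrable_subset)

text \<open>
  The lemma of du Bois-Reymond: after subtraction of a multiple of a fixed bump function \<open>\<rho>\<close>, a test function has
  integral \<open>0\<close> and is therefore the derivative of a test function. The constant is the mean of \<open>f\<close> weighted
  by \<open>\<rho>\<close>.
\<close>

lemma AE_constant_if_distr_deriv_zero:
  fixes f :: "real \<Rightarrow> 'k::{real_normed_field,euclidean_space}"
  assumes "a < b" and f: "f \<in> L1_loc a b"
    and 0: "\<And>\<phi>. \<phi> \<in> test_fun a b \<Longrightarrow> (LINT x:{a<..<b}|lborel. deriv \<phi> x *\<^sub>R f x) = 0"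
  shows "\<exists>c. AE x in lborel. x \<in> {a<..<b} \<longrightarrow> f x = c"
proof -
  obtain p where "a < p" "p < b" using dense[OF assms(1)] by blast
  then obtain q where pq: "a < p" "p < q" "q < b" using dense[of p b] by blast
  define \<rho> where "\<rho> = cutoff p q 0"
  have \<rho>: "\<rho> \<in> test_fun a b" unfolding \<rho>_def by (rule cutoff_test_fun[OF pq(1,3)])
  have one: "(\<lambda>_. 1::real) \<in> L1_loc a b"
    by (intro set_integrable_imp_L1_loc set_integrable_const_Ioo)
  have const: "(\<lambda>_. c) \<in> L1_loc a b" for c :: 'k
    by (intro set_integrable_imp_L1_loc set_integrable_const_Ioo)
  have int1: "set_integrable lborel {a<..<b} \<phi>" if "\<phi> \<in> test_fun a b" for \<phi>
    using set_integrable_mult_test_fun[OF that one assms(1)] by simp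
  define I where "I = (LINT x:{a<..<b}|lborel. \<rho> x)"
  have "I \<noteq> 0"
  proof
    assume "I = 0"
    then have "AE x in lborel. indicator {a<..<b} x *\<^sub>R \<rho> x = 0"
      using int1[OF \<rho>] cutoff_bounds(1)[of p q 0] unfolding I_def set_lebesgue_integral_def set_integrable_def
      by (subst (asm) integral_nonneg_eq_0_iff_AE) (auto simp: \<rho>_def)
    then have "AE x in lborel. x \<notin> {p<..<q}"
    proof eventually_elim
      case (elim x)
      then show ?case using cutoff_pos[of p x q 0] pq by (auto simp: \<rho>_def indicator_def split: if_splits)
    qed
    then have "emeasure lborel {p<..<q} = 0"
      by (subst (asm) AE_iff_measurable[of "{p<..<q}"]) auto
    then show False using pq by simp
  qed
  define c where "c = (1 / I) *\<^sub>R (LINT x:{a<..<b}|lborel. \<rho> x *\<^sub>R f x)"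
  have "AE x in lborel. x \<in> {a<..<b} \<longrightarrow> f x - c = 0"
  proof (rule L1_loc_AE_zero[OF assms(1)])
    show "(\<lambda>x. f x - c) \<in> L1_loc a b"
      using f const[of c] by (auto simp: L1_loc_def intro!: set_integral_diff)
    fix \<theta> assume \<theta>: "\<theta> \<in> test_fun a b"
    define r where "r = (LINT x:{a<..<b}|lborel. \<theta> x) / I"
    have "(LINT x:{a<..<b}|lborel. \<theta> x - r * \<rho> x) = 0"
      using int1[OF \<theta>] int1[OF \<rho>] \<open>I \<noteq> 0\<close> by (subst set_integral_diff) (auto simp: r_def I_def[symmetric])
    then obtain \<psi> where \<psi>: "\<psi> \<in> test_fun a b" "deriv \<psi> = (\<lambda>x. \<theta> x - r * \<rho> x)"
      using test_fun_primitive[OF test_fun_lincomb[OF \<theta> \<rho>, of r] assms(1)] by metis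
    note i\<theta> = set_integrable_mult_test_fun[OF \<theta> f assms(1)]
    note i\<rho> = set_integrable_mult_test_fun[OF \<rho> f assms(1)]
    have "0 = (LINT x:{a<..<b}|lborel. \<theta> x *\<^sub>R f x - r *\<^sub>R (\<rho> x *\<^sub>R f x))"
      using 0[OF \<psi>(1)] by (simp add: \<psi>(2) scaleR_left_diff_distrib)
    also have "\<dots> = (LINT x:{a<..<b}|lborel. \<theta> x *\<^sub>R f x) - r *\<^sub>R (LINT x:{a<..<b}|lborel. \<rho> x *\<^sub>R f x)"
      unfolding set_integral_diff(2)[OF i\<theta> set_integrable_scaleR_right[OF i\<rho>]] set_integral_scaleR_right ..
    finally have "(LINT x:{a<..<b}|lborel. \<theta> x *\<^sub>R f x) = (LINT x:{a<..<b}|lborel. \<theta> x) *\<^sub>R c"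
      by (simp add: c_def r_def)
    moreover have "(LINT x:{a<..<b}|lborel. \<theta> x *\<^sub>R c) = (LINT x:{a<..<b}|lborel. \<theta> x) *\<^sub>R c"
      using int1[OF \<theta>] unfolding set_lebesgue_integral_def set_integrable_def
      by (subst integral_scaleR_left[symmetric]) auto
    ultimately show "(LINT x:{a<..<b}|lborel. \<theta> x *\<^sub>R (f x - c)) = 0"
      using i\<theta> set_integrable_mult_test_fun[OF \<theta> const assms(1), of c]
      by (simp add: scaleR_right_diff_distrib set_integral_diff)
  qed
  then show ?thesis by auto
qed

context interval_measure
begin

text \<open>
  The two orders of integration of \<open>k y * w x\<close> over the triangle \<open>a < y < x < b\<close>.
\<close>

lemma fubini_triangle:
  fixes k w :: "real \<Rightarrow> 'k::{real_normed_field,euclidean_space}"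
  assumes k: "set_integrable M {a<..<b} k" and w: "set_integrable lborel {a<..<b} w"
  shows "set_integrable lborel {a<..<b} (\<lambda>x. (LINT y:{a<..<x}|M. k y) * w x)"
    and "set_integrable M {a<..<b} (\<lambda>y. k y * (LINT x:{y<..<b}|lborel. w x))"
    and "(LINT x:{a<..<b}|lborel. (LINT y:{a<..<x}|M. k y) * w x)
       = (LINT y:{a<..<b}|M. k y * (LINT x:{y<..<b}|lborel. w x))"
proof -
  interpret P: pair_sigma_finite M lborel ..
  define K where "K y = indicator {a<..<b} y *\<^sub>R k y" for y
  define W where "W x = indicator {a<..<b} x *\<^sub>R w x" for x
  have K: "integrable M K" and W: "integrable lborel W"
    using k w unfolding K_def W_def set_integrable_def by auto
  have Km [measurable]: "K \<in> borel_measurable M" and Wm [measurable]: "W \<in> borel_measurable borel"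
    using K W by auto
  have id [measurable]: "(\<lambda>x. x) \<in> borel_measurable M" by (rule measurable_M) simp
  define F where "F y x = (indicator {y<..} x :: real) *\<^sub>R (K y * W x)" for y x
  have "integrable (M \<Otimes>\<^sub>M lborel) (\<lambda>p. K (fst p) * W (snd p))"
  proof (rule P.Fubini_integrable)
    show "(\<lambda>p. K (fst p) * W (snd p)) \<in> borel_measurable (M \<Otimes>\<^sub>M lborel)" by measurable
    show "integrable M (\<lambda>x. LINT y|lborel. norm (K (fst (x, y)) * W (snd (x, y))))"
      using K W by (simp add: norm_mult)
    show "AE x in M. integrable lborel (\<lambda>y. K (fst (x, y)) * W (snd (x, y)))"
      using W by simp
  qed
  then have F: "integrable (M \<Otimes>\<^sub>M lborel) (\<lambda>(y, x). F y x)"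
  proof (rule Bochner_Integration.integrable_bound)
    show "(\<lambda>(y, x). F y x) \<in> borel_measurable (M \<Otimes>\<^sub>M lborel)"
    proof -
      have *: "(\<lambda>p. fst p) \<in> borel_measurable (M \<Otimes>\<^sub>M lborel)" "(\<lambda>p. snd p) \<in> borel_measurable (M \<Otimes>\<^sub>M lborel)"
        using measurable_compose[OF measurable_fst id] measurable_compose[OF measurable_snd measurable_ident_sets[OF sets_lborel]]
        by simp_all
      have "(\<lambda>p. K (fst p) * W (snd p)) \<in> borel_measurable (M \<Otimes>\<^sub>M lborel)" by measurable
      then have "(\<lambda>p. if fst p < snd p then K (fst p) * W (snd p) else 0) \<in> borel_measurable (M \<Otimes>\<^sub>M lborel)"
        by (intro measurable_If borel_measurable_less[OF *]) auto
      then show ?thesis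
        by (rule measurable_cong[THEN iffD1, rotated]) (auto simp: F_def)
    qed
  qed (auto simp: F_def indicator_def)
  have eq1: "(LINT y|M. F y x) = indicator {a<..<b} x *\<^sub>R ((LINT y:{a<..<x}|M. k y) * w x)" for x
  proof -
    have "F y x = (indicator {a<..<x} y *\<^sub>R k y) * W x" for y
      by (auto simp: F_def K_def W_def indicator_def)
    then have "(LINT y|M. F y x) = (LINT y:{a<..<x}|M. k y) * W x"
      unfolding set_lebesgue_integral_def by (simp only: integral_mult_left_zero)
    then show ?thesis by (simp add: W_def)
  qed
  have eq2: "(LINT x|lborel. F y x) = indicator {a<..<b} y *\<^sub>R (k y * (LINT x:{y<..<b}|lborel. w x))" for y
  proof -
    have "F y x = K y * (indicator {y<..<b} x *\<^sub>R w x)" for x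
      by (auto simp: F_def K_def W_def indicator_def)
    then have "(LINT x|lborel. F y x) = K y * (LINT x:{y<..<b}|lborel. w x)"
      unfolding set_lebesgue_integral_def by (simp only: integral_mult_right_zero)
    then show ?thesis by (simp add: K_def)
  qed
  show "set_integrable lborel {a<..<b} (\<lambda>x. (LINT y:{a<..<x}|M. k y) * w x)"
    using P.integrable_snd[OF F] unfolding eq1 set_integrable_def .
  show "set_integrable M {a<..<b} (\<lambda>y. k y * (LINT x:{y<..<b}|lborel. w x))"
    using P.integrable_fst[OF F] unfolding eq2 set_integrable_def .
  show "(LINT x:{a<..<b}|lborel. (LINT y:{a<..<x}|M. k y) * w x)
       = (LINT y:{a<..<b}|M. k y * (LINT x:{y<..<b}|lborel. w x))"
    using P.Fubini_integral[OF F] unfolding eq1 eq2 set_lebesgue_integral_def .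
qed

end

text \<open>
  Absolute continuity of \<open>v\<close> on the closed interval, with derivative \<open>w\<close> almost everywhere.
\<close>

definition primitive_on :: "real \<Rightarrow> real \<Rightarrow> (real \<Rightarrow> 'k) \<Rightarrow> (real \<Rightarrow> 'k::{real_normed_field,euclidean_space}) \<Rightarrow> bool" where
  "primitive_on a b w v \<longleftrightarrow> set_integrable lborel {a<..<b} w \<and>
     (\<forall>x\<in>{a..b}. v x = v a + (LINT t:{a<..<x}|lborel. w t))"

lemma set_integral_Ioo_split:
  fixes w :: "real \<Rightarrow> 'k::euclidean_space"
  assumes "set_integrable lborel {a<..<b} w" "a \<le> x" "x \<le> b"
  shows "(LINT t:{a<..<b}|lborel. w t) = (LINT t:{a<..<x}|lborel. w t) + (LINT t:{x<..<b}|lborel. w t)"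
proof -
  have int: "set_integrable lborel A w" if "A \<in> sets lborel" "A \<subseteq> {a<..<b}" for A
    using set_integrable_subset[OF assms(1)] that by blast
  have "(LINT t:{a<..<b}|lborel. w t) = (LINT t:{a<..<x} \<union> {x<..<b}|lborel. w t)"
    by (rule set_integral_finite_diff[where F = "{x}"]) (use assms in \<open>auto intro!: int\<close>)
  also have "\<dots> = (LINT t:{a<..<x}|lborel. w t) + (LINT t:{x<..<b}|lborel. w t)"
    using assms(2,3) by (intro set_integral_Un int) auto
  finally show ?thesis .
qed

lemma primitive_on_diff:
  assumes "primitive_on a b w v" "a \<le> x" "x \<le> y" "y \<le> b"
  shows "v y - v x = (LINT t:{x<..<y}|lborel. w t)"
proof -
  have "set_integrable lborel {a<..<b} w"
    and v: "\<And>x. x \<in> {a..b} \<Longrightarrow> v x = v a + (LINT t:{a<..<x}|lborel. w t)"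
    using assms(1) unfolding primitive_on_def by blast+
  then have "set_integrable lborel {a<..<y} w"
    by (rule_tac set_integrable_subset) (use assms in auto)
  from set_integral_Ioo_split[OF this assms(2,3)] show ?thesis
    using v[of x] v[of y] assms by simp
qed

lemma test_fun_primitive_on:
  assumes "\<phi> \<in> test_fun a b" "a < b"
  shows "primitive_on a b (\<lambda>x. of_real (deriv \<phi> x)) (\<lambda>x. of_real (\<phi> x) :: 'k::{real_normed_field,euclidean_space})"
  unfolding primitive_on_def
proof (intro conjI ballI)
  show "set_integrable lborel {a<..<b} (\<lambda>x. of_real (deriv \<phi> x) :: 'k)"
    using set_integrable_mult_test_fun[OF test_fun_deriv[OF assms(1)] set_integrable_imp_L1_loc[OF set_integrable_const_Ioo] assms(2), of "1::'k"]
    by (simp add: scaleR_conv_of_real)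
  fix x assume x: "x \<in> {a..b}"
  have cont: "continuous_on {a..x} (deriv \<phi>)" by (rule test_fun_continuous[OF test_fun_deriv[OF assms(1)]])
  have "(\<phi> has_vector_derivative deriv \<phi> t) (at t within {a..x})" for t
    using test_fun_has_derivative[OF assms(1), of t]
    by (simp add: has_real_derivative_iff_has_vector_derivative has_vector_derivative_at_within)
  then have "\<phi> x - \<phi> a = (LINT t:{a..x}|lborel. deriv \<phi> t)"
    using integral_FTC_atLeastAtMost[of a x \<phi> "deriv \<phi>"] x cont by (simp add: set_lebesgue_integral_def)
  also have "(LINT t:{a..x}|lborel. deriv \<phi> t) = (LINT t:{a<..<x}|lborel. deriv \<phi> t)"
  proof (rule set_integral_finite_diff[where F = "{a, x}"])
    show "set_integrable lborel {a..x} (deriv \<phi>)" by (rule borel_integrable_atLeastAtMost'[OF cont])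
    then show "set_integrable lborel {a<..<x} (deriv \<phi>)" by (rule set_integrable_subset) auto
  qed auto
  finally have "\<phi> x = \<phi> a + (LINT t:{a<..<x}|lborel. deriv \<phi> t)" by simp
  then have "(of_real (\<phi> x) :: 'k) = of_real (\<phi> a) + of_real (LINT t:{a<..<x}|lborel. deriv \<phi> t)"
    by (metis of_real_add)
  also have "of_real (LINT t:{a<..<x}|lborel. deriv \<phi> t) = (LINT t:{a<..<x}|lborel. (of_real (deriv \<phi> t) :: 'k))"
  proof -
    have "set_integrable lborel {a<..<x} (deriv \<phi>)"
      by (rule set_integrable_subset[OF borel_integrable_atLeastAtMost'[OF cont]]) auto
    from integral_bounded_linear[OF bounded_linear_of_real[where 'a = 'k] this[unfolded set_integrable_def]]
    show ?thesis by (simp add: set_lebesgue_integral_def scaleR_conv_of_real)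
  qed
  finally show "(of_real (\<phi> x) :: 'k) = of_real (\<phi> a) + (LINT t:{a<..<x}|lborel. of_real (deriv \<phi> t))" .
qed

context interval_measure
begin

text \<open>
  The factor \<open>c + (LINT y:{a<..<x}|M. k y)\<close> jumps at the atoms of \<open>M\<close>; Fubini's theorem needs no continuity, and
  the boundary terms contain the limits \<open>c\<close> and \<open>c + (LINT y:{a<..<b}|M. k y)\<close> of this factor at the end points.
\<close>

lemma integration_by_parts:
  fixes k w v :: "real \<Rightarrow> 'k::{real_normed_field,euclidean_space}"
  assumes k: "set_integrable M {a<..<b} k" and v: "primitive_on a b w v"
  shows "set_integrable M {a<..<b} (\<lambda>y. k y * v y)"
    and "set_integrable lborel {a<..<b} (\<lambda>x. (c + (LINT y:{a<..<x}|M. k y)) * w x)"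
    and "(LINT x:{a<..<b}|lborel. (c + (LINT y:{a<..<x}|M. k y)) * w x)
       = (c + (LINT y:{a<..<b}|M. k y)) * v b - c * v a - (LINT y:{a<..<b}|M. k y * v y)"
proof -
  have w: "set_integrable lborel {a<..<b} w" using v by (simp add: primitive_on_def)
  have diff: "(LINT x:{y<..<b}|lborel. w x) = v b - v y" if "y \<in> {a..b}" for y
    using primitive_on_diff[OF v, of y b] that by auto
  note F = fubini_triangle[OF k w]
  have kv: "set_integrable M {a<..<b} (\<lambda>y. k y * (v b - v y))"
    using F(2) unfolding set_integrable_def
    by (rule Bochner_Integration.integrable_cong[THEN iffD1, rotated -1]) (auto simp: indicator_def diff)
  have kvb: "set_integrable M {a<..<b} (\<lambda>y. k y * v b)" using k by simp
  have eq: "k y * v y = k y * v b - k y * (v b - v y)" for y by (simp add: algebra_simps)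
  show "set_integrable M {a<..<b} (\<lambda>y. k y * v y)"
    unfolding eq by (rule set_integral_diff(1)[OF kvb kv])
  have *: "(LINT y:{a<..<b}|M. k y * v y) = (LINT y:{a<..<b}|M. k y) * v b - (LINT y:{a<..<b}|M. k y * (v b - v y))"
    unfolding eq by (subst set_integral_diff(2)[OF kvb kv]) simp
  have "(LINT y:{a<..<b}|M. k y * (LINT x:{y<..<b}|lborel. w x)) = (LINT y:{a<..<b}|M. k y * (v b - v y))"
    by (intro set_lebesgue_integral_cong subset_sets_M) (auto simp: diff)
  note F3 = F(3)[unfolded this]
  have cw: "set_integrable lborel {a<..<b} (\<lambda>x. c * w x)" using w by simp
  show "set_integrable lborel {a<..<b} (\<lambda>x. (c + (LINT y:{a<..<x}|M. k y)) * w x)"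
    unfolding distrib_right by (rule set_integral_add(1)[OF cw F(1)])
  have "(LINT x:{a<..<b}|lborel. (c + (LINT y:{a<..<x}|M. k y)) * w x)
      = c * (v b - v a) + (LINT y:{a<..<b}|M. k y * (v b - v y))"
    unfolding distrib_right set_integral_add(2)[OF cw F(1)] F3 using diff[of a] less by simp
  then show "(LINT x:{a<..<b}|lborel. (c + (LINT y:{a<..<x}|M. k y)) * w x)
       = (c + (LINT y:{a<..<b}|M. k y)) * v b - c * v a - (LINT y:{a<..<b}|M. k y * v y)"
    unfolding * by (simp only: ring_distribs) simp
qed

lemma integrable_indefinite:
  fixes k :: "real \<Rightarrow> 'k::{real_normed_field,euclidean_space}"
  assumes "set_integrable M {a<..<b} k"
  shows "set_integrable lborel {a<..<b} (\<lambda>x. c + (LINT y:{a<..<x}|M. k y))"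
proof -
  have 1: "set_integrable lborel {a<..<b} (\<lambda>_. c)" for c :: 'k by (rule set_integrable_const_Ioo)
  show ?thesis using set_integral_add(1)[OF 1 fubini_triangle(1)[OF assms 1[of 1]], of c] by simp
qed

text \<open>
  Integration by parts against a test function, whose boundary values vanish.
\<close>

lemma has_distr_deriv_indefinite:
  fixes f k :: "real \<Rightarrow> 'k::{real_normed_field,euclidean_space}"
  assumes k: "set_integrable M {a<..<b} k" and f: "set_integrable lborel {a<..<b} f"
    and AE: "AE x in lborel. x \<in> {a<..<b} \<longrightarrow> f x = c + (LINT y:{a<..<x}|M. k y)"
  shows "has_distr_deriv a b M f k"
  unfolding has_distr_deriv_def
proof
  fix \<phi> assume \<phi>: "\<phi> \<in> test_fun a b"
  have ends: "\<phi> a = 0" "\<phi> b = 0"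
    using \<phi> by (auto simp: test_fun_def)
  note IBP = integration_by_parts[OF k test_fun_primitive_on[OF \<phi> less, where 'k = 'k]]
  have "(LINT x:{a<..<b}|lborel. deriv \<phi> x *\<^sub>R f x)
      = (LINT x:{a<..<b}|lborel. (c + (LINT y:{a<..<x}|M. k y)) * of_real (deriv \<phi> x))"
  proof (rule set_integral_cong_AE[OF _ IBP(2)])
    show "set_integrable lborel {a<..<b} (\<lambda>x. deriv \<phi> x *\<^sub>R f x)"
      by (intro set_integrable_mult_test_fun[OF test_fun_deriv[OF \<phi>] set_integrable_imp_L1_loc[OF f] less])
    show "AE x in lborel. x \<in> {a<..<b} \<longrightarrow> deriv \<phi> x *\<^sub>R f x = (c + (LINT y:{a<..<x}|M. k y)) * of_real (deriv \<phi> x)"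
      using AE by eventually_elim (auto simp: scaleR_conv_of_real mult.commute)
  qed
  also have "\<dots> = - (LINT y:{a<..<b}|M. k y * of_real (\<phi> y))"
    unfolding IBP(3) using ends by simp
  finally show "(LINT x:{a<..<b}|lborel. deriv \<phi> x *\<^sub>R f x) = - (LINT x:{a<..<b}|M. \<phi> x *\<^sub>R k x)"
    by (simp add: scaleR_conv_of_real mult.commute)
qed

text \<open>
  Subtracting the indefinite integral of \<open>k\<close>, which has the same distributional derivative as \<open>f\<close>,
  leaves a function with vanishing derivative.
\<close>

lemma has_distr_deriv_imp_indefinite:
  fixes f k :: "real \<Rightarrow> 'k::{real_normed_field,euclidean_space}"
  assumes k: "set_integrable M {a<..<b} k" and f: "f \<in> L1_loc a b" and d: "has_distr_deriv a b M f k"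
  shows "\<exists>c. AE x in lborel. x \<in> {a<..<b} \<longrightarrow> f x = c + (LINT y:{a<..<x}|M. k y)"
proof -
  define U where "U x = (LINT y:{a<..<x}|M. k y)" for x
  have U: "set_integrable lborel {a<..<b} U"
    using integrable_indefinite[OF k, of 0] by (simp add: U_def[abs_def])
  have dU: "has_distr_deriv a b M U k"
    by (rule has_distr_deriv_indefinite[OF k U, of 0]) (simp add: U_def)
  have "\<exists>c. AE x in lborel. x \<in> {a<..<b} \<longrightarrow> f x - U x = c"
  proof (rule AE_constant_if_distr_deriv_zero[OF less])
    show "(\<lambda>x. f x - U x) \<in> L1_loc a b"
      using f set_integrable_imp_L1_loc[OF U] by (auto simp: L1_loc_def intro!: set_integral_diff)
    fix \<phi> assume \<phi>: "\<phi> \<in> test_fun a b"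
    note int = set_integrable_mult_test_fun[OF test_fun_deriv[OF \<phi>] f less]
      set_integrable_mult_test_fun[OF test_fun_deriv[OF \<phi>] set_integrable_imp_L1_loc[OF U] less]
    show "(LINT x:{a<..<b}|lborel. deriv \<phi> x *\<^sub>R (f x - U x)) = 0"
      using d dU \<phi> unfolding scaleR_right_diff_distrib set_integral_diff(2)[OF int] has_distr_deriv_def by simp
  qed
  then obtain c where "AE x in lborel. x \<in> {a<..<b} \<longrightarrow> f x - U x = c" by blast
  then have "AE x in lborel. x \<in> {a<..<b} \<longrightarrow> f x = c + U x"
    by eventually_elim (auto simp: algebra_simps)
  then show ?thesis unfolding U_def by blast
qed

lemma has_distr_deriv_unique:
  fixes f g g' :: "real \<Rightarrow> 'k::{real_normed_field,euclidean_space}"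
  assumes "set_integrable M {a<..<b} g" "set_integrable M {a<..<b} g'"
    and "has_distr_deriv a b M f g" "has_distr_deriv a b M f g'"
  shows "AE x in M. x \<in> {a<..<b} \<longrightarrow> g x = g' x"
proof -
  have int: "set_integrable M {a<..<b} (\<lambda>x. \<phi> x *\<^sub>R h x)"
    if "\<phi> \<in> test_fun a b" "set_integrable M {a<..<b} h" for \<phi> and h :: "real \<Rightarrow> 'k"
    using integration_by_parts(1)[OF that(2) test_fun_primitive_on[OF that(1) less]]
    by (simp add: scaleR_conv_of_real mult.commute)
  have "AE x in M. x \<in> {a<..<b} \<longrightarrow> g x - g' x = 0"
  proof (rule AE_zero_if_test_integrals_zero)
    fix c d assume "a < c" "c < d" "d < b"
    then show "set_integrable M {c..d} (\<lambda>x. g x - g' x)"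
      using set_integral_diff(1)[OF assms(1,2)] by (rule_tac set_integrable_borel_subset) auto
  next
    fix \<phi> assume \<phi>: "\<phi> \<in> test_fun a b"
    then have "- (LINT x:{a<..<b}|M. \<phi> x *\<^sub>R g x) = - (LINT x:{a<..<b}|M. \<phi> x *\<^sub>R g' x)"
      using assms(3,4) unfolding has_distr_deriv_def by metis
    then show "(LINT x:{a<..<b}|M. \<phi> x *\<^sub>R (g x - g' x)) = 0"
      unfolding scaleR_right_diff_distrib
      by (simp add: set_integral_diff(2)[OF int[OF \<phi> assms(1)] int[OF \<phi> assms(2)]])
  qed
  then show ?thesis by eventually_elim auto
qed

end


section \<open>Square integrable functions\<close>

lemma sq_integrableD:
  assumes "f \<in> sq_integrable M"
  shows "f \<in> borel_measurable M" "integrable M (\<lambda>x. (norm (f x))\<^sup>2)"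
  using assms by (auto simp: sq_integrable_def)

lemma integrable_mult_sq_integrable:
  assumes "f \<in> sq_integrable M" "g \<in> sq_integrable M"
  shows "integrable M (\<lambda>x. f x * g x)"
proof (rule Bochner_Integration.integrable_bound)
  show "integrable M (\<lambda>x. (norm (f x))\<^sup>2 + (norm (g x))\<^sup>2)"
    using assms by (auto dest: sq_integrableD)
  show "(\<lambda>x. f x * g x) \<in> borel_measurable M"
    using sq_integrableD(1)[OF assms(1)] sq_integrableD(1)[OF assms(2)] by measurable
  have "norm (f x * g x) \<le> (norm (f x))\<^sup>2 + (norm (g x))\<^sup>2" for x
    using sum_squares_bound[of "norm (f x)" "norm (g x)"] mult_nonneg_nonneg[OF norm_ge_zero norm_ge_zero, of "f x" "g x"]
    unfolding norm_mult by linarith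
  then show "AE x in M. norm (f x * g x) \<le> norm ((norm (f x))\<^sup>2 + (norm (g x))\<^sup>2)"
    by (intro AE_I2) simp
qed

lemma sq_integrable_bound:
  fixes f :: "'x \<Rightarrow> 'k::{real_normed_field,euclidean_space}"
  assumes "f \<in> borel_measurable M" "integrable M u" "\<And>x. x \<in> space M \<Longrightarrow> (norm (f x))\<^sup>2 \<le> u x"
  shows "f \<in> sq_integrable M"
  unfolding sq_integrable_def
proof (intro CollectI conjI assms(1))
  show "integrable M (\<lambda>x. (norm (f x))\<^sup>2)"
  proof (rule Bochner_Integration.integrable_bound[OF assms(2)])
    show "(\<lambda>x. (norm (f x))\<^sup>2) \<in> borel_measurable M" using assms(1) by measurable
    show "AE x in M. norm ((norm (f x))\<^sup>2) \<le> norm (u x)"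
      using assms(3) by (intro AE_I2) force
  qed
qed

lemma sq_integrable_add:
  assumes "f \<in> sq_integrable M" "g \<in> sq_integrable M"
  shows "(\<lambda>x. f x + g x) \<in> sq_integrable M"
proof (rule sq_integrable_bound)
  show "integrable M (\<lambda>x. 2 * ((norm (f x))\<^sup>2 + (norm (g x))\<^sup>2))"
    by (intro integrable_mult_right Bochner_Integration.integrable_add sq_integrableD assms)
  show "(\<lambda>x. f x + g x) \<in> borel_measurable M"
    using sq_integrableD(1)[OF assms(1)] sq_integrableD(1)[OF assms(2)] by measurable
  fix x
  have "(norm (f x + g x))\<^sup>2 \<le> (norm (f x) + norm (g x))\<^sup>2"
    by (intro power_mono norm_triangle_ineq) simp
  also have "\<dots> \<le> 2 * ((norm (f x))\<^sup>2 + (norm (g x))\<^sup>2)"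
    using sum_squares_bound[of "norm (f x)" "norm (g x)"] by (simp add: power2_sum)
  finally show "(norm (f x + g x))\<^sup>2 \<le> 2 * ((norm (f x))\<^sup>2 + (norm (g x))\<^sup>2)" .
qed

lemma sq_integrable_cmult:
  assumes "f \<in> sq_integrable M"
  shows "(\<lambda>x. c * f x) \<in> sq_integrable M"
  using sq_integrableD[OF assms] by (simp add: sq_integrable_def norm_mult power_mult_distrib)

lemma sq_integrable_diff:
  assumes "f \<in> sq_integrable M" "g \<in> sq_integrable M"
  shows "(\<lambda>x. f x - g x) \<in> sq_integrable M"
  using sq_integrable_add[OF assms(1) sq_integrable_cmult[OF assms(2), of "-1"]] by simp

lemma sq_integrable_conj:
  assumes "f \<in> sq_integrable M"
  shows "(\<lambda>x. conj_sc (f x)) \<in> sq_integrable M"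
proof -
  have [measurable]: "f \<in> borel_measurable M" using assms by (rule sq_integrableD)
  have "(\<lambda>x. conj_sc (f x)) \<in> borel_measurable M" by measurable
  then show ?thesis using sq_integrableD[OF assms] by (simp add: sq_integrable_def)
qed

lemma sq_integrable_cong_AE:
  assumes "f \<in> sq_integrable M" "g \<in> borel_measurable M" "AE x in M. g x = f x"
  shows "g \<in> sq_integrable M"
proof -
  have [measurable]: "f \<in> borel_measurable M" "g \<in> borel_measurable M"
    using assms by (auto dest: sq_integrableD)
  have "integrable M (\<lambda>x. (norm (g x))\<^sup>2) \<longleftrightarrow> integrable M (\<lambda>x. (norm (f x))\<^sup>2)"
    by (rule integrable_cong_AE) (measurable, measurable, use assms(3) in \<open>eventually_elim, simp\<close>)
  then show ?thesis using assms by (simp add: sq_integrable_def)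
qed

lemma (in finite_measure) sq_integrable_bounded:
  fixes f :: "'a \<Rightarrow> 'k::{real_normed_field,euclidean_space}"
  assumes "f \<in> borel_measurable M" "\<And>x. x \<in> space M \<Longrightarrow> norm (f x) \<le> B"
  shows "f \<in> sq_integrable M"
proof (rule sq_integrable_bound[OF assms(1)])
  show "integrable M (\<lambda>_. B\<^sup>2)" by simp
  show "(norm (f x))\<^sup>2 \<le> B\<^sup>2" if "x \<in> space M" for x
    by (intro power_mono assms(2) that) simp
qed

lemma (in finite_measure) integrable_sq_integrable:
  assumes "f \<in> sq_integrable M"
  shows "integrable M f"
proof -
  have "(\<lambda>_. 1) \<in> sq_integrable M" by (rule sq_integrable_bounded[of _ 1]) auto
  from integrable_mult_sq_integrable[OF assms this] show ?thesis by simp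
qed

lemma L2_class_self: "f \<in> sq_integrable M \<Longrightarrow> f \<in> L2_class M f"
  by (simp add: L2_class_def)

lemma L2_class_cong:
  assumes "AE x in M. f x = g x"
  shows "L2_class M f = L2_class M g"
proof -
  have "(AE x in M. h x = f x) \<longleftrightarrow> (AE x in M. h x = g x)" for h
    using assms by (auto elim: AE_mp)
  then show ?thesis by (simp add: L2_class_def)
qed

lemma rep_in_L2:
  assumes "F \<in> L2 M"
  shows "rep F \<in> sq_integrable M" "L2_class M (rep F) = F"
proof -
  obtain f where f: "f \<in> sq_integrable M" "F = L2_class M f"
    using assms by (auto simp: L2_def)
  have "rep F \<in> L2_class M f"
    unfolding rep_def f(2) by (rule someI[of "\<lambda>x. x \<in> L2_class M f", OF L2_class_self[OF f(1)]])
  then have *: "rep F \<in> sq_integrable M" "AE x in M. rep F x = f x" by (auto simp: L2_class_def)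
  show "rep F \<in> sq_integrable M" by fact
  show "L2_class M (rep F) = F" unfolding f(2) by (rule L2_class_cong[OF *(2)[unfolded f(2)]])
qed

lemma rep_L2_class:
  assumes "f \<in> sq_integrable M"
  shows "L2_class M f \<in> L2 M" "AE x in M. rep (L2_class M f) x = f x"
proof -
  have "rep (L2_class M f) \<in> L2_class M f"
    unfolding rep_def by (rule someI[of "\<lambda>x. x \<in> L2_class M f", OF L2_class_self[OF assms]])
  then show "AE x in M. rep (L2_class M f) x = f x" by (simp add: L2_class_def)
qed (use assms in \<open>auto simp: L2_def\<close>)

section \<open>Sobolev functions of one variable\<close>

lemma set_integrable_Ioo_iff:
  fixes f :: "real \<Rightarrow> 'k::euclidean_space"
  shows "integrable (restrict_space lborel {a<..<b}) f \<longleftrightarrow> set_integrable lborel {a<..<b} f"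
  unfolding set_integrable_def by (rule integrable_restrict_space) simp

lemma finite_measure_Ioo: "finite_measure (restrict_space lborel {a<..<b::real})"
proof (rule finite_measureI)
  have "emeasure (restrict_space lborel {a<..<b}) {a<..<b} = emeasure lborel {a<..<b}"
    by (subst emeasure_restrict_space) auto
  then show "emeasure (restrict_space lborel {a<..<b}) (space (restrict_space lborel {a<..<b})) \<noteq> \<infinity>"
    using emeasure_bounded_finite[of "{a<..<b}"] by (simp add: space_restrict_space)
qed

lemma sq_integrable_Ioo_imp_integrable:
  "f \<in> sq_integrable (restrict_space lborel {a<..<b::real}) \<Longrightarrow> set_integrable lborel {a<..<b} f"
  using finite_measure.integrable_sq_integrable[OF finite_measure_Ioo] set_integrable_Ioo_iff by blast

lemma continuous_on_indefinite:
  fixes w :: "real \<Rightarrow> 'k::euclidean_space"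
  assumes "set_integrable lborel {a<..<b} w"
  shows "continuous_on {a..b} (\<lambda>x. LINT t:{a<..<x}|lborel. w t)"
proof -
  define g where "g t = indicator {a<..<b} t *\<^sub>R w t" for t
  have g: "integrable lborel g" using assms by (simp add: g_def[abs_def] set_integrable_def)
  have gs: "set_integrable lborel A g" if "A \<in> sets borel" for A
    unfolding set_integrable_def using g that by (intro integrable_mult_indicator) auto
  have "g integrable_on {a..b}"
    using set_borel_integral_eq_integral(1)[OF gs[of "{a..b}"]] by simp
  from indefinite_integral_continuous_1[OF this]
  have "continuous_on {a..b} (\<lambda>x. integral {a..x} g)" .
  moreover have "integral {a..x} g = (LINT t:{a<..<x}|lborel. w t)" if "x \<in> {a..b}" for x
  proof -
    have "integral {a..x} g = (LINT t:{a..x}|lborel. g t)"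
      using set_borel_integral_eq_integral(2)[OF gs[of "{a..x}"]] by simp
    also have "\<dots> = (LINT t:{a<..<x}|lborel. g t)"
      by (rule set_integral_finite_diff[where F = "{a, x}"]) (auto intro: gs)
    also have "\<dots> = (LINT t:{a<..<x}|lborel. w t)"
      using that by (intro set_lebesgue_integral_cong) (auto simp: g_def)
    finally show ?thesis .
  qed
  ultimately show ?thesis by (rule continuous_on_eq)
qed

lemma primitive_onD:
  assumes "primitive_on a b w v"
  shows "set_integrable lborel {a<..<b} w" "x \<in> {a..b} \<Longrightarrow> v x = v a + (LINT t:{a<..<x}|lborel. w t)"
  using assms unfolding primitive_on_def by blast+

lemma primitive_on_continuous:
  assumes "primitive_on a b w v"
  shows "continuous_on {a..b} v"
proof -
  have "continuous_on {a..b} (\<lambda>x. v a + (LINT t:{a<..<x}|lborel. w t))"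
    using assms by (intro continuous_on_add continuous_on_const continuous_on_indefinite) (simp add: primitive_on_def)
  then show ?thesis
    by (rule continuous_on_eq) (rule primitive_onD(2)[OF assms, symmetric])
qed

lemma continuous_on_AE_eq:
  fixes f g :: "real \<Rightarrow> 'k::euclidean_space"
  assumes "a < b" "continuous_on {a..b} f" "continuous_on {a..b} g"
    and AE: "AE x in lborel. x \<in> {a<..<b} \<longrightarrow> f x = g x" and "x \<in> {a..b}"
  shows "f x = g x"
proof -
  define C where "C = {x \<in> {a..b}. f x = g x}"
  have "C = {a..b} \<inter> (\<lambda>x. f x - g x) -` {0}" by (auto simp: C_def)
  moreover have "continuous_on {a..b} (\<lambda>x. f x - g x)" using assms by (intro continuous_intros)
  ultimately have C: "closed C" using continuous_closed_preimage[of "{a..b}" "\<lambda>x. f x - g x" "{0}"] by simp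
  have "AE x in lborel. x \<in> {a<..<b} \<longrightarrow> x \<in> C"
    using AE by eventually_elim (auto simp: C_def)
  then have "AE x \<in> {a<..<b} in lebesgue. x \<in> C" by (rule AE_completion)
  from mem_closed_if_AE_lebesgue_open[OF _ C this] have "{a<..<b} \<subseteq> C" by auto
  then have "closure {a<..<b} \<subseteq> C" using C by (rule closure_minimal)
  then show ?thesis using assms(1,5) by (auto simp: C_def)
qed

lemma has_distr_deriv_restrict_Icc:
  "has_distr_deriv a b (restrict_space lborel {a..b}) f g \<longleftrightarrow> has_distr_deriv a b lborel f g"
proof -
  have "{a<..<b} \<subseteq> {a..b}" by auto
  then show ?thesis unfolding has_distr_deriv_def by (simp only: set_integral_restrict_Icc)
qed

lemma primitive_on_has_distr_deriv:
  assumes "a < b" "primitive_on a b w v"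
  shows "has_distr_deriv a b lborel v w" "v \<in> L1_loc a b" "w \<in> L1_loc a b"
proof -
  interpret I: interval_measure "restrict_space lborel {a..b}" a b
    by (rule interval_measure_lborel[OF assms(1)])
  have sub: "{a<..<b} \<subseteq> {a..b}" "\<And>x. x \<in> {a<..<b} \<Longrightarrow> {a<..<x} \<subseteq> {a..b}" by auto
  have w: "set_integrable lborel {a<..<b} w" using assms(2) by (simp add: primitive_on_def)
  have v: "set_integrable lborel {a<..<b} v"
    by (rule set_integrable_subset[OF borel_integrable_atLeastAtMost'[OF primitive_on_continuous[OF assms(2)]]]) auto
  show "has_distr_deriv a b lborel v w"
    unfolding has_distr_deriv_restrict_Icc[symmetric]
  proof (rule I.has_distr_deriv_indefinite[OF _ v])
    show "set_integrable (restrict_space lborel {a..b}) {a<..<b} w"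
      using w by (simp add: set_integral_restrict_Icc sub)
    show "AE x in lborel. x \<in> {a<..<b} \<longrightarrow> v x = v a + (LINT y:{a<..<x}|restrict_space lborel {a..b}. w y)"
    proof (intro AE_I2 impI)
      fix x assume x: "x \<in> {a<..<b}"
      then have "v x = v a + (LINT y:{a<..<x}|lborel. w y)"
        by (intro primitive_onD(2)[OF assms(2)]) auto
      then show "v x = v a + (LINT y:{a<..<x}|restrict_space lborel {a..b}. w y)"
        using sub(2)[OF x] by (simp only: set_integral_restrict_Icc)
    qed
  qed
  show "v \<in> L1_loc a b" "w \<in> L1_loc a b" using v w by (auto intro: set_integrable_imp_L1_loc)
qed

lemma L1_loc_distr_deriv_unique:
  fixes w w' v :: "real \<Rightarrow> 'k::{real_normed_field,euclidean_space}"
  assumes "a < b" "w \<in> L1_loc a b" "w' \<in> L1_loc a b" "has_distr_deriv a b lborel v w" "has_distr_deriv a b lborel v w'"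
  shows "AE x in lborel. x \<in> {a<..<b} \<longrightarrow> w x = w' x"
proof -
  have "AE x in lborel. x \<in> {a<..<b} \<longrightarrow> w x - w' x = 0"
  proof (rule L1_loc_AE_zero[OF assms(1)])
    show "(\<lambda>x. w x - w' x) \<in> L1_loc a b"
      using assms(2,3) by (auto simp: L1_loc_def intro!: set_integral_diff)
    fix \<phi> assume \<phi>: "\<phi> \<in> test_fun a b"
    have "- (LINT x:{a<..<b}|lborel. \<phi> x *\<^sub>R w x) = - (LINT x:{a<..<b}|lborel. \<phi> x *\<^sub>R w' x)"
      using assms(4,5) \<phi> unfolding has_distr_deriv_def by metis
    then show "(LINT x:{a<..<b}|lborel. \<phi> x *\<^sub>R (w x - w' x)) = 0"
      unfolding scaleR_right_diff_distrib
      using set_integral_diff(2)[OF set_integrable_mult_test_fun[OF \<phi> assms(2,1)] set_integrable_mult_test_fun[OF \<phi> assms(3,1)]]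
      by simp
  qed
  then show ?thesis by eventually_elim auto
qed

text \<open>
  Local integrability gives measurability on compact subintervals only; a limit extends it to the open interval,
  where equality almost everywhere alone would not suffice for the Borel \<open>\<sigma>\<close>-algebra.
\<close>

lemma L1_loc_AE_eq_integrable:
  fixes f g :: "real \<Rightarrow> 'k::{real_normed_field,euclidean_space}"
  assumes f: "f \<in> L1_loc a b" and g: "set_integrable lborel {a<..<b} g"
    and AE: "AE x in lborel. x \<in> {a<..<b} \<longrightarrow> f x = g x"
  shows "set_integrable lborel {a<..<b} f"
proof -
  have "(\<lambda>x. indicator {a<..<b} x *\<^sub>R f x) \<in> borel_measurable lborel"
  proof (rule borel_measurable_LIMSEQ_metric)
    fix n :: nat
    have "set_integrable lborel {a + 1 / Suc n..b - 1 / Suc n} f"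
      using f by (simp add: L1_loc_def)
    then show "(\<lambda>x. indicator {a + 1 / Suc n..b - 1 / Suc n} x *\<^sub>R f x) \<in> borel_measurable lborel"
      by (auto simp: set_integrable_def)
  next
    fix x
    show "(\<lambda>n. indicator {a + 1 / Suc n..b - 1 / Suc n} x *\<^sub>R f x) \<longlonglongrightarrow> indicator {a<..<b} x *\<^sub>R f x"
    proof (cases "x \<in> {a<..<b}")
      case True
      then have "min (x - a) (b - x) > 0" by auto
      from order_tendstoD(2)[OF LIMSEQ_inverse_real_of_nat this]
      have "\<forall>\<^sub>F n in sequentially. x \<in> {a + 1 / Suc n..b - 1 / Suc n}"
        unfolding inverse_eq_divide by eventually_elim auto
      then have "\<forall>\<^sub>F n in sequentially. indicator {a + 1 / Suc n..b - 1 / Suc n} x *\<^sub>R f x = indicator {a<..<b} x *\<^sub>R f x"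
        by eventually_elim (simp only: indicator_simps True)
      then show ?thesis by (rule tendsto_eventually)
    next
      case False
      have "x \<notin> {a + 1 / Suc n..b - 1 / Suc n}" for n
      proof -
        have "0 < 1 / real (Suc n)" by simp
        then show ?thesis using False unfolding greaterThanLessThan_iff atLeastAtMost_iff by linarith
      qed
      then show ?thesis using False by simp
    qed
  qed
  moreover have "AE x in lborel. indicator {a<..<b} x *\<^sub>R f x = indicator {a<..<b} x *\<^sub>R g x"
    using AE by eventually_elim (auto simp: indicator_def)
  ultimately show ?thesis
    using g unfolding set_integrable_def
    by (subst integrable_cong_AE) auto
qed

lemma primitive_on_cong_AE:
  assumes "primitive_on a b w v" "set_integrable lborel {a<..<b} w'"
    and "AE x in lborel. x \<in> {a<..<b} \<longrightarrow> w' x = w x"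
  shows "primitive_on a b w' v"
  unfolding primitive_on_def
proof (intro conjI ballI assms(2))
  fix x assume x: "x \<in> {a..b}"
  have w: "set_integrable lborel {a<..<b} w" using assms(1) by (simp add: primitive_on_def)
  have "(LINT t:{a<..<x}|lborel. w' t) = (LINT t:{a<..<x}|lborel. w t)"
  proof (rule set_integral_cong_AE)
    show "set_integrable lborel {a<..<x} w'" "set_integrable lborel {a<..<x} w"
      using x by (auto intro: set_integrable_subset[OF assms(2)] set_integrable_subset[OF w])
    show "AE y in lborel. y \<in> {a<..<x} \<longrightarrow> w' y = w y"
      using assms(3) by eventually_elim (use x in auto)
  qed
  moreover have "v x = v a + (LINT t:{a<..<x}|lborel. w t)"
    using assms(1) x by (rule primitive_onD(2))
  ultimately show "v x = v a + (LINT t:{a<..<x}|lborel. w' t)" by simp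
qed

lemma weak_deriv_primitive_on:
  fixes w v :: "real \<Rightarrow> 'k::{real_normed_field,euclidean_space}"
  assumes "a < b" "primitive_on a b w v"
  shows "AE x in lborel. x \<in> {a<..<b} \<longrightarrow> weak_deriv a b v x = w x"
    and "primitive_on a b (weak_deriv a b v) v"
proof -
  note w = primitive_on_has_distr_deriv[OF assms]
  have *: "weak_deriv a b v \<in> L1_loc a b \<and> has_distr_deriv a b lborel v (weak_deriv a b v)"
    unfolding weak_deriv_def by (rule someI[of _ w]) (use w in auto)
  show AE: "AE x in lborel. x \<in> {a<..<b} \<longrightarrow> weak_deriv a b v x = w x"
    using L1_loc_distr_deriv_unique[OF assms(1)] * w by blast
  have "set_integrable lborel {a<..<b} (weak_deriv a b v)"
    using L1_loc_AE_eq_integrable[OF conjunct1[OF *] _ AE] assms(2) by (simp add: primitive_on_def)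
  then show "primitive_on a b (weak_deriv a b v) v"
    using primitive_on_cong_AE[OF assms(2) _ AE] by blast
qed

text \<open>
  The integral representation holds almost everywhere by the lemma of du Bois-Reymond, and then everywhere up to the
  end points since both sides are continuous.
\<close>

lemma W12_primitive_on:
  fixes v :: "real \<Rightarrow> 'k::{real_normed_field,euclidean_space}"
  assumes "a < b" "v \<in> W12 a b" "continuous_on {a..b} v"
  shows "primitive_on a b (weak_deriv a b v) v"
    and "weak_deriv a b v \<in> sq_integrable (restrict_space lborel {a<..<b})"
proof -
  obtain g where g: "g \<in> sq_integrable (restrict_space lborel {a<..<b})" "has_distr_deriv a b lborel v g"
    using assms(2) by (auto simp: W12_def)
  have gi: "set_integrable lborel {a<..<b} g" by (rule sq_integrable_Ioo_imp_integrable[OF g(1)])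
  interpret I: interval_measure "restrict_space lborel {a..b}" a b
    by (rule interval_measure_lborel[OF assms(1)])
  have sub: "{a<..<b} \<subseteq> {a..b}" "\<And>x. x \<in> {a..b} \<Longrightarrow> {a<..<x} \<subseteq> {a..b}" by auto
  have "v \<in> L1_loc a b"
    using assms(2) by (auto simp: W12_def intro: set_integrable_imp_L1_loc sq_integrable_Ioo_imp_integrable)
  moreover have "has_distr_deriv a b (restrict_space lborel {a..b}) v g"
    using g(2) by (simp add: has_distr_deriv_restrict_Icc)
  moreover have "set_integrable (restrict_space lborel {a..b}) {a<..<b} g"
    using gi by (simp add: set_integral_restrict_Icc sub)
  ultimately obtain c where "AE x in lborel. x \<in> {a<..<b} \<longrightarrow> v x = c + (LINT y:{a<..<x}|restrict_space lborel {a..b}. g y)"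
    using I.has_distr_deriv_imp_indefinite by blast
  then have "AE x in lborel. x \<in> {a<..<b} \<longrightarrow> v x = c + (LINT y:{a<..<x}|lborel. g y)"
    by eventually_elim (auto simp: set_integral_restrict_Icc sub)
  from continuous_on_AE_eq[OF assms(1,3) _ this]
  have v: "v x = c + (LINT y:{a<..<x}|lborel. g y)" if "x \<in> {a..b}" for x
    using continuous_on_add[OF continuous_on_const continuous_on_indefinite[OF gi]] that by blast
  have "v a = c" using v[of a] assms(1) by (simp add: set_lebesgue_integral_def)
  then have prim: "primitive_on a b g v" using v gi by (simp add: primitive_on_def)
  show w: "primitive_on a b (weak_deriv a b v) v" by (rule weak_deriv_primitive_on(2)[OF assms(1) prim])
  show "weak_deriv a b v \<in> sq_integrable (restrict_space lborel {a<..<b})"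
  proof (rule sq_integrable_cong_AE[OF g(1)])
    show "weak_deriv a b v \<in> borel_measurable (restrict_space lborel {a<..<b})"
      using w by (intro borel_measurable_integrable) (simp add: set_integrable_Ioo_iff primitive_on_def)
    show "AE x in restrict_space lborel {a<..<b}. weak_deriv a b v x = g x"
      using weak_deriv_primitive_on(1)[OF assms(1) prim] by (subst AE_restrict_space_iff) auto
  qed
qed

lemma primitive_on_W12:
  fixes w v :: "real \<Rightarrow> 'k::{real_normed_field,euclidean_space}"
  assumes "a < b" "primitive_on a b w v" "w \<in> sq_integrable (restrict_space lborel {a<..<b})"
  shows "v \<in> W12 a b"
proof -
  have cont: "continuous_on {a..b} v" by (rule primitive_on_continuous[OF assms(2)])
  then obtain B where B: "\<forall>x\<in>{a..b}. norm (v x) \<le> B"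
    using compact_imp_bounded[OF compact_continuous_image[OF cont compact_Icc]]
    by (auto simp: bounded_iff)
  have "v \<in> sq_integrable (restrict_space lborel {a<..<b})"
  proof (rule finite_measure.sq_integrable_bounded[OF finite_measure_Ioo])
    have "set_integrable lborel {a<..<b} v"
      by (rule set_integrable_subset[OF borel_integrable_atLeastAtMost'[OF cont]]) auto
    then show "v \<in> borel_measurable (restrict_space lborel {a<..<b})"
      by (intro borel_measurable_integrable) (simp add: set_integrable_Ioo_iff)
  qed (use B in \<open>auto simp: space_restrict_space\<close>)
  then show ?thesis
    using assms(3) primitive_on_has_distr_deriv(1)[OF assms(1,2)] by (auto simp: W12_def)
qed

lemma primitive_on_unique:
  fixes w w' v :: "real \<Rightarrow> 'k::{real_normed_field,euclidean_space}"
  assumes "a < b" "primitive_on a b w v" "primitive_on a b w' v"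
  shows "AE x in lborel. x \<in> {a<..<b} \<longrightarrow> w x = w' x"
  using L1_loc_distr_deriv_unique[OF assms(1)] primitive_on_has_distr_deriv[OF assms(1,2)]
    primitive_on_has_distr_deriv[OF assms(1,3)] by blast


section \<open>Interpolation across the gaps of the support\<close>

text \<open>
  Unused indices are filled with the empty set, so that finite families are covered as well and integrals over the
  union become series.
\<close>

lemma countable_disjoint_enumeration:
  assumes "countable \<G>" "pairwise disjnt \<G>"
  shows "\<exists>A :: nat \<Rightarrow> 'a set. disjoint_family A \<and> (\<Union>i. A i) = \<Union>\<G> \<and> (\<forall>i. A i \<in> \<G> \<or> A i = {})"
proof -
  define A where "A i = \<Union>{C \<in> \<G>. to_nat_on \<G> C = i}" for i
  have eq: "C = D" if "C \<in> \<G>" "D \<in> \<G>" "to_nat_on \<G> C = to_nat_on \<G> D" for C D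
    using inj_on_to_nat_on[OF assms(1)] that by (auto dest: inj_onD)
  have 1: "disjoint_family A"
    unfolding disjoint_family_on_def
  proof (intro ballI impI)
    fix i j :: nat assume "i \<noteq> j"
    show "A i \<inter> A j = {}"
    proof (rule ccontr)
      assume "A i \<inter> A j \<noteq> {}"
      then obtain x C D where *: "C \<in> \<G>" "to_nat_on \<G> C = i" "x \<in> C" "D \<in> \<G>" "to_nat_on \<G> D = j" "x \<in> D"
        unfolding A_def by blast
      then have "C \<noteq> D" using \<open>i \<noteq> j\<close> by auto
      then have "disjnt C D" using assms(2) * by (auto dest: pairwiseD)
      then show False using * by (auto simp: disjnt_def)
    qed
  qed
  have 2: "(\<Union>i. A i) = \<Union>\<G>" by (auto simp: A_def)
  have 3: "A i \<in> \<G> \<or> A i = {}" for i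
  proof (cases "\<exists>C\<in>\<G>. to_nat_on \<G> C = i")
    case True
    then obtain C where "C \<in> \<G>" "to_nat_on \<G> C = i" by blast
    then have "{C \<in> \<G>. to_nat_on \<G> C = i} = {C}" using eq by blast
    then show ?thesis using \<open>C \<in> \<G>\<close> by (simp add: A_def)
  qed (auto simp: A_def)
  show ?thesis using 1 2 3 by blast
qed

lemma set_integral_const_Ioo:
  fixes c :: "'k::euclidean_space"
  assumes "l \<le> r" shows "(LINT x:{l<..<r}|lborel. c) = (r - l) *\<^sub>R c"
  using assms unfolding set_lebesgue_integral_def by simp

text \<open>
  The set \<open>K\<close> stands for the support of an edge measure. As it contains both end points, its complement in the
  interval consists of bounded open gaps with end points in \<open>K\<close>.
\<close>

locale gap_set =
  fixes K :: "real set" and a b :: real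
  assumes less: "a < b" and closed_K: "closed K" and K_subset: "K \<subseteq> {a..b}"
    and a_in: "a \<in> K" and b_in: "b \<in> K"
begin

definition gaps :: "(real \<times> real) set" where
  "gaps = {(l, r). l \<in> K \<and> r \<in> K \<and> l < r \<and> {l<..<r} \<inter> K = {}}"

lemma gapsD:
  assumes "(l, r) \<in> gaps"
  shows "l \<in> K" "r \<in> K" "l < r" "{l<..<r} \<inter> K = {}" "a \<le> l" "r \<le> b"
  using assms K_subset by (auto simp: gaps_def)

lemma gap_exists:
  assumes "x \<in> {a..b}" "x \<notin> K"
  obtains l r where "(l, r) \<in> gaps" "l < x" "x < r"
proof -
  define l where "l = Sup (K \<inter> {a..x})"
  define r where "r = Inf (K \<inter> {x..b})"
  have l: "l \<in> K \<inter> {a..x}" unfolding l_def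
    using a_in assms by (intro closed_contains_Sup closed_Int closed_K) auto
  have r: "r \<in> K \<inter> {x..b}" unfolding r_def
    using b_in assms by (intro closed_contains_Inf closed_Int closed_K) auto
  have "y \<le> l" if "y \<in> K" "y \<le> x" for y
    unfolding l_def using that K_subset by (intro cSup_upper) auto
  moreover have "r \<le> y" if "y \<in> K" "x \<le> y" for y
    unfolding r_def using that K_subset by (intro cInf_lower) auto
  ultimately have "{l<..<r} \<inter> K = {}" by (force simp: not_le)
  moreover have "l < x" "x < r" using l r assms(2) by (auto simp: order.strict_iff_order)
  ultimately show ?thesis using that[of l r] l r by (auto simp: gaps_def)
qed

lemma gaps_disjoint:
  assumes "(l, r) \<in> gaps" "(l', r') \<in> gaps" "x \<in> {l<..<r}" "x \<in> {l'<..<r'}"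
  shows "l = l'" "r = r'"
proof -
  have "l \<notin> {l'<..<r'}" "l' \<notin> {l<..<r}" "r \<notin> {l'<..<r'}" "r' \<notin> {l<..<r}"
    using gapsD(1,2,4)[OF assms(1)] gapsD(1,2,4)[OF assms(2)] by blast+
  then show "l = l'" "r = r'" using assms(3,4) by auto
qed

lemma Union_gaps: "(\<Union>(l, r)\<in>gaps. {l<..<r}) = {a<..<b} - K"
proof -
  have "x \<in> (\<Union>(l, r)\<in>gaps. {l<..<r})" if x: "x \<in> {a<..<b} - K" for x
  proof -
    obtain l r where "(l, r) \<in> gaps" "l < x" "x < r"
      using gap_exists[of x] x by auto
    then have "(l, r) \<in> gaps" "x \<in> {l<..<r}" by auto
    then show ?thesis by blast
  qed
  moreover have "x \<in> {a<..<b} - K" if "(l, r) \<in> gaps" "x \<in> {l<..<r}" for x l r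
    using gapsD[OF that(1)] that(2) by auto
  ultimately show ?thesis by auto
qed

lemma gaps_enumeration:
  obtains A :: "nat \<Rightarrow> real set" where "disjoint_family A" "(\<Union>i. A i) = {a<..<b} - K"
    "\<And>i. A i = {} \<or> (\<exists>(l, r)\<in>gaps. A i = {l<..<r})"
proof -
  define \<G> where "\<G> = (\<lambda>(l, r). {l<..<r}) ` gaps"
  have disj: "pairwise disjnt \<G>"
  proof (rule pairwiseI)
    fix C D assume "C \<in> \<G>" "D \<in> \<G>" "C \<noteq> D"
    then obtain l r l' r' where *: "(l, r) \<in> gaps" "C = {l<..<r}" "(l', r') \<in> gaps" "D = {l'<..<r'}"
      unfolding \<G>_def by blast
    show "disjnt C D"
    proof (rule ccontr)
      assume "\<not> disjnt C D"
      then obtain x where "x \<in> C" "x \<in> D" by (auto simp: disjnt_def)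
      then have "l = l'" "r = r'" using gaps_disjoint[OF *(1,3)] * by simp_all
      then show False using * \<open>C \<noteq> D\<close> by simp
    qed
  qed
  have "countable \<G>"
    by (rule countable_disjoint_open_subsets[OF _ disj]) (auto simp: \<G>_def)
  then obtain A :: "nat \<Rightarrow> real set" where
    "disjoint_family A" "(\<Union>i. A i) = \<Union>\<G>" "\<And>i. A i \<in> \<G> \<or> A i = {}"
    using countable_disjoint_enumeration[OF _ disj] by blast
  moreover have "\<Union>\<G> = {a<..<b} - K" using Union_gaps by (simp add: \<G>_def)
  moreover have "(\<exists>(l, r)\<in>gaps. C = {l<..<r}) \<longleftrightarrow> C \<in> \<G>" for C by (auto simp: \<G>_def)
  ultimately show ?thesis using that[of A] by metis
qed

lemma borel_K [measurable]: "K \<in> sets borel"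
  using closed_K by simp

text \<open>
  The integral over the complement of \<open>K\<close> is the sum of the integrals over the countably many gaps, where the constant
  value of \<open>q\<close> may be pulled out.
\<close>

lemma gap_orthogonality:
  fixes q z :: "real \<Rightarrow> 'k::{real_normed_field,euclidean_space}"
  assumes qz: "set_integrable lborel {a<..<b} (\<lambda>x. q x * z x)" and z: "set_integrable lborel {a<..<b} z"
    and K0: "\<And>x. x \<in> K \<Longrightarrow> z x = 0" and gap0: "\<And>l r. (l, r) \<in> gaps \<Longrightarrow> (LINT x:{l<..<r}|lborel. z x) = 0"
    and const: "\<And>l r. (l, r) \<in> gaps \<Longrightarrow> \<exists>c. AE x in lborel. x \<in> {l<..<r} \<longrightarrow> q x = c"
  shows "(LINT x:{a<..<b}|lborel. q x * z x) = 0"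
proof -
  obtain A :: "nat \<Rightarrow> real set" where A: "disjoint_family A" "(\<Union>i. A i) = {a<..<b} - K"
    "\<And>i. A i = {} \<or> (\<exists>(l, r)\<in>gaps. A i = {l<..<r})"
    using gaps_enumeration by metis
  have [simp]: "A i \<in> sets borel" for i using A(3)[of i] by auto
  have zero: "(LINT x:A i|lborel. q x * z x) = 0" for i
  proof (cases "A i = {}")
    case True
    then show ?thesis by (simp add: set_lebesgue_integral_def)
  next
    case False
    then obtain l r where lr: "(l, r) \<in> gaps" "A i = {l<..<r}" using A(3)[of i] by auto
    obtain c where c: "AE x in lborel. x \<in> {l<..<r} \<longrightarrow> q x = c" using const[OF lr(1)] by blast
    have sub: "{l<..<r} \<subseteq> {a<..<b}" using gapsD[OF lr(1)] by auto
    have zi: "set_integrable lborel {l<..<r} z" using set_integrable_subset[OF z _ sub] by simp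
    have "(LINT x:{l<..<r}|lborel. q x * z x) = (LINT x:{l<..<r}|lborel. c * z x)"
    proof (rule set_integral_cong_AE)
      show "set_integrable lborel {l<..<r} (\<lambda>x. q x * z x)" using set_integrable_subset[OF qz _ sub] by simp
      show "set_integrable lborel {l<..<r} (\<lambda>x. c * z x)" using zi by simp
      show "AE x in lborel. x \<in> {l<..<r} \<longrightarrow> q x * z x = c * z x"
        using c by eventually_elim auto
    qed
    then show ?thesis using gap0[OF lr(1)] lr(2) by simp
  qed
  have "(LINT x:{a<..<b}|lborel. q x * z x) = (LINT x:(\<Union>i. A i)|lborel. q x * z x)"
    unfolding A(2) set_lebesgue_integral_def
    by (intro Bochner_Integration.integral_cong refl) (auto simp: indicator_def K0)
  also have "\<dots> = (\<Sum>i. (LINT x:A i|lborel. q x * z x))"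
  proof (rule lebesgue_integral_countable_add)
    show "A i \<inter> A j = {}" if "i \<noteq> j" for i j
      using A(1) that by (auto simp: disjoint_family_on_def)
    show "set_integrable lborel (\<Union>i. A i) (\<lambda>x. q x * z x)"
      unfolding A(2) by (rule set_integrable_subset[OF qz]) auto
  qed simp
  finally show ?thesis by (simp add: zero)
qed

text \<open>
  If \<open>w\<close> is the derivative of \<open>v\<close>, then the mean value of \<open>w\<close> over a gap is the slope of the affine function
  that agrees with \<open>v\<close> at both ends of the gap.
\<close>

definition gap_average :: "(real \<Rightarrow> 'k) \<Rightarrow> real \<Rightarrow> 'k::{real_normed_field,euclidean_space}" where
  "gap_average w x = (if x \<in> {a..b} - K then
     (case (THE p. p \<in> gaps \<and> fst p < x \<and> x < snd p) of (l, r) \<Rightarrow>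
        (1 / (r - l)) *\<^sub>R (LINT t:{l<..<r}|lborel. w t))
     else w x)"

lemma gap_average_eq:
  assumes "(l, r) \<in> gaps" "x \<in> {l<..<r}"
  shows "gap_average w x = (1 / (r - l)) *\<^sub>R (LINT t:{l<..<r}|lborel. w t)"
proof -
  have "(THE p. p \<in> gaps \<and> fst p < x \<and> x < snd p) = (l, r)"
    using assms gaps_disjoint by (intro the_equality) force+
  moreover have "x \<in> {a..b} - K" using gapsD[OF assms(1)] assms(2) by auto
  ultimately show ?thesis by (simp add: gap_average_def)
qed

lemma gap_average_K: "x \<in> K \<Longrightarrow> gap_average w x = w x"
  by (simp add: gap_average_def)

lemma gap_average_integral:
  assumes "(l, r) \<in> gaps"
  shows "(LINT x:{l<..<r}|lborel. gap_average w x) = (LINT t:{l<..<r}|lborel. w t)"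
proof -
  have "(LINT x:{l<..<r}|lborel. gap_average w x) = (LINT x:{l<..<r}|lborel. (1 / (r - l)) *\<^sub>R (LINT t:{l<..<r}|lborel. w t))"
    by (intro set_lebesgue_integral_cong) (auto simp: gap_average_eq[OF assms])
  then show ?thesis using gapsD(3)[OF assms] by (simp only: set_integral_const_Ioo less_imp_le) simp
qed

lemma gap_average_measurable:
  assumes "w \<in> borel_measurable (restrict_space lborel {a<..<b})"
  shows "gap_average w \<in> borel_measurable (restrict_space lborel {a<..<b})"
proof -
  obtain A :: "nat \<Rightarrow> real set" where A: "disjoint_family A" "(\<Union>i. A i) = {a<..<b} - K"
    "\<And>i. A i = {} \<or> (\<exists>(l, r)\<in>gaps. A i = {l<..<r})"
    using gaps_enumeration by metis
  have Ab: "A i \<in> sets borel" for i using A(3)[of i] by auto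
  show ?thesis
  proof (rule measurable_piecewise_restrict)
    show "countable (insert K (range A))" by simp
    show "space (restrict_space lborel {a<..<b}) \<subseteq> \<Union>(insert K (range A))"
      using A(2) by (auto simp: space_restrict_space)
    fix \<Omega> assume \<Omega>: "\<Omega> \<in> insert K (range A)"
    then have "\<Omega> \<in> sets borel" using Ab by auto
    then show "\<Omega> \<inter> space (restrict_space lborel {a<..<b}) \<in> sets (restrict_space lborel {a<..<b})"
      by (auto simp: sets_restrict_space space_restrict_space)
    consider "\<Omega> = K" | "\<Omega> = {}" | l r where "(l, r) \<in> gaps" "\<Omega> = {l<..<r}"
    proof -
      have "\<Omega> = K \<or> \<Omega> = {} \<or> (\<exists>(l, r)\<in>gaps. \<Omega> = {l<..<r})" using \<Omega> A(3) by auto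
      then show ?thesis using that by blast
    qed
    then show "gap_average w \<in> borel_measurable (restrict_space (restrict_space lborel {a<..<b}) \<Omega>)"
    proof cases
      case 1
      have "w \<in> borel_measurable (restrict_space (restrict_space lborel {a<..<b}) \<Omega>)"
        by (rule measurable_restrict_space1[OF assms])
      then show ?thesis
        by (rule measurable_cong[THEN iffD1, rotated]) (auto simp: 1 gap_average_K space_restrict_space)
    next
      case 2
      then show ?thesis by (simp add: measurable_def space_restrict_space)
    next
      case 3
      have "(\<lambda>_. (1 / (r - l)) *\<^sub>R (LINT t:{l<..<r}|lborel. w t)) \<in> borel_measurable (restrict_space (restrict_space lborel {a<..<b}) \<Omega>)"
        by simp
      then show ?thesis
        by (rule measurable_cong[THEN iffD1, rotated]) (auto simp: 3(2) gap_average_eq[OF 3(1)] space_restrict_space)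
    qed
  qed
qed

text \<open>
  With \<open>m\<close> the mean value, \<open>norm (w x) ^ 2 \<ge> 2 * (m \<bullet> w x) - norm m ^ 2\<close> pointwise; integrating over the
  gap shows that averaging does not increase the integral of the squared norm.
\<close>

lemma gap_average_nn_integral_le:
  assumes "(l, r) \<in> gaps" "set_integrable lborel {l<..<r} w" "set_integrable lborel {l<..<r} (\<lambda>x. (norm (w x))\<^sup>2)"
  shows "(\<integral>\<^sup>+x\<in>{l<..<r}. ennreal ((norm (gap_average w x))\<^sup>2) \<partial>lborel) \<le> (\<integral>\<^sup>+x\<in>{l<..<r}. ennreal ((norm (w x))\<^sup>2) \<partial>lborel)"
proof -
  define m where "m = (1 / (r - l)) *\<^sub>R (LINT t:{l<..<r}|lborel. w t)"
  have lr: "l < r" using gapsD[OF assms(1)] by simp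
  have mi: "(LINT t:{l<..<r}|lborel. w t) = (r - l) *\<^sub>R m" using lr by (simp add: m_def)
  have miw: "set_integrable lborel {l<..<r} (\<lambda>x. m \<bullet> w x)"
    and "(LINT x:{l<..<r}|lborel. m \<bullet> w x) = m \<bullet> (LINT x:{l<..<r}|lborel. w x)"
  proof -
    have *: "indicator {l<..<r} x *\<^sub>R (m \<bullet> w x) = m \<bullet> (indicator {l<..<r} x *\<^sub>R w x)" for x by simp
    show "set_integrable lborel {l<..<r} (\<lambda>x. m \<bullet> w x)"
      using assms(2) unfolding set_integrable_def * by (rule integrable_inner_right)
    show "(LINT x:{l<..<r}|lborel. m \<bullet> w x) = m \<bullet> (LINT x:{l<..<r}|lborel. w x)"
      using assms(2) unfolding set_integrable_def set_lebesgue_integral_def * by (intro integral_inner_right) auto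
  qed
  then have miw2: "(LINT x:{l<..<r}|lborel. m \<bullet> w x) = (r - l) * (norm m)\<^sup>2"
    by (simp add: mi power2_norm_eq_inner)
  have "(LINT x:{l<..<r}|lborel. 2 * (m \<bullet> w x) - (norm m)\<^sup>2) \<le> (LINT x:{l<..<r}|lborel. (norm (w x))\<^sup>2)"
  proof (rule set_integral_mono)
    show "set_integrable lborel {l<..<r} (\<lambda>x. 2 * (m \<bullet> w x) - (norm m)\<^sup>2)"
      by (intro set_integral_diff(1) set_integrable_const_Ioo set_integrable_mult_right miw)
    fix x
    have "0 \<le> (norm (w x - m))\<^sup>2" by simp
    then show "2 * (m \<bullet> w x) - (norm m)\<^sup>2 \<le> (norm (w x))\<^sup>2"
      unfolding power2_norm_eq_inner by (simp add: inner_diff_left inner_diff_right inner_commute)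
  qed (rule assms(3))
  moreover have "(LINT x:{l<..<r}|lborel. 2 * (m \<bullet> w x) - (norm m)\<^sup>2) = (r - l) * (norm m)\<^sup>2"
    using miw2 lr
    by (subst set_integral_diff(2)) (auto intro!: set_integrable_const_Ioo miw simp: set_integral_const_Ioo)
  ultimately have le: "(r - l) * (norm m)\<^sup>2 \<le> (LINT x:{l<..<r}|lborel. (norm (w x))\<^sup>2)" by simp
  have "(\<integral>\<^sup>+x\<in>{l<..<r}. ennreal ((norm (gap_average w x))\<^sup>2) \<partial>lborel) = (\<integral>\<^sup>+x\<in>{l<..<r}. ennreal ((norm m)\<^sup>2) \<partial>lborel)"
    by (intro nn_integral_cong) (auto simp: indicator_def gap_average_eq[OF assms(1)] m_def)
  also have "\<dots> = ennreal ((r - l) * (norm m)\<^sup>2)"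
    using lr by (subst nn_integral_cmult_indicator) (auto simp: ennreal_mult mult.commute)
  also have "\<dots> \<le> ennreal (LINT x:{l<..<r}|lborel. (norm (w x))\<^sup>2)"
    by (rule ennreal_leI[OF le])
  also have "\<dots> = (\<integral>\<^sup>+x\<in>{l<..<r}. ennreal ((norm (w x))\<^sup>2) \<partial>lborel)"
    unfolding set_lebesgue_integral_def
    by (subst nn_integral_eq_integral[symmetric])
       (use assms(3) in \<open>auto simp: set_integrable_def indicator_def intro!: nn_integral_cong\<close>)
  finally show ?thesis .
qed

text \<open>
  The squared norm is unchanged on \<open>K\<close>, and its integral over every gap does not increase.
\<close>

lemma gap_average_sq_integrable:
  fixes w :: "real \<Rightarrow> 'k::{real_normed_field,euclidean_space}"
  assumes w: "w \<in> sq_integrable (restrict_space lborel {a<..<b})"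
  shows "gap_average w \<in> sq_integrable (restrict_space lborel {a<..<b})"
proof -
  let ?L = "restrict_space lborel {a<..<b}"
  have m: "w \<in> borel_measurable ?L" "gap_average w \<in> borel_measurable ?L"
    using sq_integrableD(1)[OF w] gap_average_measurable by auto
  have wi: "set_integrable lborel {a<..<b} w" by (rule sq_integrable_Ioo_imp_integrable[OF w])
  have w2: "set_integrable lborel {a<..<b} (\<lambda>x. (norm (w x))\<^sup>2)"
    using sq_integrableD(2)[OF w] by (simp add: set_integrable_Ioo_iff)
  obtain A :: "nat \<Rightarrow> real set" where A: "disjoint_family A" "(\<Union>i. A i) = {a<..<b} - K"
    "\<And>i. A i = {} \<or> (\<exists>(l, r)\<in>gaps. A i = {l<..<r})"
    using gaps_enumeration by metis
  have Ab: "A i \<in> sets borel" for i using A(3)[of i] by auto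
  have L: "(\<integral>\<^sup>+x. ennreal ((norm (f x))\<^sup>2) \<partial>?L) = (\<integral>\<^sup>+x\<in>{a<..<b}. ennreal ((norm (f x))\<^sup>2) \<partial>lborel)" for f :: "real \<Rightarrow> 'k"
    by (rule nn_integral_restrict_space) simp
  have split: "(\<integral>\<^sup>+x\<in>{a<..<b}. ennreal ((norm (f x))\<^sup>2) \<partial>lborel) = (\<integral>\<^sup>+x\<in>{a<..<b} \<inter> K. ennreal ((norm (f x))\<^sup>2) \<partial>lborel)
      + (\<Sum>i. \<integral>\<^sup>+x\<in>A i. ennreal ((norm (f x))\<^sup>2) \<partial>lborel)" if f: "f \<in> borel_measurable ?L" for f :: "real \<Rightarrow> 'k"
  proof -
    define F where "F x = ennreal ((norm (f x))\<^sup>2) * indicator {a<..<b} x" for x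
    have F [measurable]: "F \<in> borel_measurable lborel"
      unfolding F_def using f by (subst borel_measurable_restrict_space_iff_ennreal[symmetric]) auto
    have "(\<integral>\<^sup>+x\<in>{a<..<b} \<inter> K \<union> ({a<..<b} - K). F x \<partial>lborel) = (\<integral>\<^sup>+x\<in>{a<..<b} \<inter> K. F x \<partial>lborel) + (\<integral>\<^sup>+x\<in>{a<..<b} - K. F x \<partial>lborel)"
      by (rule nn_integral_disjoint_pair) auto
    also have "(\<integral>\<^sup>+x\<in>{a<..<b} - K. F x \<partial>lborel) = (\<Sum>i. \<integral>\<^sup>+x\<in>A i. F x \<partial>lborel)"
      unfolding A(2)[symmetric] by (rule nn_integral_disjoint_family) (use A(1) Ab in auto)
    also have "(\<integral>\<^sup>+x\<in>{a<..<b} \<inter> K \<union> ({a<..<b} - K). F x \<partial>lborel) = (\<integral>\<^sup>+x\<in>{a<..<b}. ennreal ((norm (f x))\<^sup>2) \<partial>lborel)"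
      by (intro nn_integral_cong) (auto simp: F_def indicator_def)
    also have "(\<integral>\<^sup>+x\<in>{a<..<b} \<inter> K. F x \<partial>lborel) = (\<integral>\<^sup>+x\<in>{a<..<b} \<inter> K. ennreal ((norm (f x))\<^sup>2) \<partial>lborel)"
      by (intro nn_integral_cong) (auto simp: F_def indicator_def)
    also have "(\<lambda>i. \<integral>\<^sup>+x\<in>A i. F x \<partial>lborel) = (\<lambda>i. \<integral>\<^sup>+x\<in>A i. ennreal ((norm (f x))\<^sup>2) \<partial>lborel)"
      using A(2) by (intro ext nn_integral_cong) (auto simp: F_def indicator_def)
    finally show ?thesis .
  qed
  have "(\<integral>\<^sup>+x. ennreal ((norm (gap_average w x))\<^sup>2) \<partial>?L) \<le> (\<integral>\<^sup>+x. ennreal ((norm (w x))\<^sup>2) \<partial>?L)"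
    unfolding L split[OF m(1)] split[OF m(2)]
  proof (intro add_mono suminf_le)
    show "(\<integral>\<^sup>+x\<in>{a<..<b} \<inter> K. ennreal ((norm (gap_average w x))\<^sup>2) \<partial>lborel) \<le> (\<integral>\<^sup>+x\<in>{a<..<b} \<inter> K. ennreal ((norm (w x))\<^sup>2) \<partial>lborel)"
      by (intro nn_integral_mono) (auto simp: indicator_def gap_average_K)
    fix i
    show "(\<integral>\<^sup>+x\<in>A i. ennreal ((norm (gap_average w x))\<^sup>2) \<partial>lborel) \<le> (\<integral>\<^sup>+x\<in>A i. ennreal ((norm (w x))\<^sup>2) \<partial>lborel)"
    proof (cases "A i = {}")
      case False
      then obtain l r where lr: "(l, r) \<in> gaps" "A i = {l<..<r}" using A(3)[of i] by auto
      have sub: "{l<..<r} \<subseteq> {a<..<b}" using gapsD[OF lr(1)] by auto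
      show ?thesis unfolding lr(2)
        by (intro gap_average_nn_integral_le lr(1) set_integrable_subset[OF wi _ sub] set_integrable_subset[OF w2 _ sub]) auto
    qed simp
  qed auto
  also have "\<dots> < \<infinity>"
    using sq_integrableD(2)[OF w] by (auto simp: integrable_iff_bounded)
  finally have "integrable ?L (\<lambda>x. (norm (gap_average w x))\<^sup>2)"
    using m(2) by (auto simp: integrable_iff_bounded)
  then show ?thesis using m(2) by (simp add: sq_integrable_def)
qed

end


lemma primitive_on_subinterval:
  assumes "primitive_on a b w v" "a \<le> l" "l \<le> r" "r \<le> b"
  shows "primitive_on l r w v"
  unfolding primitive_on_def
proof (intro conjI ballI)
  show "set_integrable lborel {l<..<r} w"
    by (rule set_integrable_subset[OF primitive_onD(1)[OF assms(1)]]) (use assms in auto)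
  fix x assume "x \<in> {l..r}"
  then have "v x - v l = (LINT t:{l<..<x}|lborel. w t)"
    using assms by (intro primitive_on_diff[OF assms(1)]) auto
  then show "v x = v l + (LINT t:{l<..<x}|lborel. w t)" by (metis add.commute diff_add_cancel)
qed

lemma primitive_on_affine:
  fixes p q :: "'k::{real_normed_field,euclidean_space}"
  assumes "\<And>x. x \<in> {l..r} \<Longrightarrow> v x = p + x *\<^sub>R q" "l \<le> r"
  shows "primitive_on l r (\<lambda>_. q) v"
  unfolding primitive_on_def
proof (intro conjI ballI set_integrable_const_Ioo)
  fix x assume x: "x \<in> {l..r}"
  have "v l = p + l *\<^sub>R q" using assms by simp
  then show "v x = v l + (LINT t:{l<..<x}|lborel. q)"
    using x assms by (simp add: set_integral_const_Ioo algebra_simps)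
qed

lemma set_integral_conj_sc:
  fixes f :: "real \<Rightarrow> 'k::{real_normed_field,euclidean_space}"
  assumes "set_integrable lborel A f"
  shows "set_integrable lborel A (\<lambda>x. conj_sc (f x))"
    and "(LINT x:A|lborel. conj_sc (f x)) = conj_sc (LINT x:A|lborel. f x)"
proof -
  have *: "indicator A x *\<^sub>R conj_sc (f x) = conj_sc (indicator A x *\<^sub>R f x)" for x by simp
  show "set_integrable lborel A (\<lambda>x. conj_sc (f x))"
    using assms unfolding set_integrable_def * by (rule integrable_bounded_linear[OF bounded_linear_conj_sc])
  show "(LINT x:A|lborel. conj_sc (f x)) = conj_sc (LINT x:A|lborel. f x)"
    using assms unfolding set_integrable_def set_lebesgue_integral_def *
    by (rule integral_bounded_linear[OF bounded_linear_conj_sc])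
qed

lemma primitive_on_conj_sc:
  fixes w v :: "real \<Rightarrow> 'k::{real_normed_field,euclidean_space}"
  assumes "primitive_on a b w v"
  shows "primitive_on a b (\<lambda>x. conj_sc (w x)) (\<lambda>x. conj_sc (v x))"
  unfolding primitive_on_def
proof (intro conjI ballI set_integral_conj_sc(1) primitive_onD(1)[OF assms])
  fix x assume x: "x \<in> {a..b}"
  have "set_integrable lborel {a<..<x} w"
    by (rule set_integrable_subset[OF primitive_onD(1)[OF assms]]) (use x in auto)
  from set_integral_conj_sc(2)[OF this] primitive_onD(2)[OF assms x]
  show "conj_sc (v x) = conj_sc (v a) + (LINT t:{a<..<x}|lborel. conj_sc (w t))"
    by (metis conj_sc_add)
qed

locale edge_measure = interval_measure +
  assumes ends_in_spt: "a \<in> spt M" "b \<in> spt M" and ends_null: "emeasure M {a, b} = 0"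
begin

lemma spt_subset: "spt M \<subseteq> {a..b}"
  by (auto simp: spt_def space_M)

definition null_opens :: "real set set" where
  "null_opens = {U. open U \<and> emeasure M (U \<inter> {a..b}) = 0}"

lemma Union_null_opens: "{a..b} - spt M = {a..b} \<inter> \<Union>null_opens"
  unfolding spt_def space_M null_opens_def by (auto simp: not_gr_zero)

lemma closed_spt: "closed (spt M)"
proof -
  have "- spt M = - {a..b} \<union> \<Union>null_opens"
    using Union_null_opens spt_subset unfolding spt_def space_M null_opens_def by (auto simp: not_gr_zero)
  moreover have "open (- {a..b} \<union> \<Union>null_opens)"
    by (intro open_Un open_Union) (auto simp: null_opens_def)
  ultimately show ?thesis by (simp add: closed_def)
qed

sublocale gap_set "spt M" a b
  by unfold_locales (use less closed_spt spt_subset ends_in_spt in auto)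

text \<open>
  By the Lindelof property countably many open null sets cover the complement of the support in the interval.
\<close>

lemma AE_in_spt: "AE x in M. x \<in> spt M"
proof -
  obtain \<U> where \<U>: "\<U> \<subseteq> null_opens" "countable \<U>" "\<Union>\<U> = \<Union>null_opens"
    using Lindelof[of null_opens] by (auto simp: null_opens_def)
  have "(\<Union>U\<in>\<U>. U \<inter> {a..b}) \<in> null_sets M"
    using \<U>(1,2) by (intro null_sets_UN') (auto simp: null_opens_def null_sets_def intro!: Int_sets_M)
  then have "AE x in M. x \<notin> (\<Union>U\<in>\<U>. U \<inter> {a..b})" by (rule AE_not_in)
  with AE_space show ?thesis
  proof eventually_elim
    case (elim x)
    then show ?case using Union_null_opens \<U>(3) unfolding space_M by blast
  qed
qed

lemma AE_in_Ioo: "AE x in M. x \<in> {a<..<b}"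
proof -
  have "{a, b} \<in> null_sets M"
    using ends_null less by (auto simp: null_sets_def intro!: subset_sets_M)
  then have "AE x in M. x \<notin> {a, b}" by (rule AE_not_in)
  with AE_space show ?thesis by eventually_elim (auto simp: space_M)
qed

text \<open>
  Otherwise \<open>v\<close> would be nonzero on a neighbourhood of \<open>x\<close>, which has positive measure.
\<close>

lemma zero_on_spt:
  fixes v :: "real \<Rightarrow> 'k::euclidean_space"
  assumes "continuous_on {a..b} v" "AE x in M. v x = 0" "x \<in> spt M"
  shows "v x = 0"
proof (rule ccontr)
  assume "v x \<noteq> 0"
  have "openin (top_of_set {a..b}) ({a..b} \<inter> v -` (- {0}))"
    by (rule continuous_openin_preimage_gen[OF assms(1)]) (simp add: open_Compl)
  then obtain U where U: "open U" "{a..b} \<inter> v -` (- {0}) = {a..b} \<inter> U"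
    unfolding openin_open by blast
  have "x \<in> U" using U(2) \<open>v x \<noteq> 0\<close> assms(3) spt_subset by blast
  then have "emeasure M (U \<inter> space M) > 0" using assms(3) U(1) by (auto simp: spt_def)
  moreover have "U \<inter> space M \<in> null_sets M"
  proof -
    have "{x \<in> space M. \<not> v x = 0} = {a..b} \<inter> v -` (- {0})" by (auto simp: space_M)
    then have "{x \<in> space M. \<not> v x = 0} = U \<inter> space M" unfolding U(2) space_M by (simp only: Int_commute)
    moreover have "U \<inter> space M \<in> sets M" using Int_sets_M[of U] U(1) by (simp add: space_M)
    ultimately show ?thesis using assms(2) by (simp add: AE_iff_null)
  qed
  ultimately show False by auto
qed

lemma continuous_measurable_M:
  fixes v :: "real \<Rightarrow> 'k::euclidean_space"
  assumes "continuous_on {a..b} v"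
  shows "v \<in> borel_measurable M"
  by (subst measurable_cong_sets[OF sets_M refl]) (rule borel_measurable_continuous_on_restrict[OF assms])

lemma continuous_sq_integrable:
  fixes v :: "real \<Rightarrow> 'k::{real_normed_field,euclidean_space}"
  assumes cont: "continuous_on {a..b} v"
  shows "v \<in> sq_integrable M"
proof -
  obtain B where B: "\<forall>x\<in>{a..b}. norm (v x) \<le> B"
    using compact_imp_bounded[OF compact_continuous_image[OF cont compact_Icc]] by (auto simp: bounded_iff)
  show ?thesis
    by (rule sq_integrable_bounded[OF continuous_measurable_M[OF cont], of B]) (use B in \<open>auto simp: space_M\<close>)
qed

lemma cont_fun_mu_affine:
  fixes u :: "real \<Rightarrow> 'k::{real_normed_field,euclidean_space}"
  assumes "u \<in> cont_fun_mu a b M" "(l, r) \<in> gaps"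
  obtains p q where "\<And>x. x \<in> {l..r} \<Longrightarrow> u x = p + x *\<^sub>R q"
proof -
  note g = gapsD[OF assms(2)]
  have "{l<..<r} \<subseteq> {a..b} - spt M" "{l<..<r} \<noteq> {}" using g by auto
  then have "\<exists>C. C \<in> components ({a..b} - spt M) \<and> {l<..<r} \<subseteq> C"
    by (intro exists_component_superset connected_Ioo) (blast, blast)
  then obtain C where "C \<in> components ({a..b} - spt M)" "{l<..<r} \<subseteq> C" by blast
  then obtain p q where pq: "\<forall>x\<in>{l<..<r}. u x = p + x *\<^sub>R q"
    using assms(1) unfolding cont_fun_mu_def by blast
  have "continuous_on {l..r} u"
    using assms(1) g by (auto simp: cont_fun_mu_def cont_fun_def intro: continuous_on_subset)
  then have "u x = p + x *\<^sub>R q" if "x \<in> {l..r}" for x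
    by (rule continuous_on_AE_eq[OF g(3) _ _ _ that]) (use pq in \<open>auto intro!: continuous_intros AE_I2\<close>)
  then show ?thesis using that by blast
qed

text \<open>
  A component of the complement of the support is contained in a single gap: by connectedness it would otherwise
  contain an end point of the gap, and these belong to the support.
\<close>

lemma cont_fun_muI:
  fixes u :: "real \<Rightarrow> 'k::{real_normed_field,euclidean_space}"
  assumes "u \<in> cont_fun a b" "\<And>l r. (l, r) \<in> gaps \<Longrightarrow> \<exists>p q. \<forall>x\<in>{l<..<r}. u x = p + x *\<^sub>R q"
  shows "u \<in> cont_fun_mu a b M"
  unfolding cont_fun_mu_def
proof (intro CollectI conjI ballI assms(1))
  fix C assume C: "C \<in> components ({a..b} - spt M)"
  then have CC: "connected C" "C \<subseteq> {a..b} - spt M" "C \<noteq> {}"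
    by (auto dest: in_components_connected in_components_subset in_components_nonempty)
  then obtain x where x: "x \<in> C" by blast
  obtain l r where lr: "(l, r) \<in> gaps" "l < x" "x < r" using gap_exists[of x] x CC(2) by blast
  have "C \<subseteq> {l<..<r}"
  proof
    fix y assume y: "y \<in> C"
    have "{x..y} \<subseteq> C" "{y..x} \<subseteq> C" using connected_contains_Icc[OF CC(1)] x y by auto
    moreover have "l \<notin> C" "r \<notin> C" using gapsD[OF lr(1)] CC(2) by auto
    ultimately show "y \<in> {l<..<r}" using lr(2,3) by (meson atLeastAtMost_iff greaterThanLessThan_iff less_imp_le not_le subsetD)
  qed
  then show "\<exists>p q. \<forall>x\<in>C. u x = p + x *\<^sub>R q" using assms(2)[OF lr(1)] by blast
qed

lemma W12_muD:
  fixes u :: "real \<Rightarrow> 'k::{real_normed_field,euclidean_space}"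
  assumes "u \<in> W12_mu a b M"
  shows "u \<in> W12 a b" "u \<in> cont_fun_mu a b M" "u \<in> cont_fun a b" "continuous_on {a..b} u"
  using assms by (auto simp: W12_mu_def cont_fun_mu_def cont_fun_def)

text \<open>
  The functions agree on the support, and on a gap an affine function is determined by its values at the two ends,
  which belong to the support.
\<close>

lemma W12_mu_unique:
  fixes u v :: "real \<Rightarrow> 'k::{real_normed_field,euclidean_space}"
  assumes u: "u \<in> W12_mu a b M" and v: "v \<in> W12_mu a b M" and AE: "AE x in M. u x = v x"
  shows "u = v"
proof
  fix x
  have cont: "continuous_on {a..b} (\<lambda>x. u x - v x)"
    by (intro continuous_on_diff W12_muD(4)[OF u] W12_muD(4)[OF v])
  have "AE x in M. u x - v x = 0" using AE by eventually_elim simp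
  from zero_on_spt[OF cont this] have K: "u y = v y" if "y \<in> spt M" for y using that by simp
  show "u x = v x"
  proof (cases "x \<in> {a..b}")
    case False
    then show ?thesis
      using W12_muD(3)[OF u] W12_muD(3)[OF v] by (simp add: cont_fun_def extensional_def)
  next
    case True
    show ?thesis
    proof (cases "x \<in> spt M")
      case False
      obtain l r where lr: "(l, r) \<in> gaps" "l < x" "x < r" using gap_exists[OF True False] by metis
      note g = gapsD[OF lr(1)]
      obtain p q where pq: "\<And>x. x \<in> {l..r} \<Longrightarrow> u x = p + x *\<^sub>R q"
        using cont_fun_mu_affine[OF W12_muD(2)[OF u] lr(1)] by metis
      obtain p' q' where pq': "\<And>x. x \<in> {l..r} \<Longrightarrow> v x = p' + x *\<^sub>R q'"
        using cont_fun_mu_affine[OF W12_muD(2)[OF v] lr(1)] by metis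
      have l: "p + l *\<^sub>R q = p' + l *\<^sub>R q'" and r: "p + r *\<^sub>R q = p' + r *\<^sub>R q'"
        using K[OF g(1)] K[OF g(2)] pq[of l] pq'[of l] pq[of r] pq'[of r] g(3) by auto
      have "(r - l) *\<^sub>R (q - q') = (p + r *\<^sub>R q - (p' + r *\<^sub>R q')) - (p + l *\<^sub>R q - (p' + l *\<^sub>R q'))"
        by (simp add: algebra_simps)
      then have "q = q'" using l r g(3) by simp
      then show ?thesis using l pq[of x] pq'[of x] lr by simp
    qed (rule K)
  qed
qed

lemma W12_mu_deriv_constant:
  fixes u :: "real \<Rightarrow> 'k::{real_normed_field,euclidean_space}"
  assumes u: "u \<in> W12_mu a b M" and lr: "(l, r) \<in> gaps"
  shows "\<exists>c. AE x in lborel. x \<in> {l<..<r} \<longrightarrow> weak_deriv a b u x = c"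
proof -
  note g = gapsD[OF lr]
  obtain p q where pq: "\<And>x. x \<in> {l..r} \<Longrightarrow> u x = p + x *\<^sub>R q"
    using cont_fun_mu_affine[OF W12_muD(2)[OF u] lr] by metis
  have "primitive_on l r (weak_deriv a b u) u"
    using g by (intro primitive_on_subinterval[OF W12_primitive_on(1)[OF less W12_muD(1,4)[OF u]]]) auto
  moreover have "primitive_on l r (\<lambda>_. q) u"
    using g by (intro primitive_on_affine[OF pq]) auto
  ultimately show ?thesis using primitive_on_unique[OF g(3)] by blast
qed

text \<open>
  For a Sobolev function \<open>v\<close> this is the function that agrees with \<open>v\<close> on the support and is affine on the gaps.
  Defining it through its derivative yields its Sobolev regularity at once.
\<close>

definition interpolate :: "(real \<Rightarrow> 'k) \<Rightarrow> real \<Rightarrow> 'k::{real_normed_field,euclidean_space}" where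
  "interpolate v = (\<lambda>x\<in>{a..b}. v a + (LINT t:{a<..<x}|lborel. gap_average (weak_deriv a b v) t))"

text \<open>
  At a point \<open>x\<close> of the support the indicator of \<open>{a<..<x}\<close> is constant on the gaps, so that averaging \<open>v'\<close> over
  the gaps does not change the integral over \<open>{a<..<x}\<close>, that is the value at \<open>x\<close>.
\<close>

lemma interpolate:
  fixes v :: "real \<Rightarrow> 'k::{real_normed_field,euclidean_space}"
  assumes v: "v \<in> W12 a b" "continuous_on {a..b} v"
  shows "primitive_on a b (gap_average (weak_deriv a b v)) (interpolate v)"
    and "x \<in> spt M \<Longrightarrow> interpolate v x = v x"
    and "interpolate v \<in> W12_mu a b M"
proof -
  define w where "w = weak_deriv a b v"
  define h where "h = gap_average w"
  have wv: "primitive_on a b w v" and wsq: "w \<in> sq_integrable (restrict_space lborel {a<..<b})"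
    unfolding w_def by (rule W12_primitive_on[OF less v])+
  have hsq: "h \<in> sq_integrable (restrict_space lborel {a<..<b})"
    unfolding h_def by (rule gap_average_sq_integrable[OF wsq])
  have wi: "set_integrable lborel {a<..<b} w" and hi: "set_integrable lborel {a<..<b} h"
    by (intro sq_integrable_Ioo_imp_integrable wsq hsq)+
  have int_eq: "interpolate v x = v a + (LINT t:{a<..<x}|lborel. h t)" if "x \<in> {a..b}" for x
    using that by (simp add: interpolate_def h_def w_def)
  have "interpolate v a = v a" using int_eq[of a] less by (simp add: set_lebesgue_integral_def)
  then have prim: "primitive_on a b h (interpolate v)"
    using hi int_eq by (simp add: primitive_on_def)
  then show "primitive_on a b (gap_average (weak_deriv a b v)) (interpolate v)"
    by (simp add: h_def w_def)
  show K: "interpolate v x = v x" if x: "x \<in> spt M" for x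
  proof -
    have xab: "x \<in> {a..b}" using x spt_subset by blast
    have sub: "{a<..<x} \<subseteq> {a<..<b}" using xab by auto
    have wx: "set_integrable lborel {a<..<x} w" and hx: "set_integrable lborel {a<..<x} h"
      using set_integrable_subset[OF wi _ sub] set_integrable_subset[OF hi _ sub] by auto
    have "(LINT t:{a<..<b}|lborel. of_real (indicator {a<..<x} t) * (w t - h t)) = 0"
    proof (rule gap_orthogonality)
      have "indicator {a<..<b} t *\<^sub>R (of_real (indicator {a<..<x} t) * (w t - h t)) = indicator {a<..<x} t *\<^sub>R (w t - h t)" for t
        using sub by (auto simp: indicator_def)
      then show "set_integrable lborel {a<..<b} (\<lambda>t. of_real (indicator {a<..<x} t) * (w t - h t))"
        using set_integral_diff(1)[OF wx hx] by (simp only: set_integrable_def)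
      show "set_integrable lborel {a<..<b} (\<lambda>t. w t - h t)" by (rule set_integral_diff(1)[OF wi hi])
      show "w t - h t = 0" if "t \<in> spt M" for t using that by (simp add: h_def gap_average_K)
      fix l r assume lr: "(l, r) \<in> gaps"
      note g = gapsD[OF lr]
      have sub: "{l<..<r} \<subseteq> {a<..<b}" using g by auto
      show "(LINT t:{l<..<r}|lborel. w t - h t) = 0"
        by (subst set_integral_diff(2)[OF set_integrable_subset[OF wi _ sub] set_integrable_subset[OF hi _ sub]])
           (auto simp: h_def gap_average_integral[OF lr])
      have "r \<le> x \<or> x \<le> l" using g(4) x by force
      then have "\<forall>t\<in>{l<..<r}. of_real (indicator {a<..<x} t) = (if r \<le> x then 1 else 0 :: 'k)"
        using g by (auto simp: indicator_def)
      then show "\<exists>c. AE t in lborel. t \<in> {l<..<r} \<longrightarrow> (of_real (indicator {a<..<x} t) :: 'k) = c"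
        by (intro exI[of _ "if r \<le> x then 1 else 0"] AE_I2) blast
    qed
    also have "(LINT t:{a<..<b}|lborel. of_real (indicator {a<..<x} t) * (w t - h t)) = (LINT t:{a<..<x}|lborel. w t - h t)"
      unfolding set_lebesgue_integral_def using sub
      by (intro Bochner_Integration.integral_cong) (auto simp: indicator_def)
    finally have "(LINT t:{a<..<x}|lborel. w t) = (LINT t:{a<..<x}|lborel. h t)"
      by (simp add: set_integral_diff(2)[OF wx hx])
    then show ?thesis using int_eq[OF xab] primitive_onD(2)[OF wv xab] by simp
  qed
  have "interpolate v \<in> W12 a b" by (rule primitive_on_W12[OF less prim hsq])
  moreover have "interpolate v \<in> cont_fun_mu a b M"
  proof (rule cont_fun_muI)
    show "interpolate v \<in> cont_fun a b"
      using primitive_on_continuous[OF prim] by (simp add: cont_fun_def interpolate_def)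
    fix l r assume lr: "(l, r) \<in> gaps"
    note g = gapsD[OF lr]
    define m where "m = (1 / (r - l)) *\<^sub>R (LINT t:{l<..<r}|lborel. w t)"
    have "interpolate v x = (interpolate v l - l *\<^sub>R m) + x *\<^sub>R m" if x: "x \<in> {l<..<r}" for x
    proof -
      have "interpolate v x - interpolate v l = (LINT t:{l<..<x}|lborel. h t)"
        using x g by (intro primitive_on_diff[OF prim]) auto
      also have "\<dots> = (LINT t:{l<..<x}|lborel. m)"
        using x by (intro set_lebesgue_integral_cong) (auto simp: h_def gap_average_eq[OF lr] m_def)
      also have "\<dots> = (x - l) *\<^sub>R m" using x by (simp add: set_integral_const_Ioo)
      finally show ?thesis by (simp add: algebra_simps)
    qed
    then show "\<exists>p q. \<forall>x\<in>{l<..<r}. interpolate v x = p + x *\<^sub>R q" by blast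
  qed
  ultimately show "interpolate v \<in> W12_mu a b M" by (simp add: W12_mu_def)
qed

lemma interpolate_AE: 
  fixes v :: "real \<Rightarrow> 'k::{real_normed_field,euclidean_space}"
  assumes "v \<in> W12 a b" "continuous_on {a..b} v"
  shows "AE x in M. interpolate v x = v x"
  using AE_in_spt by eventually_elim (rule interpolate(2)[OF assms])

text \<open>
  The definite description in \<open>iota1\<close> is justified by the interpolant of any Sobolev function in the class
  \<open>F\<close> and by \<open>W12_mu_unique\<close>.
\<close>

lemma iota1:
  fixes F :: "(real \<Rightarrow> 'k::{real_normed_field,euclidean_space}) set"
  assumes "F \<in> dom_iota1 a b M"
  shows "iota1 a b M F \<in> W12_mu a b M" "AE x in M. iota1 a b M F x = rep F x"
proof -
  obtain g where g: "g \<in> W12 a b" "g \<in> cont_fun a b" "AE x in M. g x = rep F x"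
    using assms by (auto simp: dom_iota1_def)
  have cont: "continuous_on {a..b} g" using g(2) by (simp add: cont_fun_def)
  have ex: "interpolate g \<in> W12_mu a b M \<and> (AE x in M. interpolate g x = rep F x)"
  proof (intro conjI interpolate(3)[OF g(1) cont])
    show "AE x in M. interpolate g x = rep F x"
      using interpolate_AE[OF g(1) cont] g(3) by eventually_elim simp
  qed
  have "iota1 a b M F \<in> W12_mu a b M \<and> (AE x in M. iota1 a b M F x = rep F x)"
    unfolding iota1_def
  proof (rule theI[of _ "interpolate g"], rule ex)
    fix u assume u: "u \<in> W12_mu a b M \<and> (AE x in M. u x = rep F x)"
    have "AE x in M. u x = interpolate g x"
      using conjunct2[OF u] conjunct2[OF ex] by eventually_elim simp
    then show "u = interpolate g" using W12_mu_unique u ex by blast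
  qed
  then show "iota1 a b M F \<in> W12_mu a b M" "AE x in M. iota1 a b M F x = rep F x" by auto
qed

lemma iota1_L2_class:
  fixes v :: "real \<Rightarrow> 'k::{real_normed_field,euclidean_space}"
  assumes v: "v \<in> W12 a b" "continuous_on {a..b} v"
  shows "L2_class M v \<in> dom_iota1 a b M" "iota1 a b M (L2_class M v) = interpolate v"
proof -
  note rep = rep_L2_class[OF continuous_sq_integrable[OF v(2)]]
  have AE: "AE x in M. interpolate v x = rep (L2_class M v) x"
    using interpolate_AE[OF v] rep(2) by eventually_elim simp
  note i = W12_muD[OF interpolate(3)[OF v]]
  show dom: "L2_class M v \<in> dom_iota1 a b M"
    using rep(1) AE i(1,3) unfolding dom_iota1_def by blast
  have "AE x in M. iota1 a b M (L2_class M v) x = interpolate v x"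
    using iota1(2)[OF dom] AE by eventually_elim simp
  then show "iota1 a b M (L2_class M v) = interpolate v"
    by (intro W12_mu_unique iota1(1)[OF dom] interpolate(3)[OF v])
qed

text \<open>
  The derivative of \<open>u\<close> is constant on the gaps, while \<open>v'\<close> and the derivative of the interpolant agree on the
  support and have the same mean value on every gap. Hence test functions may be used in place of their
  interpolants.
\<close>

lemma interpolate_orthogonality:
  fixes u v w :: "real \<Rightarrow> 'k::{real_normed_field,euclidean_space}"
  assumes u: "u \<in> W12_mu a b M" and v: "v \<in> W12 a b" "continuous_on {a..b} v" and w: "primitive_on a b w v"
  shows "(LINT x:{a<..<b}|lborel. weak_deriv a b u x * conj_sc (weak_deriv a b (interpolate v) x))
       = (LINT x:{a<..<b}|lborel. weak_deriv a b u x * conj_sc (w x))"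
proof -
  let ?L = "restrict_space lborel {a<..<b}"
  define u' where "u' = weak_deriv a b u"
  define v' where "v' = weak_deriv a b v"
  define p' where "p' = weak_deriv a b (interpolate v)"
  note i = W12_muD[OF interpolate(3)[OF v]]
  have usq: "u' \<in> sq_integrable ?L" unfolding u'_def by (rule W12_primitive_on(2)[OF less W12_muD(1,4)[OF u]])
  have vsq: "v' \<in> sq_integrable ?L" unfolding v'_def by (rule W12_primitive_on(2)[OF less v])
  have psq: "p' \<in> sq_integrable ?L" unfolding p'_def by (rule W12_primitive_on(2)[OF less i(1,4)])
  have hsq: "gap_average v' \<in> sq_integrable ?L" by (rule gap_average_sq_integrable[OF vsq])
  have int: "set_integrable lborel {a<..<b} (\<lambda>x. u' x * conj_sc (f x))" if "f \<in> sq_integrable ?L" for f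
    using integrable_mult_sq_integrable[OF usq sq_integrable_conj[OF that]] by (simp add: set_integrable_Ioo_iff)
  have vw: "AE x in lborel. x \<in> {a<..<b} \<longrightarrow> v' x = w x"
    unfolding v'_def by (rule weak_deriv_primitive_on(1)[OF less w])
  have ph: "AE x in lborel. x \<in> {a<..<b} \<longrightarrow> p' x = gap_average v' x"
    unfolding p'_def v'_def by (rule weak_deriv_primitive_on(1)[OF less interpolate(1)[OF v]])
  have "w \<in> borel_measurable ?L"
    using primitive_onD(1)[OF w] by (intro borel_measurable_integrable) (simp add: set_integrable_Ioo_iff)
  moreover have "AE x in ?L. w x = v' x"
    using vw by (subst AE_restrict_space_iff) (auto elim: eventually_mono)
  ultimately have wsq: "w \<in> sq_integrable ?L" by (rule sq_integrable_cong_AE[OF vsq])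
  have dsq: "(\<lambda>x. v' x - gap_average v' x) \<in> sq_integrable ?L" by (rule sq_integrable_diff[OF vsq hsq])
  have vi: "set_integrable lborel {a<..<b} v'" and hi: "set_integrable lborel {a<..<b} (gap_average v')"
    by (intro sq_integrable_Ioo_imp_integrable vsq hsq)+
  have "(LINT x:{a<..<b}|lborel. u' x * conj_sc (v' x - gap_average v' x)) = 0"
  proof (rule gap_orthogonality)
    show "set_integrable lborel {a<..<b} (\<lambda>x. u' x * conj_sc (v' x - gap_average v' x))" by (rule int[OF dsq])
    show "set_integrable lborel {a<..<b} (\<lambda>x. conj_sc (v' x - gap_average v' x))"
      by (rule set_integral_conj_sc(1)[OF sq_integrable_Ioo_imp_integrable[OF dsq]])
    show "conj_sc (v' x - gap_average v' x) = 0" if "x \<in> spt M" for x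
      using that by (simp add: gap_average_K)
    fix l r assume lr: "(l, r) \<in> gaps"
    have sub: "{l<..<r} \<subseteq> {a<..<b}" using gapsD[OF lr] by auto
    have vl: "set_integrable lborel {l<..<r} v'" and hl: "set_integrable lborel {l<..<r} (gap_average v')"
      using set_integrable_subset[OF vi _ sub] set_integrable_subset[OF hi _ sub] by auto
    show "(LINT x:{l<..<r}|lborel. conj_sc (v' x - gap_average v' x)) = 0"
      unfolding set_integral_conj_sc(2)[OF set_integral_diff(1)[OF vl hl]] set_integral_diff(2)[OF vl hl]
      by (simp add: gap_average_integral[OF lr])
    show "\<exists>c. AE x in lborel. x \<in> {l<..<r} \<longrightarrow> u' x = c"
      unfolding u'_def by (rule W12_mu_deriv_constant[OF u lr])
  qed
  then have "(LINT x:{a<..<b}|lborel. u' x * conj_sc (gap_average v' x)) = (LINT x:{a<..<b}|lborel. u' x * conj_sc (v' x))"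
    using set_integral_diff(2)[OF int[OF vsq] int[OF hsq]] by (simp add: right_diff_distrib)
  moreover have "(LINT x:{a<..<b}|lborel. u' x * conj_sc (gap_average v' x)) = (LINT x:{a<..<b}|lborel. u' x * conj_sc (p' x))"
    by (rule set_integral_cong_AE[OF int[OF hsq] int[OF psq]]) (use ph in \<open>eventually_elim, simp\<close>)
  moreover have "(LINT x:{a<..<b}|lborel. u' x * conj_sc (v' x)) = (LINT x:{a<..<b}|lborel. u' x * conj_sc (w x))"
    by (rule set_integral_cong_AE[OF int[OF vsq] int[OF wsq]]) (use vw in \<open>eventually_elim, simp\<close>)
  ultimately show ?thesis by (simp add: u'_def p'_def)
qed

end


section \<open>Boundary values of functions of bounded variation\<close>

lemma AE_lborel_dense:
  fixes l r :: real
  assumes "AE x in lborel. P x" "l < r"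
  shows "\<exists>x\<in>{l<..<r}. P x"
proof (rule ccontr)
  assume *: "\<not> (\<exists>x\<in>{l<..<r}. P x)"
  have "AE x in lborel. x \<notin> {l<..<r}" using assms(1) by eventually_elim (use * in blast)
  then have "emeasure lborel {l<..<r} = 0"
    by (subst (asm) AE_iff_measurable[of "{l<..<r}"]) auto
  then show False using assms(2) by simp
qed

text \<open>
  Functions that are equal almost everywhere agree at points arbitrarily close to the end point.
\<close>

lemma one_sided_limit_unique_AE:
  fixes g h :: "real \<Rightarrow> 'k::real_normed_vector"
  assumes "a < b" and AE: "AE x in lborel. x \<in> {a<..<b} \<longrightarrow> g x = h x"
  shows "(g \<longlongrightarrow> l) (at_right a) \<Longrightarrow> (h \<longlongrightarrow> l') (at_right a) \<Longrightarrow> l = l'"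
    and "(g \<longlongrightarrow> l) (at_left b) \<Longrightarrow> (h \<longlongrightarrow> l') (at_left b) \<Longrightarrow> l = l'"
proof -
  have limit_0: "l = l'"
    if F: "(g \<longlongrightarrow> l) F" "(h \<longlongrightarrow> l') F" and freq: "\<exists>\<^sub>F x in F. g x = h x" for F
  proof (rule ccontr)
    assume "l \<noteq> l'"
    then have "\<forall>\<^sub>F x in F. dist (g x - h x) (l - l') < norm (l - l')"
      using tendstoD[OF tendsto_diff[OF F], of "norm (l - l')"] by simp
    then have "\<forall>\<^sub>F x in F. \<not> g x = h x" by eventually_elim (auto simp: dist_norm norm_minus_commute)
    then show False using freq by (simp add: frequently_def)
  qed
  have right: "\<exists>\<^sub>F x in at_right a. g x = h x"
    unfolding frequently_def eventually_at_right_field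
  proof (intro notI, elim exE conjE)
    fix c assume c: "a < c" "\<forall>x>a. x < c \<longrightarrow> \<not> g x = h x"
    obtain x where "x \<in> {a<..<min b c}" "x \<in> {a<..<b} \<longrightarrow> g x = h x"
      using AE_lborel_dense[OF AE, of a "min b c"] c(1) assms(1) by auto
    then show False using c(2) by auto
  qed
  show "(g \<longlongrightarrow> l) (at_right a) \<Longrightarrow> (h \<longlongrightarrow> l') (at_right a) \<Longrightarrow> l = l'"
    using limit_0[OF _ _ right] by blast
  have left: "\<exists>\<^sub>F x in at_left b. g x = h x"
    unfolding frequently_def eventually_at_left_field
  proof (intro notI, elim exE conjE)
    fix c assume c: "c < b" "\<forall>x>c. x < b \<longrightarrow> \<not> g x = h x"
    obtain x where "x \<in> {max a c<..<b}" "x \<in> {a<..<b} \<longrightarrow> g x = h x"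
      using AE_lborel_dense[OF AE, of "max a c" b] c(1) assms(1) by auto
    then show False using c(2) by auto
  qed
  show "(g \<longlongrightarrow> l) (at_left b) \<Longrightarrow> (h \<longlongrightarrow> l') (at_left b) \<Longrightarrow> l = l'"
    using limit_0[OF _ _ left] by blast
qed

context interval_measure
begin

text \<open>
  The increments are dominated by those of the indefinite integral of \<open>norm k\<close>, whose sum telescopes.
\<close>

lemma bounded_var_indefinite:
  fixes k :: "real \<Rightarrow> 'k::{real_normed_field,euclidean_space}"
  assumes k: "set_integrable M {a<..<b} k"
  shows "bounded_var_on {a<..<b} (\<lambda>x. c + (LINT y:{a<..<x}|M. k y))"
proof -
  define h where "h x = c + (LINT y:{a<..<x}|M. k y)" for x
  define V where "V x = (LINT y:{a<..<x}|M. norm (k y))" for x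
  have kn: "set_integrable M {a<..<b} (\<lambda>y. norm (k y))"
    using integrable_norm[OF k[unfolded set_integrable_def]] by (simp add: set_integrable_def)
  have step: "norm (h y - h x) \<le> V y - V x" if "a < x" "x \<le> y" "y < b" for x y
  proof -
    have sub: "{a<..<x} \<subseteq> {a<..<b}" "{x..<y} \<subseteq> {a<..<b}" "{a<..<y} = {a<..<x} \<union> {x..<y}" "{a<..<x} \<inter> {x..<y} = {}"
      using that by auto
    have "h y - h x = (LINT t:{x..<y}|M. k t)"
      unfolding h_def sub(3)
      using set_integral_Un[OF sub(4) set_integrable_borel_subset[OF k _ sub(1)] set_integrable_borel_subset[OF k _ sub(2)]]
      by simp
    also have "norm \<dots> \<le> (LINT t:{x..<y}|M. norm (k t))"
      using set_integrable_borel_subset[OF k _ sub(2)] by (intro set_integral_norm_bound) auto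
    also have "\<dots> = V y - V x"
      unfolding V_def sub(3)
      using set_integral_Un[OF sub(4) set_integrable_borel_subset[OF kn _ sub(1)] set_integrable_borel_subset[OF kn _ sub(2)]]
      by simp
    finally show ?thesis .
  qed
  have V_bounds: "0 \<le> V x" "V x \<le> (LINT y:{a<..<b}|M. norm (k y))" if "x \<in> {a<..<b}" for x
  proof -
    show "0 \<le> V x" unfolding V_def set_lebesgue_integral_def by (intro integral_nonneg_AE AE_I2) simp
    show "V x \<le> (LINT y:{a<..<b}|M. norm (k y))"
      unfolding V_def set_lebesgue_integral_def
    proof (rule integral_mono)
      show "integrable M (\<lambda>t. indicator {a<..<x} t *\<^sub>R norm (k t))" "integrable M (\<lambda>t. indicator {a<..<b} t *\<^sub>R norm (k t))"
        unfolding set_integrable_def[symmetric] using that by (auto intro: set_integrable_borel_subset[OF kn])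
      show "indicator {a<..<x} t *\<^sub>R norm (k t) \<le> indicator {a<..<b} t *\<^sub>R norm (k t)" for t
        using that by (auto simp: indicator_def)
    qed
  qed
  have "(\<Sum>i<n. norm (h (t (Suc i)) - h (t i))) \<le> (LINT y:{a<..<b}|M. norm (k y))"
    if t: "\<forall>i\<le>n. t i \<in> {a<..<b}" "\<forall>i<n. t i \<le> t (Suc i)" for n t
  proof -
    have "(\<Sum>i<n. norm (h (t (Suc i)) - h (t i))) \<le> (\<Sum>i<n. V (t (Suc i)) - V (t i))"
    proof (rule sum_mono)
      fix i assume "i \<in> {..<n}"
      then have "t i \<in> {a<..<b}" "t (Suc i) \<in> {a<..<b}" "t i \<le> t (Suc i)" using t by auto
      then show "norm (h (t (Suc i)) - h (t i)) \<le> V (t (Suc i)) - V (t i)" by (intro step) auto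
    qed
    also have "\<dots> = V (t n) - V (t 0)" by (rule sum_lessThan_telescope)
    also have "\<dots> \<le> (LINT y:{a<..<b}|M. norm (k y))"
      using V_bounds[of "t n"] V_bounds[of "t 0"] t(1) by force
    finally show ?thesis .
  qed
  then show ?thesis unfolding bounded_var_on_def h_def[symmetric] by blast
qed

lemma indefinite_limits:
  fixes k :: "real \<Rightarrow> 'k::{real_normed_field,euclidean_space}"
  assumes k: "set_integrable M {a<..<b} k"
  shows "((\<lambda>x. c + (LINT y:{a<..<x}|M. k y)) \<longlongrightarrow> c) (at_right a)"
    and "((\<lambda>x. c + (LINT y:{a<..<x}|M. k y)) \<longlongrightarrow> c + (LINT y:{a<..<b}|M. k y)) (at_left b)"
proof -
  have "((\<lambda>x. c + (LINT y:{a<..<x}|M. k y)) \<longlongrightarrow> c + 0) (at_right a)"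
  proof (rule tendsto_at_right_sequentially[OF less], rule tendsto_add[OF tendsto_const])
    fix S :: "nat \<Rightarrow> real"
    assume S: "\<And>n. a < S n" "\<And>n. S n < b" "decseq S" "S \<longlonglongrightarrow> a"
    have "(\<lambda>n. LINT y:{a<..<S n}|M. k y) \<longlonglongrightarrow> (LINT y:(\<Inter>n. {a<..<S n})|M. k y)"
    proof (rule set_integral_cont_down)
      show "{a<..<S n} \<in> sets M" for n using S(2)[of n] by (intro subset_sets_M) auto
      show "decseq (\<lambda>n. {a<..<S n})" using S(3) by (force simp: decseq_def)
      show "set_integrable M {a<..<S 0} k"
        using S(2)[of 0] by (intro set_integrable_borel_subset[OF k]) auto
    qed
    moreover have "(\<Inter>n. {a<..<S n}) = {}"
    proof -
      have "x \<notin> (\<Inter>n. {a<..<S n})" for x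
      proof
        assume x: "x \<in> (\<Inter>n. {a<..<S n})"
        then have "x \<le> S n" for n by (auto simp: less_imp_le)
        then have "x \<le> a" by (intro LIMSEQ_le_const[OF S(4)]) auto
        then show False using x by auto
      qed
      then show ?thesis by blast
    qed
    ultimately show "(\<lambda>n. LINT y:{a<..<S n}|M. k y) \<longlonglongrightarrow> 0" by (simp add: set_lebesgue_integral_def)
  qed
  then show "((\<lambda>x. c + (LINT y:{a<..<x}|M. k y)) \<longlongrightarrow> c) (at_right a)" by simp
  show "((\<lambda>x. c + (LINT y:{a<..<x}|M. k y)) \<longlongrightarrow> c + (LINT y:{a<..<b}|M. k y)) (at_left b)"
  proof (rule tendsto_at_left_sequentially[OF less], rule tendsto_add[OF tendsto_const])
    fix S :: "nat \<Rightarrow> real"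
    assume S: "\<And>n. S n < b" "\<And>n. a < S n" "incseq S" "S \<longlonglongrightarrow> b"
    have eq: "(\<Union>n. {a<..<S n}) = {a<..<b}"
    proof -
      have "\<exists>n. x < S n" if "x < b" for x
        using order_tendstoD(1)[OF S(4) that] by (auto simp: eventually_sequentially)
      then show ?thesis using S(1) by (force intro: less_trans)
    qed
    have "(\<lambda>n. LINT y:{a<..<S n}|M. k y) \<longlonglongrightarrow> (LINT y:(\<Union>n. {a<..<S n})|M. k y)"
    proof (rule set_integral_cont_up)
      show "{a<..<S n} \<in> sets M" for n using S(1)[of n] by (intro subset_sets_M) auto
      show "incseq (\<lambda>n. {a<..<S n})" using S(3) by (force simp: incseq_def)
      show "set_integrable M (\<Union>n. {a<..<S n}) k" unfolding eq by (rule k)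
    qed
    then show "(\<lambda>n. LINT y:{a<..<S n}|M. k y) \<longlonglongrightarrow> (LINT y:{a<..<b}|M. k y)" by (simp only: eq)
  qed
qed

lemma boundary_values:
  fixes f k :: "real \<Rightarrow> 'k::{real_normed_field,euclidean_space}"
  assumes k: "set_integrable M {a<..<b} k"
    and f: "AE x in lborel. x \<in> {a<..<b} \<longrightarrow> f x = c + (LINT y:{a<..<x}|M. k y)"
  shows "left_value a b f = c" "right_value a b f = c + (LINT y:{a<..<b}|M. k y)"
proof -
  define h where "h x = c + (LINT y:{a<..<x}|M. k y)" for x
  have h: "BV_rep a b f h"
    unfolding BV_rep_def using bounded_var_indefinite[OF k, of c] f
    by (auto simp: h_def[abs_def] elim: eventually_mono)
  note lim = indefinite_limits[OF k, of c, folded h_def, unfolded h_def[of b]]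
  have AE: "AE x in lborel. x \<in> {a<..<b} \<longrightarrow> g x = h x" if "BV_rep a b f g" for g
    using conjunct2[OF that[unfolded BV_rep_def]] conjunct2[OF h[unfolded BV_rep_def]]
    by eventually_elim auto
  show "left_value a b f = c"
    unfolding left_value_def
  proof (rule the_equality)
    show "\<exists>h. BV_rep a b f h \<and> (h \<longlongrightarrow> c) (at_right a)"
      using h lim(1) by (intro exI[of _ h] conjI)
    show "l = c" if "\<exists>g. BV_rep a b f g \<and> (g \<longlongrightarrow> l) (at_right a)" for l
      using that by (elim exE conjE) (rule one_sided_limit_unique_AE(1)[OF less AE _ lim(1)])
  qed
  show "right_value a b f = c + (LINT y:{a<..<b}|M. k y)"
    unfolding right_value_def
  proof (rule the_equality)
    show "\<exists>h. BV_rep a b f h \<and> (h \<longlongrightarrow> c + (LINT y:{a<..<b}|M. k y)) (at_left b)"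
      using h lim(2) by (intro exI[of _ h] conjI)
    show "l = c + (LINT y:{a<..<b}|M. k y)" if "\<exists>g. BV_rep a b f g \<and> (g \<longlongrightarrow> l) (at_left b)" for l
      using that by (elim exE conjE) (rule one_sided_limit_unique_AE(2)[OF less AE _ lim(2)])
  qed
qed

end

context edge_measure
begin

text \<open>
  Integration by parts against the conjugate of the second function. The description of \<open>u\<close> as an indefinite
  integral identifies the boundary terms as one-sided limits of \<open>u\<close>.
\<close>

lemma greens_formula:
  fixes F F' :: "(real \<Rightarrow> 'k::{real_normed_field,euclidean_space}) set" and k :: "real \<Rightarrow> 'k"
  defines "u \<equiv> weak_deriv a b (iota1 a b M F)"
  assumes F: "F \<in> dom_iota1 a b M" and F': "F' \<in> dom_iota1 a b M"
    and k: "has_mu_deriv a b M u k"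
  shows "(LINT x:{a<..<b}|lborel. u x * conj_sc (weak_deriv a b (iota1 a b M F') x))
    = right_value a b u * conj_sc (iota1 a b M F' b) - left_value a b u * conj_sc (iota1 a b M F' a)
      - (LINT x|M. k x * conj_sc (rep F' x))"
proof -
  define v where "v = iota1 a b M F'"
  have v: "v \<in> W12_mu a b M" "AE x in M. v x = rep F' x" unfolding v_def by (rule iota1[OF F'])+
  have ki: "set_integrable M {a<..<b} k"
    using k by (intro set_integrable_borel) (auto simp: has_mu_deriv_def)
  obtain c where c: "AE x in lborel. x \<in> {a<..<b} \<longrightarrow> u x = c + (LINT y:{a<..<x}|M. k y)"
    using has_distr_deriv_imp_indefinite[OF ki] k by (auto simp: has_mu_deriv_def)
  note bv = boundary_values[OF ki c]
  have prim: "primitive_on a b (weak_deriv a b v) v" by (rule W12_primitive_on(1)[OF less W12_muD(1,4)[OF v(1)]])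
  have vsq: "weak_deriv a b v \<in> sq_integrable (restrict_space lborel {a<..<b})"
    by (rule W12_primitive_on(2)[OF less W12_muD(1,4)[OF v(1)]])
  have usq: "u \<in> sq_integrable (restrict_space lborel {a<..<b})"
    unfolding u_def by (rule W12_primitive_on(2)[OF less W12_muD(1,4)[OF iota1(1)[OF F]]])
  have primc: "primitive_on a b (\<lambda>x. conj_sc (weak_deriv a b v x)) (\<lambda>x. conj_sc (v x))"
    by (rule primitive_on_conj_sc[OF prim])
  note IBP = integration_by_parts[OF ki primc]
  have "(LINT x:{a<..<b}|lborel. u x * conj_sc (weak_deriv a b v x))
      = (LINT x:{a<..<b}|lborel. (c + (LINT y:{a<..<x}|M. k y)) * conj_sc (weak_deriv a b v x))"
  proof (rule set_integral_cong_AE[OF _ IBP(2)[of c]])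
    show "set_integrable lborel {a<..<b} (\<lambda>x. u x * conj_sc (weak_deriv a b v x))"
      using integrable_mult_sq_integrable[OF usq sq_integrable_conj[OF vsq]] by (simp add: set_integrable_Ioo_iff)
    show "AE x in lborel. x \<in> {a<..<b} \<longrightarrow> u x * conj_sc (weak_deriv a b v x)
        = (c + (LINT y:{a<..<x}|M. k y)) * conj_sc (weak_deriv a b v x)"
      using c by eventually_elim simp
  qed
  also have "\<dots> = right_value a b u * conj_sc (v b) - left_value a b u * conj_sc (v a)
      - (LINT y:{a<..<b}|M. k y * conj_sc (v y))"
    unfolding IBP(3) bv ..
  also have "(LINT y:{a<..<b}|M. k y * conj_sc (v y)) = (LINT x|M. k x * conj_sc (rep F' x))"
    unfolding set_lebesgue_integral_def
  proof (rule integral_cong_AE)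
    show "(\<lambda>x. indicator {a<..<b} x *\<^sub>R (k x * conj_sc (v x))) \<in> borel_measurable M"
      using IBP(1) by (auto simp: set_integrable_def)
    have "F' \<in> L2 M" using F' by (simp add: dom_iota1_def)
    then have [measurable]: "rep F' \<in> borel_measurable M" "k \<in> borel_measurable M"
      using sq_integrableD(1)[OF rep_in_L2(1)] k by (auto simp: has_mu_deriv_def)
    show "(\<lambda>x. k x * conj_sc (rep F' x)) \<in> borel_measurable M" by measurable
    show "AE x in M. indicator {a<..<b} x *\<^sub>R (k x * conj_sc (v x)) = k x * conj_sc (rep F' x)"
      using AE_in_Ioo v(2) by eventually_elim simp
  qed
  finally show ?thesis by (simp add: v_def)
qed

end


section \<open>The operator associated with the form\<close>

lemma measure_graph_finite:
  assumes "measure_graph G"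
  shows "finite (E1 G)" "finite (V1 G)"
proof -
  have "fin_digraph (graph G)" using assms by (simp add: measure_graph_def)
  then have "finite (arcs (graph G))" "finite (verts (graph G))"
    by (auto dest: fin_digraph.finite_arcs fin_digraph.finite_verts)
  then show "finite (E1 G)" "finite (V1 G)" by (auto simp: E1_def V1_def)
qed

lemma measure_graph_edge:
  assumes "measure_graph G" "e \<in> E1 G"
  shows "edge_measure (emeas G e) (lend G e) (rend G e)"
proof -
  have "e \<in> arcs (graph G)" "emeasure (emeas G e) {lend G e..rend G e} \<noteq> 0"
    using assms(2) by (auto simp: E1_def)
  then have *: "lend G e < rend G e" "sets (emeas G e) = sets (restrict_space borel {lend G e..rend G e})"
    "finite_measure (emeas G e)" "lend G e \<in> spt (emeas G e)" "rend G e \<in> spt (emeas G e)"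
    "emeasure (emeas G e) {lend G e, rend G e} = 0"
    using assms(1) unfolding measure_graph_def by blast+
  then show ?thesis
    by (intro edge_measure.intro interval_measure.intro interval_measure_axioms.intro edge_measure_axioms.intro)
qed

lemma L2_inner_L2_class:
  assumes f: "f \<in> sq_integrable M" and G: "G \<in> L2 M"
  shows "L2_inner M (L2_class M f) G = (LINT x|M. f x * conj_sc (rep G x))"
    and "L2_inner M G (L2_class M f) = (LINT x|M. rep G x * conj_sc (f x))"
proof -
  have meas [measurable]: "f \<in> borel_measurable M" "rep G \<in> borel_measurable M"
      "rep (L2_class M f) \<in> borel_measurable M"
    using sq_integrableD(1) f rep_in_L2(1)[OF G] rep_in_L2(1)[OF rep_L2_class(1)[OF f]] by blast+
  show "L2_inner M (L2_class M f) G = (LINT x|M. f x * conj_sc (rep G x))"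
    unfolding L2_inner_def
  proof (rule integral_cong_AE)
    show "AE x in M. rep (L2_class M f) x * conj_sc (rep G x) = f x * conj_sc (rep G x)"
      using rep_L2_class(2)[OF f] by eventually_elim simp
  qed measurable
  show "L2_inner M G (L2_class M f) = (LINT x|M. rep G x * conj_sc (f x))"
    unfolding L2_inner_def
  proof (rule integral_cong_AE)
    show "AE x in M. rep G x * conj_sc (rep (L2_class M f) x) = rep G x * conj_sc (f x)"
      using rep_L2_class(2)[OF f] by eventually_elim simp
  qed measurable
qed

lemma bnd_inner_diff_left:
  "bnd_inner G (\<lambda>i. x i - y i) z = bnd_inner G x z - bnd_inner G y z"
  by (simp add: bnd_inner_def sum_subtractf left_diff_distrib)

lemma bnd_inner_add_right:
  "bnd_inner G z (\<lambda>i. x i + y i) = bnd_inner G z x + bnd_inner G z y"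
  by (simp add: bnd_inner_def sum.distrib distrib_left distrib_right)

lemma bnd_inner_mult_right:
  "bnd_inner G z (\<lambda>i. c * x i) = conj_sc c * bnd_inner G z x"
  by (simp add: bnd_inner_def sum_distrib_left distrib_left ac_simps)

lemma bnd_inner_sum_right:
  assumes "finite S"
  shows "bnd_inner G z (\<lambda>i. \<Sum>s\<in>S. c s * x s i) = (\<Sum>s\<in>S. conj_sc (c s) * bnd_inner G z (x s))"
  using assms
proof (induction S rule: finite_induct)
  case empty
  then show ?case by (simp add: bnd_inner_def)
next
  case (insert s S)
  then show ?case by (simp add: bnd_inner_add_right bnd_inner_mult_right)
qed

lemma lin_subspace_sum:
  assumes "lin_subspace Y" "finite S" "\<And>s. s \<in> S \<Longrightarrow> x s \<in> Y"
  shows "(\<lambda>i. \<Sum>s\<in>S. c s * x s i) \<in> Y"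
  using assms(2,3)
proof (induction S rule: finite_induct)
  case empty
  then show ?case using assms(1) by (simp add: lin_subspace_def)
next
  case (insert s S)
  then have "(\<lambda>i. \<Sum>s\<in>S. c s * x s i) \<in> Y" "(\<lambda>i. c s * x s i) \<in> Y"
    using assms(1) by (auto simp: lin_subspace_def)
  then have "(\<lambda>i. c s * x s i + (\<Sum>s\<in>S. c s * x s i)) \<in> Y"
    using assms(1) unfolding lin_subspace_def by fast
  then show ?case using insert.hyps by simp
qed

lemma orth_proj:
  fixes G :: "('b, 'a) measure_graph"
  assumes G: "measure_graph G" and Y: "lin_subspace Y" "Y \<subseteq> fam (bnd_idx G)"
  shows "orth_proj G Y x \<in> Y" "z \<in> Y \<Longrightarrow> bnd_inner G (\<lambda>i. x i - orth_proj G Y x i) z = 0"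
proof -
  define w :: "('b, 'a) bidx \<Rightarrow> real" where "w = case_sum (\<lambda>_. 1) (weight G)"
  note fin = measure_graph_finite[OF G]
  have inner: "bnd_inner G = weighted_inner (bnd_idx G) w"
    by (intro ext) (simp add: bnd_inner_eq_weighted_inner[OF fin] w_def)
  have finI: "finite (bnd_idx G)" using fin by (simp add: bnd_idx_def)
  have wpos: "w i > 0" if "i \<in> bnd_idx G" for i
    using that G by (auto simp: w_def bnd_idx_def V1_def measure_graph_def order.strict_iff_order)
  have "\<exists>!y. y \<in> Y \<and> (\<forall>z\<in>Y. bnd_inner G (\<lambda>i. x i - y i) z = 0)"
  proof (rule ex_ex1I)
    show "\<exists>y. y \<in> Y \<and> (\<forall>z\<in>Y. bnd_inner G (\<lambda>i. x i - y i) z = 0)"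
      using orthogonal_projection_exists[where I = "bnd_idx G" and w = w, OF finI wpos finI order_refl Y(2,1), where x = x] by (auto simp: inner)
    fix y y' assume y: "y \<in> Y \<and> (\<forall>z\<in>Y. bnd_inner G (\<lambda>i. x i - y i) z = 0)"
      and y': "y' \<in> Y \<and> (\<forall>z\<in>Y. bnd_inner G (\<lambda>i. x i - y' i) z = 0)"
    have d: "(\<lambda>i. y i - y' i) \<in> Y" using lin_subspace_diff[OF Y(1), of y y' 1] y y' by simp
    have "bnd_inner G (\<lambda>i. y i - y' i) (\<lambda>i. y i - y' i)
        = bnd_inner G (\<lambda>i. x i - y' i) (\<lambda>i. y i - y' i) - bnd_inner G (\<lambda>i. x i - y i) (\<lambda>i. y i - y' i)"
      by (simp add: bnd_inner_diff_left)
    also have "\<dots> = 0" using y y' d by simp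
    finally have on: "y i - y' i = 0" if "i \<in> bnd_idx G" for i
      using weighted_inner_self_eq_0D[OF finI wpos, where x = "\<lambda>i. y i - y' i" and i = i] that by (simp add: inner)
    have "y i = 0 \<and> y' i = 0" if "i \<notin> bnd_idx G" for i
      using subsetD[OF Y(2), of y] subsetD[OF Y(2), of y'] y y' that by (simp add: fam_def)
    then show "y = y'" using on by (metis eq_iff_diff_eq_0 ext)
  qed
  from theI'[OF this] show "orth_proj G Y x \<in> Y" "z \<in> Y \<Longrightarrow> bnd_inner G (\<lambda>i. x i - orth_proj G Y x i) z = 0"
    unfolding orth_proj_def by auto
qed

lemma bnd_subspace_lin_subspace:
  assumes "bnd_subspace G X"
  shows "lin_subspace X" "X \<subseteq> fam (bnd_idx G)" "lin_subspace (X0 X)" "X0 X \<subseteq> fam (bnd_idx G)"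
  using assms by (auto simp: bnd_subspace_def lin_subspace_def X0_def pr_V1_def fun_eq_iff)

abbreviation edge_weak_deriv where
  "edge_weak_deriv G F e \<equiv> weak_deriv (lend G e) (rend G e) (iota_e G e (F e))"

abbreviation edge_mu_deriv where
  "edge_mu_deriv G F e \<equiv> mu_deriv (lend G e) (rend G e) (emeas G e) (edge_weak_deriv G F e)"

lemma edge_deriv_iota:
  "e \<in> E1 G \<Longrightarrow> edge_deriv G (fst (iota G f)) e = edge_weak_deriv G (fst f) e"
  by (simp add: edge_deriv_def iota_def)

lemma tr_simps:
  "e \<in> E1 G \<Longrightarrow> tr G (iota G f) (Inl (e, 0)) = iota_e G e (fst f e) (lend G e)"
  "e \<in> E1 G \<Longrightarrow> tr G (iota G f) (Inl (e, 1)) = iota_e G e (fst f e) (rend G e)"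
  "v \<in> V1 G \<Longrightarrow> tr G (iota G f) (Inr v) = snd f v"
  "i \<notin> bnd_idx G \<Longrightarrow> tr G (iota G f) i = 0"
  by (auto simp: tr_def iota_def bnd_idx_def)

lemma sum_endpoints:
  "(\<Sum>p\<in>E \<times> {0, 1::nat}. f p) = (\<Sum>e\<in>E. f (e, 0) + f (e, 1))"
  by (subst sum.cartesian_product[symmetric, of "\<lambda>e j. f (e, j)", simplified]) simp

lemma bnd_inner_str:
  "bnd_inner G (str G u) x = (\<Sum>e\<in>E1 G. left_value (lend G e) (rend G e) (u e) * conj_sc (x (Inl (e, 0)))
      - right_value (lend G e) (rend G e) (u e) * conj_sc (x (Inl (e, 1))))"
proof -
  have "(\<Sum>v\<in>V1 G. str G u (Inr v) * conj_sc (x (Inr v)) * of_real (weight G v)) = 0"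
    by (rule sum.neutral) (simp add: str_def)
  moreover have "(\<Sum>e\<in>E1 G. str G u (Inl (e, 0)) * conj_sc (x (Inl (e, 0))) + str G u (Inl (e, 1)) * conj_sc (x (Inl (e, 1))))
    = (\<Sum>e\<in>E1 G. left_value (lend G e) (rend G e) (u e) * conj_sc (x (Inl (e, 0)))
      - right_value (lend G e) (rend G e) (u e) * conj_sc (x (Inl (e, 1))))"
    by (rule sum.cong[OF refl]) (auto simp: str_def bnd_idx_def)
  ultimately show ?thesis unfolding bnd_inner_def sum_endpoints by simp
qed

lemma mu_deriv:
  assumes "has_mu_deriv a b M u k"
  shows "has_mu_deriv a b M u (mu_deriv a b M u)"
  unfolding mu_deriv_def by (rule someI[where P = "has_mu_deriv a b M u"]) (rule assms)

lemma dom_HhatD: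
  assumes "F \<in> dom_Hhat G" "e \<in> E1 G"
  defines "u \<equiv> edge_weak_deriv G F e"
  shows "F e \<in> dom_iota_e G e"
    "has_mu_deriv (lend G e) (rend G e) (emeas G e) u (mu_deriv (lend G e) (rend G e) (emeas G e) u)"
    "mu_deriv (lend G e) (rend G e) (emeas G e) u \<in> sq_integrable (emeas G e)"
    "Hhat G F e = L2_class (emeas G e) (\<lambda>x. - mu_deriv (lend G e) (rend G e) (emeas G e) u x)"
  using assms(1,2) unfolding dom_Hhat_def Hhat_def u_def Let_def by (auto simp: PiE_def intro: mu_deriv)

lemma Hhat_in_L2:
  assumes "F \<in> dom_Hhat G"
  shows "Hhat G F \<in> (\<Pi>\<^sub>E e\<in>E1 G. L2 (emeas G e))"
proof (rule PiE_I)
  fix e assume e: "e \<in> E1 G"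
  note d = dom_HhatD[OF assms e]
  show "Hhat G F e \<in> L2 (emeas G e)"
    unfolding d(4) using sq_integrable_cmult[OF d(3), of "-1"] by (intro rep_L2_class(1)) simp
qed (simp add: Hhat_def)

text \<open>
  Green's formula summed over the edges; the boundary terms add up to the scalar product of signed trace and trace.
\<close>

lemma tau_eq_Hhat:
  assumes G: "measure_graph G" and f: "fst f \<in> dom_Hhat G" and g: "g \<in> dom_iota G"
  shows "tau G L f g = (\<Sum>e\<in>E1 G. L2_inner (emeas G e) (Hhat G (fst f) e) (fst g e))
    + bnd_inner G (\<lambda>i. L (tr G (iota G f)) i - str G (edge_deriv G (fst (iota G f))) i) (tr G (iota G g))"
proof -
  define D where "D = edge_deriv G (fst (iota G f))"
  define D' where "D' = edge_deriv G (fst (iota G g))"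
  have "(LINT x:{lend G e<..<rend G e}|lborel. D e x * conj_sc (D' e x))
      = L2_inner (emeas G e) (Hhat G (fst f) e) (fst g e)
        - (left_value (lend G e) (rend G e) (D e) * conj_sc (tr G (iota G g) (Inl (e, 0)))
           - right_value (lend G e) (rend G e) (D e) * conj_sc (tr G (iota G g) (Inl (e, 1))))"
    if e: "e \<in> E1 G" for e
  proof -
    interpret edge_measure "emeas G e" "lend G e" "rend G e" by (rule measure_graph_edge[OF G e])
    have D: "D e = weak_deriv (lend G e) (rend G e) (iota1 (lend G e) (rend G e) (emeas G e) (fst f e))"
      "D' e = weak_deriv (lend G e) (rend G e) (iota1 (lend G e) (rend G e) (emeas G e) (fst g e))"
      using e by (simp_all add: D_def D'_def edge_deriv_iota iota_e_def)
    define k where "k = mu_deriv (lend G e) (rend G e) (emeas G e) (D e)"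
    note d = dom_HhatD[OF f e, folded D(1)[unfolded iota_e_def[symmetric]], unfolded iota_e_def, folded D(1), folded k_def]
    have ge: "fst g e \<in> dom_iota1 (lend G e) (rend G e) (emeas G e)"
      using g e by (auto simp: dom_iota_def dom_iota_e_def)
    have kn: "(\<lambda>x. - k x) \<in> sq_integrable (emeas G e)" using sq_integrable_cmult[OF d(3), of "-1"] by simp
    have "L2_inner (emeas G e) (Hhat G (fst f) e) (fst g e) = (LINT x|emeas G e. - k x * conj_sc (rep (fst g e) x))"
      unfolding d(4) using ge by (intro L2_inner_L2_class(1)[OF kn]) (simp add: dom_iota1_def)
    also have "\<dots> = - (LINT x|emeas G e. k x * conj_sc (rep (fst g e) x))" by simp
    finally have L2: "L2_inner (emeas G e) (Hhat G (fst f) e) (fst g e) = - (LINT x|emeas G e. k x * conj_sc (rep (fst g e) x))" .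
    have "(LINT x:{lend G e<..<rend G e}|lborel. D e x * conj_sc (D' e x))
      = right_value (lend G e) (rend G e) (D e) * conj_sc (tr G (iota G g) (Inl (e, 1)))
        - left_value (lend G e) (rend G e) (D e) * conj_sc (tr G (iota G g) (Inl (e, 0)))
        - (LINT x|emeas G e. k x * conj_sc (rep (fst g e) x))"
      unfolding D tr_simps(1,2)[OF e] iota_e_def
      using greens_formula[OF _ ge d(2)[unfolded D(1)]] d(1) by (simp add: dom_iota_e_def)
    then show ?thesis unfolding L2 by simp
  qed
  then have "(\<Sum>e\<in>E1 G. LINT x:{lend G e<..<rend G e}|lborel. D e x * conj_sc (D' e x))
      = (\<Sum>e\<in>E1 G. L2_inner (emeas G e) (Hhat G (fst f) e) (fst g e)) - bnd_inner G (str G D) (tr G (iota G g))"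
    unfolding bnd_inner_str sum_subtractf[symmetric] by (rule sum.cong[OF refl])
  then show ?thesis unfolding tau_def bnd_inner_diff_left D_def D'_def by simp
qed

definition of_edge_funs :: "('v, 'e) measure_graph \<Rightarrow> ('e \<Rightarrow> real \<Rightarrow> 'k) \<Rightarrow> ('v \<Rightarrow> 'k) \<Rightarrow>
    ('e \<Rightarrow> (real \<Rightarrow> 'k) set) \<times> ('v \<Rightarrow> 'k::{real_normed_field,euclidean_space})" where
  "of_edge_funs G v y = (\<lambda>e\<in>E1 G. L2_class (emeas G e) (v e), y)"

lemma of_edge_funs:
  fixes v :: "'e \<Rightarrow> real \<Rightarrow> 'k::{real_normed_field,euclidean_space}"
  assumes G: "measure_graph G" and y: "y \<in> fam (V1 G)"
    and v: "\<And>e. e \<in> E1 G \<Longrightarrow> v e \<in> W12 (lend G e) (rend G e)"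
      "\<And>e. e \<in> E1 G \<Longrightarrow> continuous_on {lend G e..rend G e} (v e)"
  shows "of_edge_funs G v y \<in> dom_iota G"
    and "e \<in> E1 G \<Longrightarrow> tr G (iota G (of_edge_funs G v y)) (Inl (e, 0)) = v e (lend G e)"
    and "e \<in> E1 G \<Longrightarrow> tr G (iota G (of_edge_funs G v y)) (Inl (e, 1)) = v e (rend G e)"
proof -
  have *: "L2_class (emeas G e) (v e) \<in> dom_iota_e G e"
      "iota_e G e (L2_class (emeas G e) (v e)) (lend G e) = v e (lend G e)"
      "iota_e G e (L2_class (emeas G e) (v e)) (rend G e) = v e (rend G e)" if e: "e \<in> E1 G" for e
  proof -
    interpret edge_measure "emeas G e" "lend G e" "rend G e" by (rule measure_graph_edge[OF G e])
    show "L2_class (emeas G e) (v e) \<in> dom_iota_e G e"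
      unfolding dom_iota_e_def by (rule iota1_L2_class(1)[OF v[OF e]])
    show "iota_e G e (L2_class (emeas G e) (v e)) (lend G e) = v e (lend G e)"
      "iota_e G e (L2_class (emeas G e) (v e)) (rend G e) = v e (rend G e)"
      unfolding iota_e_def iota1_L2_class(2)[OF v[OF e]] by (intro interpolate(2)[OF v[OF e]] ends_in_spt)+
  qed
  have "L2_class (emeas G e) (v e) \<in> L2 (emeas G e)" if "e \<in> E1 G" for e
    using *(1)[OF that] by (simp add: dom_iota_e_def dom_iota1_def)
  then show "of_edge_funs G v y \<in> dom_iota G"
    using y * by (simp add: dom_iota_def hilb_def of_edge_funs_def)
  show "e \<in> E1 G \<Longrightarrow> tr G (iota G (of_edge_funs G v y)) (Inl (e, 0)) = v e (lend G e)"
    "e \<in> E1 G \<Longrightarrow> tr G (iota G (of_edge_funs G v y)) (Inl (e, 1)) = v e (rend G e)"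
    using * by (simp_all only: tr_simps) (simp_all add: of_edge_funs_def)
qed

lemma affine_W12:
  fixes p q :: "'k::{real_normed_field,euclidean_space}"
  assumes "a < b"
  shows "(\<lambda>x. p + x *\<^sub>R q) \<in> W12 a b" "continuous_on {a..b} (\<lambda>x. p + x *\<^sub>R q)"
proof -
  have "(\<lambda>_. q) \<in> sq_integrable (restrict_space lborel {a<..<b})"
    by (rule finite_measure.sq_integrable_bounded[OF finite_measure_Ioo]) auto
  then show "(\<lambda>x. p + x *\<^sub>R q) \<in> W12 a b"
    using primitive_on_affine[of a b "\<lambda>x. p + x *\<^sub>R q" p q] assms by (intro primitive_on_W12) auto
  show "continuous_on {a..b} (\<lambda>x. p + x *\<^sub>R q)" by (intro continuous_intros)
qed

text \<open>
  Affine functions attain arbitrary values at the two ends of every edge.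
\<close>

lemma prescribed_trace:
  fixes \<eta> :: "('v, 'e) bidx \<Rightarrow> 'k::{real_normed_field,euclidean_space}"
  assumes G: "measure_graph G" and \<eta>: "\<eta> \<in> fam (bnd_idx G)"
  obtains g where "g \<in> dom_iota G" "tr G (iota G g) = \<eta>" "snd g = pr_V1 \<eta>"
proof -
  define q where "q e = (1 / (rend G e - lend G e)) *\<^sub>R (\<eta> (Inl (e, 1)) - \<eta> (Inl (e, 0)))" for e
  define v where "v e x = (\<eta> (Inl (e, 0)) - lend G e *\<^sub>R q e) + x *\<^sub>R q e" for e x
  have y: "pr_V1 \<eta> \<in> fam (V1 G)" using \<eta> by (auto simp: fam_def pr_V1_def bnd_idx_def)
  have less: "lend G e < rend G e" if "e \<in> E1 G" for e
    using measure_graph_edge[OF G that] by (simp add: edge_measure_def interval_measure_def interval_measure_axioms_def)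
  have vW: "v e \<in> W12 (lend G e) (rend G e)" "continuous_on {lend G e..rend G e} (v e)" if "e \<in> E1 G" for e
    unfolding v_def[abs_def] by (intro affine_W12 less that)+
  note g = of_edge_funs[OF G y vW]
  have "v e (rend G e) = \<eta> (Inl (e, 0)) + (rend G e - lend G e) *\<^sub>R q e" for e
    by (simp add: v_def algebra_simps)
  then have ends: "v e (lend G e) = \<eta> (Inl (e, 0))" "v e (rend G e) = \<eta> (Inl (e, 1))" if "e \<in> E1 G" for e
  proof -
    show "v e (lend G e) = \<eta> (Inl (e, 0))" by (simp add: v_def)
    have "(rend G e - lend G e) *\<^sub>R q e = \<eta> (Inl (e, 1)) - \<eta> (Inl (e, 0))"
      using less[OF that] by (simp add: q_def)
    then show "v e (rend G e) = \<eta> (Inl (e, 1))"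
      using \<open>\<And>e. v e (rend G e) = \<eta> (Inl (e, 0)) + (rend G e - lend G e) *\<^sub>R q e\<close> by simp
  qed
  have "tr G (iota G (of_edge_funs G v (pr_V1 \<eta>))) i = \<eta> i" for i
  proof (cases "i \<in> bnd_idx G")
    case True
    then consider e where "e \<in> E1 G" "i = Inl (e, 0)" | e where "e \<in> E1 G" "i = Inl (e, 1)" | w where "w \<in> V1 G" "i = Inr w"
      by (auto simp: bnd_idx_def)
    then show ?thesis
    proof cases
      case (1 e)
      then show ?thesis by (simp only: g(2) ends)
    next
      case (2 e)
      then show ?thesis by (simp only: g(3) ends)
    next
      case (3 w)
      then show ?thesis by (simp add: tr_simps(3) of_edge_funs_def pr_V1_def)
    qed
  next
    case False
    then show ?thesis using \<eta> by (simp add: tr_simps(4) fam_def)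
  qed
  then have "tr G (iota G (of_edge_funs G v (pr_V1 \<eta>))) = \<eta>" by blast
  then show ?thesis using that[OF g(1)] by (simp add: of_edge_funs_def)
qed

text \<open>
  The form is tested with the class of a test function on the edge \<open>e\<close> and zero elsewhere. Its trace vanishes, so that
  the part of the form with \<open>L\<close> does not contribute, and by \<open>interpolate_orthogonality\<close> the derivative of the
  interpolant may be replaced by that of the test function.
\<close>

lemma H_graph_mu_deriv:
  fixes G :: "('v, 'e) measure_graph"
    and f h :: "('e \<Rightarrow> (real \<Rightarrow> 'k) set) \<times> ('v \<Rightarrow> 'k::{real_normed_field,euclidean_space})"
  assumes G: "measure_graph G" and X: "bnd_subspace G X" and fh: "(f, h) \<in> H_graph G X L" and e: "e \<in> E1 G"
  shows "has_mu_deriv (lend G e) (rend G e) (emeas G e)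
    (edge_weak_deriv G (fst f) e) (\<lambda>x. - rep (fst h e) x)"
    and "set_integrable lborel {lend G e<..<rend G e} (edge_weak_deriv G (fst f) e)"
proof -
  let ?a = "lend G e" and ?b = "rend G e" and ?M = "emeas G e"
  interpret edge_measure ?M ?a ?b by (rule measure_graph_edge[OF G e])
  define u where "u = weak_deriv ?a ?b (iota_e G e (fst f e))"
  have f: "f \<in> dom_tau G X" and h: "h \<in> hilb G"
    and eq: "\<And>g. g \<in> dom_tau G X \<Longrightarrow> tau G L f g = hilb_inner G h g"
    using fh by (auto simp: H_graph_def)
  have f_dom: "fst f e' \<in> dom_iota1 (lend G e') (rend G e') (emeas G e')" if "e' \<in> E1 G" for e'
    using f that by (auto simp: dom_tau_def dom_iota_def dom_iota_e_def)
  have hL2: "fst h e' \<in> L2 (emeas G e')" if "e' \<in> E1 G" for e'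
    using h that by (auto simp: hilb_def)
  have iota: "iota_e G e (fst f e) \<in> W12_mu ?a ?b ?M"
    unfolding iota_e_def by (rule iota1(1)[OF f_dom[OF e]])
  have usq: "u \<in> sq_integrable (restrict_space lborel {?a<..<?b})"
    unfolding u_def by (rule W12_primitive_on(2)[OF less W12_muD(1,4)[OF iota]])
  then show ui: "set_integrable lborel {?a<..<?b} (weak_deriv ?a ?b (iota_e G e (fst f e)))"
    unfolding u_def by (rule sq_integrable_Ioo_imp_integrable)
  have hi: "rep (fst h e) \<in> sq_integrable ?M" by (rule rep_in_L2(1)[OF hL2[OF e]])
  have "has_distr_deriv ?a ?b ?M u (\<lambda>x. - rep (fst h e) x)"
    unfolding has_distr_deriv_def
  proof
    fix \<phi> assume \<phi>: "\<phi> \<in> test_fun ?a ?b"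
    have ends: "\<phi> ?a = 0" "\<phi> ?b = 0" using \<phi> by (auto simp: test_fun_def)
    define w where "w e' x = (if e' = e then of_real (deriv \<phi> x) else 0 :: 'k)" for e' x
    define v where "v e' x = (if e' = e then of_real (\<phi> x) else 0 :: 'k)" for e' x
    have prim: "primitive_on (lend G e') (rend G e') (w e') (v e')"
      and wsq: "w e' \<in> sq_integrable (restrict_space lborel {lend G e'<..<rend G e'})" if e': "e' \<in> E1 G" for e'
    proof -
      show "primitive_on (lend G e') (rend G e') (w e') (v e')"
      proof (cases "e' = e")
        case True
        then show ?thesis
          using test_fun_primitive_on[OF \<phi> less, where 'k = 'k] by (simp add: w_def[abs_def] v_def[abs_def])
      next
        case False
        then show ?thesis by (simp add: w_def[abs_def] v_def[abs_def] primitive_on_def set_integrable_const_Ioo)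
      qed
      obtain B where "\<And>x. \<bar>deriv \<phi> x\<bar> \<le> B" using test_fun_bounded[OF test_fun_deriv[OF \<phi>] less] by metis
      then have B: "norm (w e' x) \<le> max B 0" for x by (auto simp: w_def le_max_iff_disj)
      have [measurable]: "deriv \<phi> \<in> borel_measurable borel" by (rule test_fun_measurable[OF test_fun_deriv[OF \<phi>]])
      have "w e' \<in> borel_measurable borel" unfolding w_def by measurable
      then show "w e' \<in> sq_integrable (restrict_space lborel {lend G e'<..<rend G e'})"
        by (intro finite_measure.sq_integrable_bounded[OF finite_measure_Ioo _ B] measurable_restrict_space1) simp
    qed
    have less': "lend G e' < rend G e'" if "e' \<in> E1 G" for e'
      using measure_graph_edge[OF G that] by (simp add: edge_measure_def interval_measure_def interval_measure_axioms_def)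
    have vW: "v e' \<in> W12 (lend G e') (rend G e')" "continuous_on {lend G e'..rend G e'} (v e')" if "e' \<in> E1 G" for e'
      using primitive_on_W12[OF less' prim wsq] primitive_on_continuous[OF prim] that by auto
    have y: "(\<lambda>_. 0) \<in> fam (V1 G)" by (simp add: fam_def)
    define g where "g = of_edge_funs G v (\<lambda>_. 0)"
    note g = of_edge_funs[OF G y vW, folded g_def]
    have tr0: "tr G (iota G g) = (\<lambda>i. 0)"
    proof
      fix i
      show "tr G (iota G g) i = 0"
      proof (cases "i \<in> bnd_idx G")
        case True
        then consider e' where "e' \<in> E1 G" "i = Inl (e', 0)" | e' where "e' \<in> E1 G" "i = Inl (e', 1)" | x where "x \<in> V1 G" "i = Inr x"
          by (auto simp: bnd_idx_def)
        then show ?thesis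
          by cases (auto simp: g(2,3)[simplified] v_def ends tr_simps(3), simp add: g_def of_edge_funs_def)
      qed (rule tr_simps(4))
    qed
    then have "g \<in> dom_tau G X" using g(1) X by (simp add: dom_tau_def bnd_subspace_def)
    from eq[OF this] have *: "tau G L f g = hilb_inner G h g" .
    have "(LINT x:{lend G e'<..<rend G e'}|lborel. edge_deriv G (fst (iota G f)) e' x * conj_sc (edge_deriv G (fst (iota G g)) e' x))
        = (if e' = e then LINT x:{?a<..<?b}|lborel. deriv \<phi> x *\<^sub>R u x else 0)" if e': "e' \<in> E1 G" for e'
    proof -
      interpret E: edge_measure "emeas G e'" "lend G e'" "rend G e'" by (rule measure_graph_edge[OF G e'])
      have ge: "edge_deriv G (fst (iota G g)) e' = weak_deriv (lend G e') (rend G e') (E.interpolate (v e'))"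
        using e' by (simp add: edge_deriv_iota iota_e_def g_def of_edge_funs_def E.iota1_L2_class(2)[OF vW[OF e']])
      have fe: "edge_deriv G (fst (iota G f)) e' = weak_deriv (lend G e') (rend G e') (iota1 (lend G e') (rend G e') (emeas G e') (fst f e'))"
        using e' by (simp add: edge_deriv_iota iota_e_def)
      show ?thesis
        unfolding ge fe E.interpolate_orthogonality[OF E.iota1(1)[OF f_dom[OF e']] vW[OF e'] prim[OF e']]
        by (auto simp: w_def u_def iota_e_def scaleR_conv_of_real mult.commute)
    qed
    then have "tau G L f g = (\<Sum>e'\<in>E1 G. if e' = e then LINT x:{?a<..<?b}|lborel. deriv \<phi> x *\<^sub>R u x else 0)"
      unfolding tau_def tr0 by (simp add: bnd_inner_def)
    also have "\<dots> = (LINT x:{?a<..<?b}|lborel. deriv \<phi> x *\<^sub>R u x)"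
      using e measure_graph_finite(1)[OF G] by simp
    finally have tau: "tau G L f g = (LINT x:{?a<..<?b}|lborel. deriv \<phi> x *\<^sub>R u x)" .
    have "L2_inner (emeas G e') (fst h e') (fst g e') = (if e' = e then LINT x|?M. \<phi> x *\<^sub>R rep (fst h e) x else 0)" if e': "e' \<in> E1 G" for e'
    proof -
      interpret E: edge_measure "emeas G e'" "lend G e'" "rend G e'" by (rule measure_graph_edge[OF G e'])
      have "L2_inner (emeas G e') (fst h e') (fst g e') = (LINT x|emeas G e'. rep (fst h e') x * conj_sc (v e' x))"
        using L2_inner_L2_class(2)[OF E.continuous_sq_integrable[OF vW(2)[OF e']] hL2[OF e']] e'
        by (simp add: g_def of_edge_funs_def)
      then show ?thesis by (auto simp: v_def scaleR_conv_of_real mult.commute)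
    qed
    then have "hilb_inner G h g = (\<Sum>e'\<in>E1 G. if e' = e then LINT x|?M. \<phi> x *\<^sub>R rep (fst h e) x else 0)"
      unfolding hilb_inner_def by (simp add: g_def of_edge_funs_def)
    also have "\<dots> = (LINT x|?M. \<phi> x *\<^sub>R rep (fst h e) x)"
      using e measure_graph_finite(1)[OF G] by simp
    also have "\<dots> = (LINT x:{?a<..<?b}|?M. \<phi> x *\<^sub>R rep (fst h e) x)"
      unfolding set_lebesgue_integral_def
    proof (rule integral_cong_AE)
      have [measurable]: "\<phi> \<in> borel_measurable ?M" "rep (fst h e) \<in> borel_measurable ?M"
        "indicator {?a<..<?b} \<in> borel_measurable ?M"
        using measurable_M[OF test_fun_measurable[OF \<phi>]] sq_integrableD(1)[OF hi] by (auto intro: measurable_M)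
      show "(\<lambda>x. \<phi> x *\<^sub>R rep (fst h e) x) \<in> borel_measurable ?M" by measurable
      show "(\<lambda>x. indicat_real {?a<..<?b} x *\<^sub>R \<phi> x *\<^sub>R rep (fst h e) x) \<in> borel_measurable ?M"
        by (intro borel_measurable_scaleR) (auto intro: measurable_M sq_integrableD(1)[OF hi] test_fun_measurable[OF \<phi>])
      show "AE x in ?M. \<phi> x *\<^sub>R rep (fst h e) x = indicat_real {?a<..<?b} x *\<^sub>R \<phi> x *\<^sub>R rep (fst h e) x"
        using AE_in_Ioo by eventually_elim simp
    qed
    finally show "(LINT x:{?a<..<?b}|lborel. deriv \<phi> x *\<^sub>R u x) = - (LINT x:{?a<..<?b}|?M. \<phi> x *\<^sub>R - rep (fst h e) x)"
      using * tau by (simp add: set_lebesgue_integral_def)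
  qed
  then show "has_mu_deriv ?a ?b ?M (weak_deriv ?a ?b (iota_e G e (fst f e))) (\<lambda>x. - rep (fst h e) x)"
    using set_integrable_imp_L1_loc[OF ui] integrable_sq_integrable[OF hi] by (simp add: has_mu_deriv_def u_def)
qed

text \<open>
  Derivatives with respect to an edge measure are unique almost everywhere on the open interval, and the end points
  are null sets, so that \<open>mu_deriv\<close> and \<open>- h\<close> are in the same class.
\<close>

lemma H_graph_Hhat:
  fixes G :: "('v, 'e) measure_graph"
    and f h :: "('e \<Rightarrow> (real \<Rightarrow> 'k) set) \<times> ('v \<Rightarrow> 'k::{real_normed_field,euclidean_space})"
  assumes G: "measure_graph G" and X: "bnd_subspace G X" and fh: "(f, h) \<in> H_graph G X L"
  shows "fst f \<in> dom_Hhat G" "fst h = Hhat G (fst f)"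
proof -
  have f: "f \<in> dom_iota G" and h: "h \<in> hilb G"
    using fh by (auto simp: H_graph_def dom_tau_def)
  have *: "edge_mu_deriv G (fst f) e \<in> sq_integrable (emeas G e)
    \<and> L2_class (emeas G e) (\<lambda>x. - edge_mu_deriv G (fst f) e x) = fst h e"
    if e: "e \<in> E1 G" for e
  proof -
    interpret edge_measure "emeas G e" "lend G e" "rend G e" by (rule measure_graph_edge[OF G e])
    note k = H_graph_mu_deriv(1)[OF G X fh e]
    define k' where "k' = edge_mu_deriv G (fst f) e"
    note k' = mu_deriv[OF k, folded k'_def]
    have hL2: "fst h e \<in> L2 (emeas G e)" using h e by (auto simp: hilb_def)
    have "AE x in emeas G e. x \<in> {lend G e<..<rend G e} \<longrightarrow> k' x = - rep (fst h e) x"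
      using k k' by (intro has_distr_deriv_unique set_integrable_borel) (auto simp: has_mu_deriv_def)
    with AE_in_Ioo have AE: "AE x in emeas G e. - rep (fst h e) x = k' x" by eventually_elim simp
    have hn: "(\<lambda>x. - rep (fst h e) x) \<in> sq_integrable (emeas G e)"
      using sq_integrable_cmult[OF rep_in_L2(1)[OF hL2], of "-1"] by simp
    have "k' \<in> borel_measurable (emeas G e)" using k' by (auto simp: has_mu_deriv_def)
    moreover have "AE x in emeas G e. k' x = - rep (fst h e) x" using AE by eventually_elim simp
    ultimately have "k' \<in> sq_integrable (emeas G e)" by (rule sq_integrable_cong_AE[OF hn])
    moreover have "AE x in emeas G e. - k' x = rep (fst h e) x" using AE by eventually_elim (metis minus_minus)
    ultimately show ?thesis using L2_class_cong[of "\<lambda>x. - k' x"] rep_in_L2(2)[OF hL2] unfolding k'_def[symmetric] by metis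
  qed
  have "fst f \<in> (\<Pi>\<^sub>E e\<in>E1 G. dom_iota_e G e)"
    using f by (auto simp: dom_iota_def hilb_def)
  then show "fst f \<in> dom_Hhat G"
    using * H_graph_mu_deriv[OF G X fh] unfolding dom_Hhat_def Let_def by blast
  show "fst h = Hhat G (fst f)"
  proof
    fix e
    show "fst h e = Hhat G (fst f) e"
    proof (cases "e \<in> E1 G")
      case True
      then show ?thesis using * by (simp add: Hhat_def Let_def)
    next
      case False
      then show ?thesis using h by (auto simp: Hhat_def hilb_def PiE_def extensional_def)
    qed
  qed
qed

text \<open>
  The edge contributions to \<open>\<tau>(f, g) = (h | g)\<close> cancel by Green's formula. What is left depends on \<open>g\<close> only through
  its trace, which can be any element of \<open>X\<close>.
\<close>

lemma H_graph_boundary: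
  assumes G: "measure_graph G" and X: "bnd_subspace G X" and fh: "(f, h) \<in> H_graph G X L" and \<eta>: "\<eta> \<in> X"
  shows "bnd_inner G (\<lambda>i. L (tr G (iota G f)) i - str G (edge_deriv G (fst (iota G f))) i) \<eta>
    = (\<Sum>v\<in>V1 G. snd h v * conj_sc (\<eta> (Inr v)) * of_real (weight G v))"
proof -
  obtain g where g: "g \<in> dom_iota G" "tr G (iota G g) = \<eta>" "snd g = pr_V1 \<eta>"
    using prescribed_trace[OF G, of \<eta>] bnd_subspace_lin_subspace(2)[OF X] \<eta> by blast
  then have "g \<in> dom_tau G X" using \<eta> by (simp add: dom_tau_def)
  then have "tau G L f g = hilb_inner G h g" using fh by (auto simp: H_graph_def)
  then show ?thesis
    unfolding tau_eq_Hhat[OF G H_graph_Hhat(1)[OF G X fh] g(1)] hilb_inner_def g(2,3) H_graph_Hhat(2)[OF G X fh]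
    by (simp add: pr_V1_def)
qed

theorem theorem3p1:
  fixes G :: "('v, 'e) measure_graph"
    and X :: "(('v, 'e) bidx \<Rightarrow> 'k::{real_normed_field,euclidean_space}) set"
    and L :: "(('v, 'e) bidx \<Rightarrow> 'k) \<Rightarrow> (('v, 'e) bidx \<Rightarrow> 'k)"
    and \<xi> :: "'v \<Rightarrow> ('v, 'e) bidx \<Rightarrow> 'k"
  assumes "measure_graph G"
    and "bnd_subspace G X"
    and "selfadjoint_on G X L"
    and "pr_V1 ` X = fam (V1 G)"
    and "\<forall>v\<in>V1 G. \<xi> v \<in> X \<and> pr_V1 (\<xi> v) = (\<lambda>u. if u = v then 1 else 0)"
  shows "dom_H G X L =
      {f \<in> hilb G. fst f \<in> dom_Hhat G \<and> tr G (iota G f) \<in> X \<and>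
         orth_proj G (X0 X) (str G (edge_deriv G (fst (iota G f)))) =
         orth_proj G (X0 X) (L (tr G (iota G f)))} \<and>
    (\<forall>f\<in>dom_H G X L. fst (H_op G X L f) = Hhat G (fst f)) \<and>
    (\<forall>f\<in>dom_H G X L. \<forall>v\<in>V1 G. snd (H_op G X L f) v =
         (1 / weight G v) *\<^sub>R
         bnd_inner G (\<lambda>i. L (tr G (iota G f)) i - str G (edge_deriv G (fst (iota G f))) i) (\<xi> v))"
proof -
  note G = assms(1) and X = assms(2)
  note sub = bnd_subspace_lin_subspace[OF X] and fin = measure_graph_finite[OF G]
  define D where "D f = (\<lambda>i. L (tr G (iota G f)) i - str G (edge_deriv G (fst (iota G f))) i)" for f
  have \<xi>: "\<xi> v \<in> X" "\<xi> v (Inr u) = (if u = v then 1 else 0)" if "v \<in> V1 G" for u v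
    using assms(5) that by (auto simp: pr_V1_def fun_eq_iff)
  have weight: "weight G v > 0" if "v \<in> V1 G" for v
    using that G by (auto simp: V1_def measure_graph_def order.strict_iff_order)
  have vertex: "snd h v = (1 / weight G v) *\<^sub>R bnd_inner G (D f) (\<xi> v)"
    if fh: "(f, h) \<in> H_graph G X L" and v: "v \<in> V1 G" for f h v
  proof -
    have "bnd_inner G (D f) (\<xi> v) = (\<Sum>u\<in>V1 G. if u = v then snd h v * of_real (weight G v) else 0)"
      unfolding D_def H_graph_boundary[OF G X fh \<xi>(1)[OF v]]
      by (rule sum.cong) (auto simp: \<xi>(2)[OF v])
    also have "\<dots> = weight G v *\<^sub>R snd h v"
      using v fin(2) by (simp add: scaleR_conv_of_real mult.commute)
    finally show ?thesis using weight[OF v] by simp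
  qed
  have unique: "h = h'" if "(f, h) \<in> H_graph G X L" "(f, h') \<in> H_graph G X L" for f h h'
  proof (rule prod_eqI)
    show "fst h = fst h'" using H_graph_Hhat(2)[OF G X] that by metis
    have "snd h \<in> fam (V1 G)" "snd h' \<in> fam (V1 G)" using that by (auto simp: H_graph_def hilb_def)
    then show "snd h = snd h'"
      using vertex[OF that(1)] vertex[OF that(2)] by (intro ext) (metis (mono_tags, lifting) fam_def mem_Collect_eq)
  qed
  have H_op: "(f, H_op G X L f) \<in> H_graph G X L" if f: "f \<in> dom_H G X L" for f
  proof -
    obtain h where "(f, h) \<in> H_graph G X L" using f by (auto simp: dom_H_def)
    then show ?thesis unfolding H_op_def by (rule theI) (rule unique[OF _ \<open>(f, h) \<in> H_graph G X L\<close>])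
  qed
  \<comment> \<open>Equality of the projections means that the difference of the two vectors is orthogonal to the subspace.\<close>
  have orth: "orth_proj G (X0 X) (str G (edge_deriv G (fst (iota G f)))) = orth_proj G (X0 X) (L (tr G (iota G f)))
    \<longleftrightarrow> (\<forall>z\<in>X0 X. bnd_inner G (D f) z = 0)" (is "?p = ?q \<longleftrightarrow> _") for f
  proof
    note p = orth_proj[OF G sub(3,4)]
    assume eq: "?p = ?q"
    show "\<forall>z\<in>X0 X. bnd_inner G (D f) z = 0"
    proof
      fix z assume z: "z \<in> X0 X"
      have "bnd_inner G (D f) z = bnd_inner G (\<lambda>i. L (tr G (iota G f)) i - ?q i) z
          - bnd_inner G (\<lambda>i. str G (edge_deriv G (fst (iota G f))) i - ?p i) z"
        unfolding D_def bnd_inner_diff_left eq by simp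
      then show "bnd_inner G (D f) z = 0" using p(2)[OF z] by simp
    qed
  next
    assume *: "\<forall>z\<in>X0 X. bnd_inner G (D f) z = 0"
    have "bnd_inner G (\<lambda>i. str G (edge_deriv G (fst (iota G f))) i - y i) z = bnd_inner G (\<lambda>i. L (tr G (iota G f)) i - y i) z"
      if "z \<in> X0 X" for y z
      using *[rule_format, OF that] unfolding D_def bnd_inner_diff_left by simp
    then show "?p = ?q" unfolding orth_proj_def by (metis (no_types, lifting))
  qed
  have dom: "f \<in> dom_H G X L \<longleftrightarrow> f \<in> hilb G \<and> fst f \<in> dom_Hhat G \<and> tr G (iota G f) \<in> X \<and> (\<forall>z\<in>X0 X. bnd_inner G (D f) z = 0)" for f
  proof
    assume "f \<in> dom_H G X L"
    then obtain h where fh: "(f, h) \<in> H_graph G X L" by (auto simp: dom_H_def)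
    have "bnd_inner G (D f) z = 0" if z: "z \<in> X0 X" for z
    proof -
      have "z \<in> X" "z (Inr v) = 0" for v using z by (auto simp: X0_def pr_V1_def fun_eq_iff)
      then show ?thesis unfolding D_def by (simp add: H_graph_boundary[OF G X fh])
    qed
    moreover have "f \<in> hilb G" "tr G (iota G f) \<in> X"
      using fh by (auto simp: H_graph_def dom_tau_def dom_iota_def)
    ultimately show "f \<in> hilb G \<and> fst f \<in> dom_Hhat G \<and> tr G (iota G f) \<in> X \<and> (\<forall>z\<in>X0 X. bnd_inner G (D f) z = 0)"
      using H_graph_Hhat(1)[OF G X fh] by blast
  next
    assume f: "f \<in> hilb G \<and> fst f \<in> dom_Hhat G \<and> tr G (iota G f) \<in> X \<and> (\<forall>z\<in>X0 X. bnd_inner G (D f) z = 0)"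
    define y where "y v = (if v \<in> V1 G then (1 / weight G v) *\<^sub>R bnd_inner G (D f) (\<xi> v) else 0)" for v
    have h: "(Hhat G (fst f), y) \<in> hilb G"
      using Hhat_in_L2[of "fst f" G] f by (simp add: hilb_def y_def fam_def)
    have ftau: "f \<in> dom_tau G X"
      using f by (auto simp: dom_tau_def dom_iota_def dom_Hhat_def)
    have "tau G L f g = hilb_inner G (Hhat G (fst f), y) g" if g: "g \<in> dom_tau G X" for g
    proof -
      define \<eta> where "\<eta> = tr G (iota G g)"
      have \<eta>: "\<eta> \<in> X" and gi: "g \<in> dom_iota G" using g by (auto simp: dom_tau_def \<eta>_def)
      have snd_g: "snd g v = \<eta> (Inr v)" if "v \<in> V1 G" for v
        using that by (simp add: \<eta>_def tr_simps(3))
      \<comment> \<open>The part of the trace in the span of the vectors \<open>\<xi> v\<close>; the remainder vanishes on the vertices and lies in \<open>X0 X\<close>.\<close>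
      define \<zeta> where "\<zeta> = (\<lambda>i. \<Sum>v\<in>V1 G. \<eta> (Inr v) * \<xi> v i)"
      have \<zeta>: "\<zeta> \<in> X" unfolding \<zeta>_def by (rule lin_subspace_sum[OF sub(1) fin(2)]) (rule \<xi>(1))
      have "\<zeta> (Inr u) = \<eta> (Inr u)" for u
      proof (cases "u \<in> V1 G")
        case True
        have "\<zeta> (Inr u) = (\<Sum>v\<in>V1 G. if v = u then \<eta> (Inr u) else 0)"
          unfolding \<zeta>_def by (rule sum.cong) (auto simp: \<xi>(2))
        then show ?thesis using True fin(2) by simp
      next
        case False
        then have "Inr u \<notin> bnd_idx G" by (auto simp: bnd_idx_def)
        then show ?thesis using subsetD[OF sub(2) \<eta>] subsetD[OF sub(2) \<zeta>] by (simp add: fam_def)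
      qed
      then have "(\<lambda>i. \<eta> i - \<zeta> i) \<in> X0 X"
        using lin_subspace_diff[OF sub(1) \<eta> \<zeta>, of 1] by (simp add: X0_def pr_V1_def)
      then have "bnd_inner G (D f) (\<lambda>i. \<eta> i - \<zeta> i) = 0" using f by blast
      moreover have "bnd_inner G (D f) (\<lambda>i. (\<eta> i - \<zeta> i) + \<zeta> i) = bnd_inner G (D f) (\<lambda>i. \<eta> i - \<zeta> i) + bnd_inner G (D f) \<zeta>"
        by (rule bnd_inner_add_right)
      ultimately have "bnd_inner G (D f) \<eta> = bnd_inner G (D f) \<zeta>" by simp
      also have "\<dots> = (\<Sum>v\<in>V1 G. conj_sc (\<eta> (Inr v)) * bnd_inner G (D f) (\<xi> v))"
        unfolding \<zeta>_def by (rule bnd_inner_sum_right[OF fin(2)])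
      also have "\<dots> = (\<Sum>v\<in>V1 G. y v * conj_sc (snd g v) * of_real (weight G v))"
      proof (rule sum.cong[OF refl])
        fix v assume v: "v \<in> V1 G"
        have "y v * of_real (weight G v) = bnd_inner G (D f) (\<xi> v)"
          using weight[OF v] v by (simp add: y_def scaleR_conv_of_real)
        then show "conj_sc (\<eta> (Inr v)) * bnd_inner G (D f) (\<xi> v) = y v * conj_sc (snd g v) * of_real (weight G v)"
          by (simp add: snd_g[OF v] ac_simps flip: \<open>y v * of_real (weight G v) = bnd_inner G (D f) (\<xi> v)\<close>)
      qed
      finally show ?thesis
        using f unfolding hilb_inner_def by (subst tau_eq_Hhat[OF G _ gi]) (simp_all add: D_def \<eta>_def)
    qed
    then have "(f, (Hhat G (fst f), y)) \<in> H_graph G X L" using h ftau by (simp add: H_graph_def)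
    then show "f \<in> dom_H G X L" by (auto simp: dom_H_def)
  qed
  show ?thesis
  proof (intro conjI ballI)
    show "dom_H G X L = {f \<in> hilb G. fst f \<in> dom_Hhat G \<and> tr G (iota G f) \<in> X \<and>
         orth_proj G (X0 X) (str G (edge_deriv G (fst (iota G f)))) =
         orth_proj G (X0 X) (L (tr G (iota G f)))}"
      unfolding orth using dom by blast
    fix f assume f: "f \<in> dom_H G X L"
    show "fst (H_op G X L f) = Hhat G (fst f)" by (rule H_graph_Hhat(2)[OF G X H_op[OF f]])
    fix v assume "v \<in> V1 G"
    then show "snd (H_op G X L f) v = (1 / weight G v) *\<^sub>R
         bnd_inner G (\<lambda>i. L (tr G (iota G f)) i - str G (edge_deriv G (fst (iota G f))) i) (\<xi> v)"
      using vertex[OF H_op[OF f]] by (simp add: D_def)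
  qed
qed

end
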